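(* Let $(b,c)$ be a weighted graph over $V$ and $m$ a measure on $V$. Then for every $\alpha>0$ the function $w=\int_0^\infty\alpha e^{-t\alpha}(1-M_t)\,dt$ satisfies $0\le w\le1$, solves $(\widetilde L+\alpha)w=0$, and is the largest function $l$ with $0\le l\le1$ and $(\widetilde L+\alpha)l\le0$. Moreover the following are equivalent: (i) for every $\alpha>0$ there is a nontrivial, nonnegative, bounded $l$ with $(\widetilde L+\alpha)l\le0$; (ii) for every $\alpha>0$ there is a nontrivial bounded $l$ with $(\widetilde L+\alpha)l=0$; (iii) for every $\alpha>0$ there is a nontrivial, nonnegative, bounded $l$ with $(\widetilde L+\alpha)l=0$; (iv) $w$ is nontrivial (for some, equivalently every, $\alpha>0$); (v) $M_t(x)<1$ for some $x\in V$ and some $t>0$; (vi) there is a nontrivial, bounded, nonnegative solution $N:[0,\infty)\times V\to[0,\infty)$ of the heat equation $\frac{d}{dt}N_t=-\widetilde LN_t$ with $N_0\equiv0$.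
   Context: Let $V$ be a countably infinite set. A weighted graph over $V$ is a pair $(b,c)$ of maps $b:V\times V\to[0,\infty)$ and $c:V\to[0,\infty)$ with $b(x,x)=0$, $b(x,y)=b(y,x)$ and $\sum_{y\in V}b(x,y)<\infty$ for all $x,y\in V$. A measure on $V$ is a map $m:V\to(0,\infty)$. $Q=Q_{b,c,m}$ is the closure in $\ell^2(V,m)$ of the form $u\mapsto\frac12\sum_{x,y}b(x,y)(u(x)-u(y))^2+\sum_x c(x)u(x)^2$ restricted to finitely supported functions, and $L$ is its associated nonnegative selfadjoint operator; the semigroup $e^{-tL}$ is positivity preserving and Markovian, and for $f:V\to[0,\infty]$ we set $e^{-tL}f(x)=\sup\{e^{-tL}g(x):g\text{ finitely supported},0\le g\le f\}$. Define $M_t(x)=e^{-tL}1(x)+\int_0^t(e^{-sL}\tfrac{c}{m})(x)\,ds$ for $t\ge0$, $x\in V$ (one has $0\le M_t\le1$). Let $\widetilde F=\{u:\sum_y b(x,y)|u(y)|<\infty\ \forall x\}$ and $\widetilde Lu(x)=\frac1{m(x)}\sum_y b(x,y)(u(x)-u(y))+\frac{c(x)}{m(x)}u(x)$; bounded functions lie in $\widetilde F$. A solution of the heat equation is a function $N:[0,\infty)\times V\to\mathbb R$ such that for each $x$, $t\mapsto N_t(x)$ is continuous on $[0,\infty)$ and differentiable on $(0,\infty)$, $N_t\in\widetilde F$ for $t>0$, and $\frac{d}{dt}N_t(x)=-\widetilde LN_t(x)$ for all $t>0$, $x\in V$. *)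

theory Defs
  imports "HOL-Analysis.Analysis"
begin

definition weighted_graph :: "('v \<Rightarrow> 'v \<Rightarrow> real) \<Rightarrow> ('v \<Rightarrow> real) \<Rightarrow> bool" where
  "weighted_graph b c \<longleftrightarrow>
     (\<forall>x y. 0 \<le> b x y \<and> b x y = b y x) \<and> (\<forall>x. b x x = 0) \<and> (\<forall>x. 0 \<le> c x) \<and>
     (\<forall>x. b x summable_on UNIV)"

definition is_measure_on :: "('v \<Rightarrow> real) \<Rightarrow> bool" where
  "is_measure_on m \<longleftrightarrow> (\<forall>x. 0 < m x)"

definition in_l2 :: "('v \<Rightarrow> real) \<Rightarrow> ('v \<Rightarrow> real) \<Rightarrow> bool" where
  "in_l2 m u \<longleftrightarrow> (\<lambda>x. m x * (u x)\<^sup>2) summable_on UNIV"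

definition l2_inner :: "('v \<Rightarrow> real) \<Rightarrow> ('v \<Rightarrow> real) \<Rightarrow> ('v \<Rightarrow> real) \<Rightarrow> real" where
  "l2_inner m u v = (\<Sum>\<^sub>\<infinity>x. m x * u x * v x)"

definition l2_norm :: "('v \<Rightarrow> real) \<Rightarrow> ('v \<Rightarrow> real) \<Rightarrow> real" where
  "l2_norm m u = sqrt (\<Sum>\<^sub>\<infinity>x. m x * (u x)\<^sup>2)"

definition fin_supp :: "('v \<Rightarrow> real) \<Rightarrow> bool" where
  "fin_supp u \<longleftrightarrow> finite {x. u x \<noteq> 0}"

definition energy_finite :: "('v \<Rightarrow> 'v \<Rightarrow> real) \<Rightarrow> ('v \<Rightarrow> real) \<Rightarrow> ('v \<Rightarrow> real) \<Rightarrow> bool" where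
  "energy_finite b c u \<longleftrightarrow>
     (\<lambda>(x,y). b x y * (u x - u y)\<^sup>2) summable_on UNIV \<and> (\<lambda>x. c x * (u x)\<^sup>2) summable_on UNIV"

definition gen_form :: "('v \<Rightarrow> 'v \<Rightarrow> real) \<Rightarrow> ('v \<Rightarrow> real) \<Rightarrow> ('v \<Rightarrow> real) \<Rightarrow> ('v \<Rightarrow> real) \<Rightarrow> real" where
  "gen_form b c u v =
     (1/2) * (\<Sum>\<^sub>\<infinity>(x,y). b x y * (u x - u y) * (v x - v y)) + (\<Sum>\<^sub>\<infinity>x. c x * u x * v x)"

text \<open>Domain of the closure Q: functions in l2 of finite energy that are limits of finitely
  supported functions in the form norm.\<close>
definition form_domain :: "('v \<Rightarrow> 'v \<Rightarrow> real) \<Rightarrow> ('v \<Rightarrow> real) \<Rightarrow> ('v \<Rightarrow> real) \<Rightarrow> ('v \<Rightarrow> real) \<Rightarrow> bool" where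
  "form_domain b c m u \<longleftrightarrow> in_l2 m u \<and> energy_finite b c u \<and>
     (\<exists>\<phi>::nat \<Rightarrow> 'v \<Rightarrow> real. (\<forall>n. fin_supp (\<phi> n)) \<and>
        (\<lambda>n. l2_norm m (\<lambda>x. \<phi> n x - u x)) \<longlonglongrightarrow> 0 \<and>
        (\<lambda>n. gen_form b c (\<lambda>x. \<phi> n x - u x) (\<lambda>x. \<phi> n x - u x)) \<longlonglongrightarrow> 0)"

definition L_rep :: "('v \<Rightarrow> 'v \<Rightarrow> real) \<Rightarrow> ('v \<Rightarrow> real) \<Rightarrow> ('v \<Rightarrow> real) \<Rightarrow> ('v \<Rightarrow> real) \<Rightarrow> ('v \<Rightarrow> real) \<Rightarrow> bool" where
  "L_rep b c m u w \<longleftrightarrow> in_l2 m w \<and> (\<forall>v. form_domain b c m v \<longrightarrow> gen_form b c u v = l2_inner m w v)"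

definition L_dom :: "('v \<Rightarrow> 'v \<Rightarrow> real) \<Rightarrow> ('v \<Rightarrow> real) \<Rightarrow> ('v \<Rightarrow> real) \<Rightarrow> ('v \<Rightarrow> real) \<Rightarrow> bool" where
  "L_dom b c m u \<longleftrightarrow> form_domain b c m u \<and> (\<exists>w. L_rep b c m u w)"

definition L_op :: "('v \<Rightarrow> 'v \<Rightarrow> real) \<Rightarrow> ('v \<Rightarrow> real) \<Rightarrow> ('v \<Rightarrow> real) \<Rightarrow> ('v \<Rightarrow> real) \<Rightarrow> ('v \<Rightarrow> real)" where
  "L_op b c m u = (THE w. L_rep b c m u w)"

text \<open>t \<mapsto> U t is the (unique) strong solution in l2 of U' = -L U, U 0 = f, on [0,\<infinity>);
  for f in l2 this is exactly t \<mapsto> e^{-tL} f.\<close>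
definition sg_orbit :: "('v \<Rightarrow> 'v \<Rightarrow> real) \<Rightarrow> ('v \<Rightarrow> real) \<Rightarrow> ('v \<Rightarrow> real) \<Rightarrow> ('v \<Rightarrow> real)
    \<Rightarrow> (real \<Rightarrow> 'v \<Rightarrow> real) \<Rightarrow> bool" where
  "sg_orbit b c m f U \<longleftrightarrow> U 0 = f \<and> (\<forall>t\<ge>0. in_l2 m (U t)) \<and>
     (\<forall>t\<ge>0. ((\<lambda>s. l2_norm m (\<lambda>x. U s x - U t x)) \<longlongrightarrow> 0) (at t within {0..})) \<and>
     (\<forall>t>0. L_dom b c m (U t) \<and>
        ((\<lambda>h. l2_norm m (\<lambda>x. (U (t + h) x - U t x) / h + L_op b c m (U t) x)) \<longlongrightarrow> 0) (at 0))"

definition sg :: "('v \<Rightarrow> 'v \<Rightarrow> real) \<Rightarrow> ('v \<Rightarrow> real) \<Rightarrow> ('v \<Rightarrow> real) \<Rightarrow> real \<Rightarrow> ('v \<Rightarrow> real) \<Rightarrow> ('v \<Rightarrow> real)" where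
  "sg b c m t f = (THE g. \<exists>U. sg_orbit b c m f U \<and> U t = g)"

definition sg_ext :: "('v \<Rightarrow> 'v \<Rightarrow> real) \<Rightarrow> ('v \<Rightarrow> real) \<Rightarrow> ('v \<Rightarrow> real) \<Rightarrow> real \<Rightarrow> ('v \<Rightarrow> real) \<Rightarrow> 'v \<Rightarrow> ennreal" where
  "sg_ext b c m t f x =
     (SUP g \<in> {g. fin_supp g \<and> (\<forall>y. 0 \<le> g y \<and> g y \<le> f y)}. ennreal (sg b c m t g x))"

definition Mfun :: "('v \<Rightarrow> 'v \<Rightarrow> real) \<Rightarrow> ('v \<Rightarrow> real) \<Rightarrow> ('v \<Rightarrow> real) \<Rightarrow> real \<Rightarrow> 'v \<Rightarrow> real" where
  "Mfun b c m t x = enn2real (sg_ext b c m t (\<lambda>_. 1) x +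
      (\<integral>\<^sup>+ s. indicator {0..t} s * sg_ext b c m s (\<lambda>y. c y / m y) x \<partial>lborel))"

definition wfun :: "('v \<Rightarrow> 'v \<Rightarrow> real) \<Rightarrow> ('v \<Rightarrow> real) \<Rightarrow> ('v \<Rightarrow> real) \<Rightarrow> real \<Rightarrow> 'v \<Rightarrow> real" where
  "wfun b c m \<alpha> x = (LBINT t:{0..}. \<alpha> * exp (- (t * \<alpha>)) * (1 - Mfun b c m t x))"

definition Ftilde :: "('v \<Rightarrow> 'v \<Rightarrow> real) \<Rightarrow> ('v \<Rightarrow> real) \<Rightarrow> bool" where
  "Ftilde b u \<longleftrightarrow> (\<forall>x. (\<lambda>y. b x y * \<bar>u y\<bar>) summable_on UNIV)"

definition Ltilde :: "('v \<Rightarrow> 'v \<Rightarrow> real) \<Rightarrow> ('v \<Rightarrow> real) \<Rightarrow> ('v \<Rightarrow> real) \<Rightarrow> ('v \<Rightarrow> real) \<Rightarrow> 'v \<Rightarrow> real" where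
  "Ltilde b c m u x = (1 / m x) * (\<Sum>\<^sub>\<infinity>y. b x y * (u x - u y)) + (c x / m x) * u x"

definition heat_solution :: "('v \<Rightarrow> 'v \<Rightarrow> real) \<Rightarrow> ('v \<Rightarrow> real) \<Rightarrow> ('v \<Rightarrow> real) \<Rightarrow> (real \<Rightarrow> 'v \<Rightarrow> real) \<Rightarrow> bool" where
  "heat_solution b c m N \<longleftrightarrow>
     (\<forall>x. continuous_on {0..} (\<lambda>t. N t x)) \<and>
     (\<forall>t>0. Ftilde b (N t)) \<and>
     (\<forall>t>0. \<forall>x. ((\<lambda>s. N s x) has_real_derivative (- Ltilde b c m (N t) x)) (at t))"

end

theory Submission
  imports Defs
begin

text \<open>
  Exhaust V by finite sets X n. The heat flow of the Dirichlet restriction of the formal operator to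
  X n is a matrix exponential. By minimum principles it is positive and increasing in n, and for
  the energies (L^k u, u), whose derivative along the flow is -2 (L^(k+1) u, u), there are decay
  estimates that do not depend on n. Hence the monotone limit is a strong solution in l2 and,
  by uniqueness, the semigroup.

  The function N = 1 - M is then the decreasing limit of the solutions of the heat equation on X n
  with initial value 0 and value 1 off X n. Comparison with these makes N the largest solution
  with values in [0, 1] and initial value 0. Its Laplace transform w is the limit of the solutions of
  the resolvent equation on X n with value 1 off X n, and is therefore the largest bounded
  subsolution. All the equivalences say that N does not vanish.
\<close>

section \<open>Sums and weighted square summable functions\<close>

text \<open>The semigroup is given only as the unique strong solution of an l2 initial value
  problem, so \<open>sg\<close> has no usable value until a solution has been exhibited. The
  definition of \<open>sg_ext\<close> evaluates it only at nonnegative finitely supported data, for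
  which monotone approximation is available. The obstacle is that pointwise convergence gives
  neither membership in the domain of L nor differentiability in l2. Both need bounds on L u and on
  L^2 u along the finite flows that do not see the size of X n; the energy estimates supply them for
  t > 0. They blow up at t = 0, so continuity there needs its own argument.

  On the infinite vertex set no minimum principle for bounded functions is at hand: its failure is
  what the theorem measures. Hence every comparison takes place on a finite set, with 1 as the
  largest boundary value that a function bounded by 1 can have. The term with c/m enters M because
  \<open>Ltilde\<close> maps the constant 1 to c/m; with it, 1 - M satisfies the homogeneous heat
  equation.\<close>

lemma tendsto_infsum_dominated:
  fixes f :: "'i \<Rightarrow> 'a \<Rightarrow> real"
  assumes a: "a summable_on UNIV" and le: "\<forall>\<^sub>F i in F. \<forall>y. \<bar>f i y\<bar> \<le> a y"
    and lim: "\<And>y. ((\<lambda>i. f i y) \<longlongrightarrow> g y) F"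
  shows "((\<lambda>i. \<Sum>\<^sub>\<infinity>y. f i y) \<longlongrightarrow> (\<Sum>\<^sub>\<infinity>y. g y)) F"
proof (cases "F = bot")
  case False
  have ga: "\<bar>g y\<bar> \<le> a y" for y
    using False lim le by (intro tendsto_upperbound[OF tendsto_rabs[OF lim]])
      (auto elim: eventually_mono)
  have gs: "g summable_on UNIV"
    using summable_on_comparison_test[OF a, of "\<lambda>y. \<bar>g y\<bar>"] ga
    by (simp add: summable_on_iff_abs_summable_on_real[of g])
  \<comment> \<open>The finite partial sums converge uniformly in those i for which the domination
    holds, so the limit along F and the limit over finite sets may be exchanged. F is kept general
    because it will be a sequence, a time tending to a point, or the filter of finite
    subsets.\<close>
  have "uniform_limit {i. \<forall>y. \<bar>f i y\<bar> \<le> a y} (\<lambda>X i. \<Sum>y\<in>X. f i y) (\<lambda>i. \<Sum>\<^sub>\<infinity>y\<in>UNIV. f i y)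
      (finite_subsets_at_top UNIV)"
    by (rule Weierstrass_m_test_general[OF _ a]) auto
  then show ?thesis
    using False gs le
    by (intro swap_uniform_limit'[where F = "finite_subsets_at_top UNIV"
          and S = "{i. \<forall>y. \<bar>f i y\<bar> \<le> a y}" and g = "\<lambda>X. \<Sum>y\<in>X. g y"])
       (auto intro!: tendsto_sum lim infsum_tendsto)
qed auto

text \<open>Fatou's lemma for series: each finite partial sum of g is a limit of partial sums of
  \<open>f n\<close>, and these are at most \<open>a n\<close>. The bound may move with n because
  for energies it is itself only known to converge.\<close>

lemma infsum_fatou:
  fixes f :: "nat \<Rightarrow> 'a \<Rightarrow> real"
  assumes lim: "\<And>x. (\<lambda>n. f n x) \<longlonglongrightarrow> g x" and nn: "\<And>n x. 0 \<le> f n x"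
    and s: "\<forall>\<^sub>F n in sequentially. f n summable_on UNIV \<and> infsum (f n) UNIV \<le> a n"
    and a: "a \<longlonglongrightarrow> A"
  shows "g summable_on UNIV" and "infsum g UNIV \<le> A"
proof -
  have g0: "0 \<le> g x" for x
    using LIMSEQ_le_const[OF lim] nn by blast
  have *: "sum g F \<le> A" if "finite F" for F
  proof (rule tendsto_le[OF sequentially_bot a])
    show "(\<lambda>n. sum (f n) F) \<longlonglongrightarrow> sum g F" by (intro tendsto_sum lim)
    show "\<forall>\<^sub>F n in sequentially. sum (f n) F \<le> a n"
      using s by eventually_elim (metis finite_sum_le_infsum that nn order_trans subset_UNIV)
  qed
  show gs: "g summable_on UNIV"
    using g0 * by (intro nonneg_bdd_above_summable_on) (auto intro!: bdd_aboveI2[where M = A])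
  show "infsum g UNIV \<le> A"
    using * by (intro infsum_le_finite_sums gs) auto
qed

text \<open>Weights are allowed to vanish, so that one theory covers the measure m, the killing
  weight c and the edge weight on ordered pairs. The price is that \<open>l2_norm\<close> is only a
  seminorm.\<close>

locale weight =
  fixes \<mu> :: "'i \<Rightarrow> real"
  assumes weight_nonneg [simp]: "\<And>i. 0 \<le> \<mu> i"
begin

lemma in_l2_prod_summable:
  assumes "in_l2 \<mu> u" "in_l2 \<mu> v"
  shows "(\<lambda>i. \<mu> i * u i * v i) summable_on UNIV"
proof -
  have s: "(\<lambda>i. \<mu> i * (u i)\<^sup>2 + \<mu> i * (v i)\<^sup>2) summable_on UNIV"
    using assms unfolding in_l2_def by (rule summable_on_add)
  have le: "\<bar>\<mu> i * u i * v i\<bar> \<le> \<mu> i * (u i)\<^sup>2 + \<mu> i * (v i)\<^sup>2" for i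
  proof -
    have "\<bar>u i * v i\<bar> \<le> (u i)\<^sup>2 + (v i)\<^sup>2"
      using sum_squares_bound[of "\<bar>u i\<bar>" "\<bar>v i\<bar>"] abs_ge_zero[of "u i * v i"]
      unfolding abs_mult power2_abs by linarith
    from mult_left_mono[OF this weight_nonneg[of i]] show ?thesis
      using weight_nonneg[of i] by (simp add: abs_mult distrib_left mult.assoc)
  qed
  have "(\<lambda>i. norm (\<mu> i * u i * v i)) summable_on UNIV"
    using le by (intro summable_on_comparison_test[OF s]) auto
  then show ?thesis by (rule abs_summable_summable)
qed

lemma in_l2_scale: "in_l2 \<mu> u \<Longrightarrow> in_l2 \<mu> (\<lambda>i. a * u i)"
  unfolding in_l2_def
  using summable_on_cmult_right[of "\<lambda>i. \<mu> i * (u i)\<^sup>2" UNIV "a\<^sup>2"]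
  by (simp add: power_mult_distrib mult_ac)

lemma in_l2_add:
  assumes "in_l2 \<mu> u" "in_l2 \<mu> v"
  shows "in_l2 \<mu> (\<lambda>i. u i + v i)"
proof -
  have "(\<lambda>i. \<mu> i * (u i)\<^sup>2 + 2 * (\<mu> i * u i * v i) + \<mu> i * (v i)\<^sup>2) summable_on UNIV"
    using assms in_l2_prod_summable[OF assms] unfolding in_l2_def
    by (intro summable_on_add summable_on_cmult_right)
  then show ?thesis by (simp add: in_l2_def power2_eq_square algebra_simps)
qed

lemma in_l2_diff:
  assumes "in_l2 \<mu> u" "in_l2 \<mu> v"
  shows "in_l2 \<mu> (\<lambda>i. u i - v i)"
  using in_l2_add[OF assms(1) in_l2_scale[OF assms(2), of "-1"]] by simp

lemma in_l2_mono:
  assumes "in_l2 \<mu> v" "\<And>i. \<bar>u i\<bar> \<le> \<bar>v i\<bar>"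
  shows "in_l2 \<mu> u"
  using assms unfolding in_l2_def
  by (elim summable_on_comparison_test) (auto intro!: mult_left_mono simp: abs_le_square_iff)

lemma l2_inner_add_left:
  "\<lbrakk>in_l2 \<mu> u; in_l2 \<mu> v; in_l2 \<mu> w\<rbrakk> \<Longrightarrow>
    l2_inner \<mu> (\<lambda>i. u i + v i) w = l2_inner \<mu> u w + l2_inner \<mu> v w"
  unfolding l2_inner_def
  by (subst infsum_add[symmetric]) (simp_all add: in_l2_prod_summable distrib_left distrib_right)

lemma l2_inner_scale_left: "l2_inner \<mu> (\<lambda>i. a * u i) v = a * l2_inner \<mu> u v"
  unfolding l2_inner_def by (subst infsum_cmult_right'[symmetric]) (auto simp: mult_ac)

lemma l2_inner_diff_left:
  "\<lbrakk>in_l2 \<mu> u; in_l2 \<mu> v; in_l2 \<mu> w\<rbrakk> \<Longrightarrow>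
    l2_inner \<mu> (\<lambda>i. u i - v i) w = l2_inner \<mu> u w - l2_inner \<mu> v w"
  using l2_inner_add_left[of u "\<lambda>i. - 1 * v i" w] in_l2_scale[of v "- 1"]
    l2_inner_scale_left[of "- 1" v w] by simp

lemma l2_inner_commute: "l2_inner \<mu> u v = l2_inner \<mu> v u"
  by (simp add: l2_inner_def mult_ac)

lemma l2_inner_add_right:
  "\<lbrakk>in_l2 \<mu> u; in_l2 \<mu> v; in_l2 \<mu> w\<rbrakk> \<Longrightarrow>
    l2_inner \<mu> w (\<lambda>i. u i + v i) = l2_inner \<mu> w u + l2_inner \<mu> w v"
  using l2_inner_add_left by (simp add: l2_inner_commute[of w])

lemma l2_inner_scale_right: "l2_inner \<mu> u (\<lambda>i. a * v i) = a * l2_inner \<mu> u v"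
  using l2_inner_scale_left by (simp add: l2_inner_commute[of u])

lemma l2_inner_diff_right:
  "\<lbrakk>in_l2 \<mu> u; in_l2 \<mu> v; in_l2 \<mu> w\<rbrakk> \<Longrightarrow>
    l2_inner \<mu> w (\<lambda>i. u i - v i) = l2_inner \<mu> w u - l2_inner \<mu> w v"
  using l2_inner_diff_left by (simp add: l2_inner_commute[of w])

lemma l2_inner_self: "l2_inner \<mu> u u = (l2_norm \<mu> u)\<^sup>2"
  unfolding l2_inner_def l2_norm_def
  by (subst real_sqrt_pow2) (auto intro!: infsum_nonneg simp: mult.assoc simp flip: power2_eq_square)

lemma l2_norm_nonneg [simp]: "0 \<le> l2_norm \<mu> u"
  unfolding l2_norm_def by (auto intro!: infsum_nonneg)

lemma l2_norm_le:
  assumes "in_l2 \<mu> v" "\<And>i. \<bar>u i\<bar> \<le> \<bar>v i\<bar>"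
  shows "l2_norm \<mu> u \<le> l2_norm \<mu> v"
  unfolding l2_norm_def
  using assms in_l2_mono[OF assms]
  by (auto simp: in_l2_def abs_le_square_iff intro!: infsum_mono mult_left_mono weight_nonneg)

lemma l2_norm_scale: "l2_norm \<mu> (\<lambda>i. a * u i) = \<bar>a\<bar> * l2_norm \<mu> u"
proof -
  have "(\<Sum>\<^sub>\<infinity>i. \<mu> i * (a * u i)\<^sup>2) = a\<^sup>2 * (\<Sum>\<^sub>\<infinity>i. \<mu> i * (u i)\<^sup>2)"
    by (subst infsum_cmult_right'[symmetric]) (auto simp: power_mult_distrib mult_ac)
  then show ?thesis by (simp add: l2_norm_def real_sqrt_mult)
qed

lemma l2_norm_sq: "(l2_norm \<mu> u)\<^sup>2 = (\<Sum>\<^sub>\<infinity>i. \<mu> i * (u i)\<^sup>2)"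
  unfolding l2_inner_self[symmetric] by (simp add: l2_inner_def power2_eq_square mult.assoc)

lemma l2_norm_eq_0D:
  assumes "in_l2 \<mu> u" "l2_norm \<mu> u = 0" "\<mu> i \<noteq> 0"
  shows "u i = 0"
proof -
  have "(\<Sum>\<^sub>\<infinity>i. \<mu> i * (u i)\<^sup>2) = 0" using assms(2) l2_norm_sq[of u] by simp
  then have "\<mu> i * (u i)\<^sup>2 = 0"
    using assms(1) unfolding in_l2_def by (intro nonneg_infsum_le_0D[of "\<lambda>i. \<mu> i * (u i)\<^sup>2" UNIV]) auto
  then show ?thesis using assms(3) by simp
qed

lemma l2_norm_add_sq:
  assumes "in_l2 \<mu> u" "in_l2 \<mu> v"
  shows "(l2_norm \<mu> (\<lambda>i. u i + v i))\<^sup>2 = (l2_norm \<mu> u)\<^sup>2 + 2 * l2_inner \<mu> u v + (l2_norm \<mu> v)\<^sup>2"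
  using assms in_l2_add[OF assms]
  using l2_inner_commute[of v u]
  by (simp add: l2_inner_add_left l2_inner_add_right flip: l2_inner_self)

lemma l2_norm_diff_sq:
  assumes "in_l2 \<mu> u" "in_l2 \<mu> v"
  shows "(l2_norm \<mu> (\<lambda>i. u i - v i))\<^sup>2 = (l2_norm \<mu> u)\<^sup>2 - 2 * l2_inner \<mu> u v + (l2_norm \<mu> v)\<^sup>2"
  using assms in_l2_diff[OF assms]
  using l2_inner_commute[of v u]
  by (simp add: l2_inner_diff_left l2_inner_diff_right flip: l2_inner_self)

lemma l2_cauchy_schwarz:
  assumes "in_l2 \<mu> u" "in_l2 \<mu> v"
  shows "\<bar>l2_inner \<mu> u v\<bar> \<le> l2_norm \<mu> u * l2_norm \<mu> v"
proof -
  define a b where "a = l2_norm \<mu> u" and "b = l2_norm \<mu> v"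
  have ab: "0 \<le> a" "0 \<le> b" by (auto simp: a_def b_def)
  have *: "0 \<le> s\<^sup>2 * a\<^sup>2 + 2 * s * l2_inner \<mu> u v * r + r\<^sup>2 * b\<^sup>2" for s r
  proof -
    have "0 \<le> (l2_norm \<mu> (\<lambda>i. s * u i + r * v i))\<^sup>2" by simp
    also have "\<dots> = s\<^sup>2 * a\<^sup>2 + 2 * s * l2_inner \<mu> u v * r + r\<^sup>2 * b\<^sup>2"
      using l2_norm_add_sq[OF in_l2_scale[OF assms(1), of s] in_l2_scale[OF assms(2), of r]]
      by (simp add: l2_norm_scale l2_inner_scale_left l2_inner_scale_right power_mult_distrib
          a_def b_def)
    finally show ?thesis .
  qed
  have "(l2_inner \<mu> u v)\<^sup>2 \<le> (a * b)\<^sup>2"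
  \<comment> \<open>The quadratic form in (s, r) from the previous step is nonnegative. If b = 0, it
    would take the value -1 at the r chosen below; otherwise s = b^2 and r = - (u, v) turn it into
    b^2 times the discriminant.\<close>
  proof (cases "b = 0")
    case True
    have "l2_inner \<mu> u v = 0"
    proof (rule ccontr)
      assume "l2_inner \<mu> u v \<noteq> 0"
      then show False
        using *[of 1 "- (a\<^sup>2 + 1) / (2 * l2_inner \<mu> u v)"] True by (simp add: field_simps)
    qed
    then show ?thesis by simp
  next
    case False
    then have "b\<^sup>2 > 0" by simp
    moreover have "0 \<le> b\<^sup>2 * ((a * b)\<^sup>2 - (l2_inner \<mu> u v)\<^sup>2)"
      using *[of "b\<^sup>2" "- l2_inner \<mu> u v"] by (simp add: power2_eq_square algebra_simps)
    ultimately show ?thesis by (simp add: zero_le_mult_iff)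
  qed
  then have "\<bar>l2_inner \<mu> u v\<bar> \<le> \<bar>a * b\<bar>" by (simp only: abs_le_square_iff)
  then show ?thesis using ab by (simp add: a_def b_def)
qed

lemma l2_norm_triangle:
  assumes "in_l2 \<mu> u" "in_l2 \<mu> v"
  shows "l2_norm \<mu> (\<lambda>i. u i + v i) \<le> l2_norm \<mu> u + l2_norm \<mu> v"
proof -
  have "(l2_norm \<mu> (\<lambda>i. u i + v i))\<^sup>2 \<le> (l2_norm \<mu> u + l2_norm \<mu> v)\<^sup>2"
    using l2_cauchy_schwarz[OF assms] l2_norm_add_sq[OF assms] by (simp add: power2_sum)
  then show ?thesis by (rule power2_le_imp_le) simp
qed

lemma l2_norm_minus_commute: "l2_norm \<mu> (\<lambda>i. u i - v i) = l2_norm \<mu> (\<lambda>i. v i - u i)"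
  by (simp add: l2_norm_def power2_commute)

lemma l2_norm_triangle_diff:
  assumes "in_l2 \<mu> u" "in_l2 \<mu> v"
  shows "l2_norm \<mu> u \<le> l2_norm \<mu> (\<lambda>i. u i - v i) + l2_norm \<mu> v"
  using l2_norm_triangle[OF in_l2_diff[OF assms] assms(2)] by simp

lemma l2_norm_fatou:
  assumes lim: "\<And>i. (\<lambda>n. f n i) \<longlonglongrightarrow> g i"
    and s: "\<forall>\<^sub>F n in sequentially. in_l2 \<mu> (f n) \<and> l2_norm \<mu> (f n) \<le> B"
  shows "in_l2 \<mu> g" "l2_norm \<mu> g \<le> B"
proof -
  obtain n where "l2_norm \<mu> (f n) \<le> B" using s by (auto simp: eventually_sequentially)
  then have B: "0 \<le> B" using l2_norm_nonneg order_trans by blast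
  have 1: "\<And>x. (\<lambda>n. \<mu> x * (f n x)\<^sup>2) \<longlonglongrightarrow> \<mu> x * (g x)\<^sup>2" by (intro tendsto_intros lim)
  have 2: "\<forall>\<^sub>F n in sequentially. (\<lambda>x. \<mu> x * (f n x)\<^sup>2) summable_on UNIV \<and> (\<Sum>\<^sub>\<infinity>x. \<mu> x * (f n x)\<^sup>2) \<le> B\<^sup>2"
    using s by eventually_elim (auto simp: in_l2_def l2_norm_def real_sqrt_le_iff sqrt_le_D)
  note F = infsum_fatou[OF 1 _ 2 tendsto_const]
  show "in_l2 \<mu> g" using F(1) by (simp add: in_l2_def weight_nonneg)
  have "(\<Sum>\<^sub>\<infinity>x. \<mu> x * (g x)\<^sup>2) \<le> B\<^sup>2" using F(2) by (simp add: weight_nonneg)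
  then show "l2_norm \<mu> g \<le> B" using B by (simp add: l2_norm_def real_le_lsqrt)
qed

lemma l2_norm_tendsto_dominated:
  assumes h: "in_l2 \<mu> h" and le: "\<forall>\<^sub>F n in F. \<forall>i. \<bar>f n i\<bar> \<le> \<bar>h i\<bar>"
    and lim: "\<And>i. ((\<lambda>n. f n i) \<longlongrightarrow> 0) F"
  shows "((\<lambda>n. l2_norm \<mu> (f n)) \<longlongrightarrow> 0) F"
proof -
  have 1: "((\<lambda>n. \<mu> i * (f n i)\<^sup>2) \<longlongrightarrow> \<mu> i * 0\<^sup>2) F" for i
    by (intro tendsto_intros lim)
  have 2: "\<forall>\<^sub>F n in F. \<forall>i. \<bar>\<mu> i * (f n i)\<^sup>2\<bar> \<le> \<mu> i * (h i)\<^sup>2"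
    using le by eventually_elim (auto simp: abs_mult abs_le_square_iff intro!: mult_left_mono)
  have "((\<lambda>n. \<Sum>\<^sub>\<infinity>i. \<mu> i * (f n i)\<^sup>2) \<longlongrightarrow> (\<Sum>\<^sub>\<infinity>i. \<mu> i * 0\<^sup>2)) F"
    using h unfolding in_l2_def by (rule tendsto_infsum_dominated[OF _ 2 1])
  from tendsto_real_sqrt[OF this] show ?thesis by (simp add: l2_norm_def)
qed

text \<open>A norm-bounded sequence that converges pointwise converges weakly: the part of h outside
  a finite set A is small in norm, so Cauchy-Schwarz controls it uniformly in n, and on A only
  finitely many terms have to converge.\<close>

lemma l2_inner_tendsto_weak:
  assumes f: "\<forall>\<^sub>F n in sequentially. in_l2 \<mu> (f n) \<and> l2_norm \<mu> (f n) \<le> B"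
    and lim: "\<And>i. (\<lambda>n. f n i) \<longlonglongrightarrow> g i" and h: "in_l2 \<mu> h"
  shows "(\<lambda>n. l2_inner \<mu> (f n) h) \<longlonglongrightarrow> l2_inner \<mu> g h"
proof (rule LIMSEQ_I)
  fix e :: real assume e: "0 < e"
  note g = l2_norm_fatou[OF lim f]
  have B: "0 \<le> B" using g(2) l2_norm_nonneg order_trans by blast
  define tr where "tr A = (\<lambda>i. if i \<in> A then 0 else h i)" for A :: "'i set"
  have "((\<lambda>A. l2_norm \<mu> (tr A)) \<longlongrightarrow> 0) (finite_subsets_at_top UNIV)"
  proof (rule l2_norm_tendsto_dominated[OF h])
    show "((\<lambda>A. tr A i) \<longlongrightarrow> 0) (finite_subsets_at_top UNIV)" for i
      by (rule tendsto_eventually)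
         (auto simp: eventually_finite_subsets_at_top tr_def intro!: exI[of _ "{i}"])
  qed (auto simp: tr_def)
  then have "\<forall>\<^sub>F A in finite_subsets_at_top UNIV. l2_norm \<mu> (tr A) < e / (4 * (B + 1))"
    using e B by (intro order_tendstoD) auto
  \<comment> \<open>Dividing by B + 1 instead of B keeps the quotient meaningful for B = 0. The
    tails of \<open>f n\<close> and of g cost e/4 each, the finite part e/2.\<close>
  then obtain A where A: "finite A" "l2_norm \<mu> (tr A) < e / (4 * (B + 1))"
    by (auto simp: eventually_finite_subsets_at_top)
  have trl2: "in_l2 \<mu> (tr A)" by (rule in_l2_mono[OF h]) (auto simp: tr_def)
  have split: "l2_inner \<mu> u h = (\<Sum>i\<in>A. \<mu> i * u i * h i) + l2_inner \<mu> u (tr A)"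
    if u: "in_l2 \<mu> u" for u
  proof -
    have "l2_inner \<mu> u (\<lambda>i. h i - tr A i) = (\<Sum>\<^sub>\<infinity>i\<in>A. \<mu> i * u i * h i)"
      unfolding l2_inner_def by (rule infsum_cong_neutral) (auto simp: tr_def)
    then show ?thesis using A l2_inner_diff_right[OF h trl2 u] by simp
  qed
  have "(\<lambda>n. \<Sum>i\<in>A. \<mu> i * f n i * h i) \<longlonglongrightarrow> (\<Sum>i\<in>A. \<mu> i * g i * h i)"
    by (intro tendsto_intros lim)
  then have "\<forall>\<^sub>F n in sequentially. dist (\<Sum>i\<in>A. \<mu> i * f n i * h i) (\<Sum>i\<in>A. \<mu> i * g i * h i) < e / 2"
    using e by (intro tendstoD) auto
  with f have "\<forall>\<^sub>F n in sequentially. norm (l2_inner \<mu> (f n) h - l2_inner \<mu> g h) < e"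
  proof eventually_elim
    case (elim n)
    then have n: "in_l2 \<mu> (f n)" "l2_norm \<mu> (f n) \<le> B" by auto
    have T: "B * l2_norm \<mu> (tr A) \<le> e / 4"
    proof -
      have "B * l2_norm \<mu> (tr A) \<le> (B + 1) * (e / (4 * (B + 1)))"
        using A B by (intro mult_mono) auto
      also have "\<dots> = e / 4" using B by (auto simp: field_simps)
      finally show ?thesis .
    qed
    have "\<bar>l2_inner \<mu> (f n) (tr A)\<bar> \<le> e / 4" "\<bar>l2_inner \<mu> g (tr A)\<bar> \<le> e / 4"
      using l2_cauchy_schwarz[OF n(1) trl2] l2_cauchy_schwarz[OF g(1) trl2]
        mult_right_mono[OF n(2) l2_norm_nonneg[of "tr A"]] mult_right_mono[OF g(2) l2_norm_nonneg[of "tr A"]] T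
      by auto
    then show ?case using elim(2) split[OF n(1)] split[OF g(1)] unfolding dist_real_def real_norm_def by linarith
  qed
  then show "\<exists>no. \<forall>n\<ge>no. norm (l2_inner \<mu> (f n) h - l2_inner \<mu> g h) < e"
    by (simp add: eventually_sequentially)
qed

end

section \<open>The formal operator and minimum principles\<close>

lemma infsum_diff:
  fixes f g :: "'a \<Rightarrow> real"
  assumes "f summable_on A" "g summable_on A"
  shows "(\<Sum>\<^sub>\<infinity>x\<in>A. f x - g x) = infsum f A - infsum g A"
  using infsum_add[OF assms(1) summable_on_uminus[THEN iffD2, OF assms(2)]] by (simp add: infsum_uminus)

locale graph_measure =
  fixes b :: "'v \<Rightarrow> 'v \<Rightarrow> real" and c m :: "'v \<Rightarrow> real"
  assumes graph: "weighted_graph b c" and meas: "is_measure_on m"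
begin

lemma b_nonneg [simp]: "0 \<le> b x y" and b_sym: "b x y = b y x" and b_diag [simp]: "b x x = 0"
  and c_nonneg [simp]: "0 \<le> c x" and b_summable: "b x summable_on UNIV"
  using graph unfolding weighted_graph_def by auto

lemma m_pos [simp]: "0 < m x" and m_nonneg [simp]: "0 \<le> m x" and m_nz [simp]: "m x \<noteq> 0"
  using meas unfolding is_measure_on_def by (auto simp: less_imp_le) (metis less_irrefl)

definition deg :: "'v \<Rightarrow> real" where
  "deg x = (\<Sum>\<^sub>\<infinity>y. b x y) + c x"

definition adj :: "('v \<Rightarrow> real) \<Rightarrow> 'v \<Rightarrow> real" where
  "adj u x = (\<Sum>\<^sub>\<infinity>y. b x y * u y)"

lemma deg_nonneg [simp]: "0 \<le> deg x"
  by (simp add: deg_def infsum_nonneg)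

lemma b_mult_abs_summable:
  assumes "bounded (range u)"
  shows "(\<lambda>y. b x y * \<bar>u y\<bar>) summable_on UNIV"
proof -
  obtain C where C: "\<And>y. \<bar>u y\<bar> \<le> C" using assms by (auto simp: bounded_iff)
  show ?thesis
    by (rule summable_on_comparison_test[OF summable_on_cmult_left[OF b_summable, of x C]])
       (auto intro!: mult_left_mono C)
qed

lemma b_mult_summable:
  assumes "bounded (range u)"
  shows "(\<lambda>y. b x y * u y) summable_on UNIV"
  by (rule abs_summable_summable) (use b_mult_abs_summable[OF assms, of x] in \<open>simp add: abs_mult\<close>)

text \<open>For bounded u the series of differences splits into two convergent series. This form is
  the one used for limits, because a multiple of the row \<open>b x\<close> dominates the series in
  \<open>adj\<close>.\<close>

lemma Ltilde_bounded:
  assumes "bounded (range u)"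
  shows "Ltilde b c m u x = (deg x * u x - adj u x) / m x"
proof -
  have "(\<Sum>\<^sub>\<infinity>y. b x y * (u x - u y)) = (\<Sum>\<^sub>\<infinity>y. b x y * u x - b x y * u y)"
    by (simp add: right_diff_distrib)
  also have "\<dots> = (\<Sum>\<^sub>\<infinity>y. b x y * u x) - (\<Sum>\<^sub>\<infinity>y. b x y * u y)"
    by (intro infsum_diff summable_on_cmult_left b_summable b_mult_summable assms)
  also have "\<dots> = (\<Sum>\<^sub>\<infinity>y. b x y) * u x - adj u x"
    by (simp add: infsum_cmult_left' adj_def)
  finally show ?thesis
    by (simp add: Ltilde_def deg_def field_simps)
qed

lemma adj_le:
  fixes u :: "'v \<Rightarrow> real"
  assumes "\<And>y. \<bar>u y\<bar> \<le> C"
  shows "\<bar>adj u x\<bar> \<le> deg x * C"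
proof -
  have bu: "bounded (range u)" using assms by (auto simp: bounded_iff)
  have "\<bar>adj u x\<bar> \<le> (\<Sum>\<^sub>\<infinity>y. \<bar>b x y * u y\<bar>)"
    unfolding adj_def using norm_infsum_bound[of "\<lambda>y. b x y * u y" UNIV] b_mult_abs_summable[OF bu, of x]
    by (simp add: abs_mult)
  also have "\<dots> \<le> (\<Sum>\<^sub>\<infinity>y. b x y * C)"
    using b_mult_abs_summable[OF bu, of x]
    by (intro infsum_mono summable_on_cmult_left b_summable) (auto simp: abs_mult intro!: mult_left_mono assms)
  also have "\<dots> = (\<Sum>\<^sub>\<infinity>y. b x y) * C" by (simp add: infsum_cmult_left')
  also have "\<dots> \<le> deg x * C"
    using assms[of x] by (intro mult_right_mono) (auto simp: deg_def)
  finally show ?thesis .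
qed

lemma Ltilde_le:
  fixes u :: "'v \<Rightarrow> real"
  assumes "\<And>y. \<bar>u y\<bar> \<le> C"
  shows "\<bar>Ltilde b c m u x\<bar> \<le> 2 * deg x * C / m x"
proof -
  have bu: "bounded (range u)" using assms by (auto simp: bounded_iff)
  have "\<bar>deg x * u x\<bar> \<le> deg x * C" using assms by (auto simp: abs_mult intro!: mult_left_mono)
  moreover have "\<bar>adj u x\<bar> \<le> deg x * C" by (rule adj_le[OF assms])
  ultimately have "\<bar>deg x * u x - adj u x\<bar> \<le> 2 * deg x * C" by linarith
  then show ?thesis by (simp add: Ltilde_bounded[OF bu] divide_right_mono)
qed

lemma adj_tendsto:
  assumes "\<forall>\<^sub>F i in F. \<forall>y. \<bar>f i y\<bar> \<le> C" and "\<And>y. ((\<lambda>i. f i y) \<longlongrightarrow> g y) F"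
  shows "((\<lambda>i. adj (f i) x) \<longlongrightarrow> adj g x) F"
  unfolding adj_def
  by (rule tendsto_infsum_dominated[OF summable_on_cmult_left[OF b_summable, of x C]])
     (use assms in \<open>auto simp: abs_mult intro!: mult_left_mono tendsto_intros elim: eventually_mono\<close>)

lemma Ltilde_tendsto:
  assumes f: "\<forall>\<^sub>F i in F. \<forall>y. \<bar>f i y\<bar> \<le> C" and g: "bounded (range g)"
    and lim: "\<And>y. ((\<lambda>i. f i y) \<longlongrightarrow> g y) F"
  shows "((\<lambda>i. Ltilde b c m (f i) x) \<longlongrightarrow> Ltilde b c m g x) F"
proof -
  have "((\<lambda>i. (deg x * f i x - adj (f i) x) / m x) \<longlongrightarrow> (deg x * g x - adj g x) / m x) F"
    by (intro tendsto_intros lim adj_tendsto[OF f lim]) auto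
  moreover have "\<forall>\<^sub>F i in F. (deg x * f i x - adj (f i) x) / m x = Ltilde b c m (f i) x"
    using f by eventually_elim (subst Ltilde_bounded, auto simp: bounded_iff)
  ultimately show ?thesis
    by (simp add: Ltilde_bounded[OF g] tendsto_cong)
qed

lemma Ltilde_diff:
  assumes "bounded (range u)" "bounded (range v)"
  shows "Ltilde b c m (\<lambda>y. u y - v y) x = Ltilde b c m u x - Ltilde b c m v x"
proof -
  have "adj (\<lambda>y. u y - v y) x = adj u x - adj v x"
    unfolding adj_def right_diff_distrib by (intro infsum_diff b_mult_summable assms)
  then show ?thesis
    using assms by (simp add: Ltilde_bounded bounded_minus_comp diff_divide_distrib right_diff_distrib)
qed

lemma Ltilde_scale: "Ltilde b c m (\<lambda>y. a * u y) x = a * Ltilde b c m u x"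
proof -
  have "(\<Sum>\<^sub>\<infinity>y. b x y * (a * u x - a * u y)) = (\<Sum>\<^sub>\<infinity>y. a * (b x y * (u x - u y)))"
    by (intro infsum_cong) (simp add: algebra_simps)
  then show ?thesis unfolding Ltilde_def infsum_cmult_right' by (simp add: algebra_simps)
qed

lemma Ltilde_const: "Ltilde b c m (\<lambda>_. a) x = a * c x / m x"
  by (simp add: Ltilde_def)

text \<open>At a minimum every difference \<open>u x - u y\<close> is nonpositive; the sign of
  \<open>u x\<close> is what makes the killing term nonpositive as well. A divergent series has the
  value 0 by convention, which also fits the inequality.\<close>

lemma Ltilde_nonpos_at_min:
  assumes "\<And>y. u x \<le> u y" "u x \<le> 0"
  shows "Ltilde b c m u x \<le> 0"
proof -
  have "0 \<le> (\<Sum>\<^sub>\<infinity>y. - (b x y * (u x - u y)))"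
    using assms by (intro infsum_nonneg) (auto simp: mult_nonneg_nonpos)
  then have "(\<Sum>\<^sub>\<infinity>y. b x y * (u x - u y)) \<le> 0" by (simp only: infsum_uminus)
  then show ?thesis
    using assms unfolding Ltilde_def
    by (intro add_nonpos_nonpos) (auto simp: divide_nonpos_nonneg mult_nonneg_nonpos)
qed

text \<open>Finiteness of K makes a negative minimum attained, and the sign condition off K makes it
  global. There \<open>Ltilde\<close> is nonpositive while \<alpha> times the value is strictly
  negative.\<close>

lemma elliptic_minimum_principle:
  assumes K: "finite K" and off: "\<And>x. x \<notin> K \<Longrightarrow> 0 \<le> w x"
    and on: "\<And>x. x \<in> K \<Longrightarrow> 0 \<le> Ltilde b c m w x + \<alpha> * w x" and \<alpha>: "0 < \<alpha>"
  shows "0 \<le> w x"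
proof (rule ccontr)
  assume neg: "\<not> 0 \<le> w x"
  then have xK: "x \<in> K" using off by blast
  define z where "z = arg_min_on w K"
  have z: "z \<in> K" "\<And>y. y \<in> K \<Longrightarrow> w z \<le> w y"
    using arg_min_if_finite[OF K, of w] arg_min_least[OF K, of _ w] xK unfolding z_def by auto
  have wz: "w z < 0" using z(2)[OF xK] neg by simp
  have "w z \<le> w y" for y using z(2)[of y] off[of y] wz by (cases "y \<in> K") auto
  then have "Ltilde b c m w z \<le> 0" using wz by (intro Ltilde_nonpos_at_min) auto
  with on[OF z(1)] mult_pos_neg[OF \<alpha> wz] show False by simp
qed

text \<open>A negative value is turned into a negative space-time minimum of w + e (1 + s) over K
  and [0, T]. It lies at a positive time s, and in space it is a global minimum of
  \<open>w s\<close>, so the time derivative of the perturbed function there is at least e > 0. Then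
  the function is smaller just before s, a contradiction. Only an inequality is asked of the
  derivative, so that supersolutions such as a constant minus a heat flow qualify.\<close>

lemma parabolic_minimum_principle:
  assumes K: "finite K" and off: "\<And>t x. 0 \<le> t \<Longrightarrow> x \<notin> K \<Longrightarrow> 0 \<le> w t x"
    and init: "\<And>x. x \<in> K \<Longrightarrow> 0 \<le> w 0 x"
    and cont: "\<And>x. x \<in> K \<Longrightarrow> continuous_on {0..} (\<lambda>t. w t x)"
    and deriv: "\<And>t x. 0 < t \<Longrightarrow> x \<in> K \<Longrightarrow>
       \<exists>D. ((\<lambda>s. w s x) has_real_derivative D) (at t) \<and> - Ltilde b c m (w t) x \<le> D"
    and T: "0 \<le> T"
  shows "0 \<le> w T x"
proof (rule ccontr)
  assume neg: "\<not> 0 \<le> w T x"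
  then have xK: "x \<in> K" using off[OF T] by blast
  \<comment> \<open>With this e the perturbation at time T uses up exactly half of the negative
    value, so \<open>\<phi> T x\<close> is still negative.\<close>
  define e where "e = - w T x / (2 * (1 + T))"
  have e: "0 < e" using neg T by (simp add: e_def divide_neg_pos)
  define \<phi> where "\<phi> s y = w s y + e * (1 + s)" for s y
  have "\<phi> T x = w T x / 2" using T by (simp add: \<phi>_def e_def field_simps)
  with neg have \<phi>T: "\<phi> T x < 0" by simp
  have "\<exists>s\<in>{0..T}. \<forall>r\<in>{0..T}. \<phi> s y \<le> \<phi> r y" if "y \<in> K" for y
    unfolding \<phi>_def using T
    by (intro continuous_attains_inf continuous_intros continuous_on_subset[OF cont[OF that]]) auto
  then obtain \<tau> where \<tau>: "\<And>y. y \<in> K \<Longrightarrow> \<tau> y \<in> {0..T}"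
      "\<And>y r. y \<in> K \<Longrightarrow> r \<in> {0..T} \<Longrightarrow> \<phi> (\<tau> y) y \<le> \<phi> r y"
    by metis
  define z where "z = arg_min_on (\<lambda>y. \<phi> (\<tau> y) y) K"
  have z: "z \<in> K" "\<And>y. y \<in> K \<Longrightarrow> \<phi> (\<tau> z) z \<le> \<phi> (\<tau> y) y"
    using arg_min_if_finite[OF K, of "\<lambda>y. \<phi> (\<tau> y) y"] arg_min_least[OF K, of _ "\<lambda>y. \<phi> (\<tau> y) y"] xK
    unfolding z_def by auto
  define s where "s = \<tau> z"
  have s: "0 \<le> s" "s \<le> T" using \<tau>(1)[OF z(1)] by (auto simp: s_def)
  have min: "\<phi> s z \<le> \<phi> r y" if "y \<in> K" "r \<in> {0..T}" for r y
    using z(2)[OF that(1)] \<tau>(2)[OF that] by (simp add: s_def)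
  have \<phi>s: "\<phi> s z < 0" using min[OF xK, of T] \<phi>T T by simp
  have s0: "0 < s"
  proof (rule ccontr)
    assume "\<not> 0 < s"
    then have "s = 0" using s by simp
    then show False using init[OF z(1)] e \<phi>s by (simp add: \<phi>_def)
  qed
  have "0 \<le> e * (1 + s)" using e s by simp
  then have wz: "w s z < 0" using \<phi>s unfolding \<phi>_def by linarith
  have "w s z \<le> w s y" for y
  proof (cases "y \<in> K")
    case True
    then show ?thesis using min[of y s] s by (simp add: \<phi>_def)
  next
    case False
    then show ?thesis using off[of s y] wz s by simp
  qed
  then have L: "Ltilde b c m (w s) z \<le> 0" using wz by (intro Ltilde_nonpos_at_min) auto
  obtain D where D: "((\<lambda>s. w s z) has_real_derivative D) (at s)" "0 \<le> D"
    using deriv[OF s0 z(1)] L by force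
  have "((\<lambda>s. \<phi> s z) has_real_derivative D + e) (at s)"
    unfolding \<phi>_def using D(1) by (auto intro!: derivative_eq_intros)
  from DERIV_pos_inc_left[OF this] D(2) e obtain d where
    d: "0 < d" "\<And>h. 0 < h \<Longrightarrow> h < d \<Longrightarrow> \<phi> (s - h) z < \<phi> s z" by auto
  define h where "h = min (d / 2) s"
  have "0 < h" "h < d" "h \<le> s" using d(1) s0 by (auto simp: h_def)
  then show False using d(2)[of h] min[OF z(1), of "s - h"] s by auto
qed

lemma bounded_if_finite_support:
  fixes u :: "'v \<Rightarrow> real"
  assumes "finite K" "\<And>x. x \<notin> K \<Longrightarrow> u x = 0"
  shows "bounded (range u)"
proof -
  have "range u \<subseteq> insert 0 (u ` K)" using assms(2) by auto
  then show ?thesis using assms(1) by (meson finite_imageI finite_imp_bounded finite_insert finite_subset)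
qed

section \<open>Heat flow on finite sets\<close>

definition trunc :: "'v set \<Rightarrow> ('v \<Rightarrow> real) \<Rightarrow> 'v \<Rightarrow> real" where
  "trunc K f x = (if x \<in> K then f x else 0)"

text \<open>The Dirichlet restriction: \<open>deg\<close> still counts the edges leaving K, whose
  other ends are treated as carrying the value 0. Setting the result to 0 off K makes the operator
  iterable on functions on all of V.\<close>

definition LK :: "'v set \<Rightarrow> ('v \<Rightarrow> real) \<Rightarrow> 'v \<Rightarrow> real" where
  "LK K f x = (if x \<in> K then (deg x * f x - (\<Sum>y\<in>K. b x y * f y)) / m x else 0)"

lemma LK_off: "x \<notin> K \<Longrightarrow> LK K f x = 0"
  by (simp add: LK_def)

lemma LK_eq_Ltilde:
  assumes "finite K" "\<And>y. y \<notin> K \<Longrightarrow> f y = 0" "x \<in> K"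
  shows "LK K f x = Ltilde b c m f x"
proof -
  have "adj f x = (\<Sum>\<^sub>\<infinity>y\<in>K. b x y * f y)"
    unfolding adj_def using assms by (intro infsum_cong_neutral) auto
  then show ?thesis
    using assms bounded_if_finite_support[OF assms(1,2)] by (simp add: Ltilde_bounded LK_def)
qed

lemma LK_sym:
  assumes "finite K"
  shows "(\<Sum>x\<in>K. m x * LK K f x * h x) = (\<Sum>x\<in>K. m x * LK K h x * f x)"
proof -
  have "(\<Sum>x\<in>K. m x * LK K f x * h x) = (\<Sum>x\<in>K. deg x * f x * h x) - (\<Sum>x\<in>K. \<Sum>y\<in>K. b x y * f y * h x)"
    for f h
    unfolding sum_subtractf[symmetric]
    by (intro sum.cong) (auto simp: LK_def left_diff_distrib sum_distrib_right)
  moreover have "(\<Sum>x\<in>K. \<Sum>y\<in>K. b x y * f y * h x) = (\<Sum>x\<in>K. \<Sum>y\<in>K. b x y * h y * f x)"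
    by (subst sum.swap) (auto intro!: sum.cong simp: b_sym mult_ac)
  ultimately show ?thesis by (simp add: mult_ac)
qed

lemma LK_bound:
  assumes "finite K"
  obtains C where "0 \<le> C" "\<And>f B x. (\<And>y. \<bar>f y\<bar> \<le> B) \<Longrightarrow> \<bar>LK K f x\<bar> \<le> C * B"
proof
  \<comment> \<open>Summing over K replaces a maximum over rows. The constant depends on K, but it
    only serves the convergence of the exponential series.\<close>
  define C where "C = (\<Sum>x\<in>K. (deg x + (\<Sum>y\<in>K. b x y)) / m x)"
  have nn: "0 \<le> (deg x + (\<Sum>y\<in>K. b x y)) / m x" for x
    by (auto intro!: divide_nonneg_pos add_nonneg_nonneg sum_nonneg)
  show C: "0 \<le> C" unfolding C_def by (intro sum_nonneg nn)
  fix f :: "'v \<Rightarrow> real" and B x assume B: "\<And>y. \<bar>f y\<bar> \<le> B"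
  then have B0: "0 \<le> B" using abs_ge_zero order_trans by blast
  show "\<bar>LK K f x\<bar> \<le> C * B"
  proof (cases "x \<in> K")
    case True
    have "\<bar>deg x * f x - (\<Sum>y\<in>K. b x y * f y)\<bar> \<le> \<bar>deg x * f x\<bar> + \<bar>\<Sum>y\<in>K. b x y * f y\<bar>"
      by (rule abs_triangle_ineq4)
    also have "\<bar>\<Sum>y\<in>K. b x y * f y\<bar> \<le> (\<Sum>y\<in>K. b x y * B)"
      by (rule order_trans[OF sum_abs]) (auto intro!: sum_mono mult_left_mono B simp: abs_mult)
    also have "\<bar>deg x * f x\<bar> \<le> deg x * B" by (auto simp: abs_mult intro!: mult_left_mono B)
    finally have "\<bar>LK K f x\<bar> \<le> (deg x * B + (\<Sum>y\<in>K. b x y * B)) / m x"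
      using True by (simp add: LK_def divide_right_mono)
    also have "\<dots> = (deg x + (\<Sum>y\<in>K. b x y)) / m x * B"
      by (simp add: distrib_right sum_distrib_right)
    also have "\<dots> \<le> C * B"
      unfolding C_def using True assms nn B0 by (intro mult_right_mono member_le_sum) auto
    finally show ?thesis .
  qed (use C B0 in \<open>simp add: LK_def\<close>)
qed

text \<open>The exponential of -t times \<open>LK K\<close>, applied to g and read off at x.
  Coefficients are kept apart from the powers of t so that the series can be differentiated as a
  power series.\<close>

definition expLK :: "'v set \<Rightarrow> ('v \<Rightarrow> real) \<Rightarrow> real \<Rightarrow> 'v \<Rightarrow> real" where
  "expLK K g t x = (\<Sum>k. ((- 1) ^ k / fact k * (LK K ^^ k) g x) * t ^ k)"

lemma LK_funpow_off: "(\<And>x. x \<notin> K \<Longrightarrow> g x = 0) \<Longrightarrow> x \<notin> K \<Longrightarrow> (LK K ^^ k) g x = 0"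
  by (cases k) (auto simp: LK_off)

lemma expLK_summable:
  assumes K: "finite K" and g: "\<And>x. x \<notin> K \<Longrightarrow> g x = 0"
  shows "summable (\<lambda>k. ((- 1) ^ k / fact k * (LK K ^^ k) g x) * (t::real) ^ k)"
proof -
  obtain C where C: "0 \<le> C" "\<And>f B x. (\<And>y. \<bar>f y\<bar> \<le> B) \<Longrightarrow> \<bar>LK K f x\<bar> \<le> C * B"
    using LK_bound[OF K] by blast
  obtain B where B: "\<And>y. \<bar>g y\<bar> \<le> B"
    using bounded_if_finite_support[of K g] K g unfolding bounded_iff by auto
  have pow: "\<bar>(LK K ^^ k) g y\<bar> \<le> C ^ k * B" for k y
  proof (induction k arbitrary: y)
    case (Suc k)
    then show ?case using C(2)[of "(LK K ^^ k) g" "C ^ k * B" y] by (simp add: mult_ac)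
  qed (simp add: B)
  have "summable (\<lambda>k. B * (inverse (fact k) * (C * \<bar>t\<bar>) ^ k))"
    by (intro summable_mult summable_exp)
  then show ?thesis
  proof (rule summable_comparison_test'[where N = 0])
    fix k :: nat
    have "\<bar>(LK K ^^ k) g x\<bar> * \<bar>t\<bar> ^ k / fact k \<le> C ^ k * B * \<bar>t\<bar> ^ k / fact k"
      by (intro divide_right_mono mult_right_mono pow) auto
    then show "norm ((- 1) ^ k / fact k * (LK K ^^ k) g x * t ^ k) \<le> B * (inverse (fact k) * (C * \<bar>t\<bar>) ^ k)"
      by (simp add: abs_mult power_abs power_mult_distrib field_simps)
  qed
qed

lemma expLK_LK:
  assumes K: "finite K" and g: "\<And>x. x \<notin> K \<Longrightarrow> g x = 0"
  shows "expLK K (LK K g) t x = LK K (expLK K g t) x"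
proof (cases "x \<in> K")
  case False
  then have "(LK K ^^ k) (LK K g) x = 0" for k by (intro LK_funpow_off LK_off)
  then show ?thesis using False by (simp add: expLK_def LK_off)
next
  case True
  define a where "a k y = ((- 1) ^ k / fact k * (LK K ^^ k) g y) * t ^ k" for k y
  have S: "summable (\<lambda>k. a k y)" for y unfolding a_def by (rule expLK_summable[OF K g])
  have "LK K (expLK K g t) x = (deg x * (\<Sum>k. a k x) - (\<Sum>y\<in>K. b x y * (\<Sum>k. a k y))) / m x"
    using True by (simp add: LK_def expLK_def a_def)
  also have "\<dots> = ((\<Sum>k. deg x * a k x) - (\<Sum>k. \<Sum>y\<in>K. b x y * a k y)) / m x"
    by (subst suminf_sum) (auto simp: suminf_mult[OF S] intro!: summable_mult S)
  also have "\<dots> = (\<Sum>k. deg x * a k x - (\<Sum>y\<in>K. b x y * a k y)) / m x"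
    by (subst suminf_diff) (auto intro!: summable_sum summable_mult S)
  also have "\<dots> = (\<Sum>k. (deg x * a k x - (\<Sum>y\<in>K. b x y * a k y)) / m x)"
    by (intro suminf_divide[symmetric] summable_diff summable_sum summable_mult S)
  also have "\<dots> = (\<Sum>k. ((- 1) ^ k / fact k * (LK K ^^ k) (LK K g) x) * t ^ k)"
  proof (rule suminf_cong)
    fix k
    have "(LK K ^^ k) (LK K g) x = LK K ((LK K ^^ k) g) x"
      by (metis funpow_swap1)
    then show "(deg x * a k x - (\<Sum>y\<in>K. b x y * a k y)) / m x
        = ((- 1) ^ k / fact k * (LK K ^^ k) (LK K g) x) * t ^ k"
      using True by (simp add: a_def LK_def sum_distrib_left sum_distrib_right right_diff_distrib left_diff_distrib
          diff_divide_distrib sum_divide_distrib mult_ac)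
  qed
  finally show ?thesis by (simp add: expLK_def)
qed

lemma expLK_deriv:
  assumes K: "finite K" and g: "\<And>x. x \<notin> K \<Longrightarrow> g x = 0"
  shows "((\<lambda>t. expLK K g t x) has_real_derivative - LK K (expLK K g t) x) (at t)"
proof -
  have "((\<lambda>t. expLK K g t x) has_real_derivative
      (\<Sum>k. diffs (\<lambda>k. (- 1) ^ k / fact k * (LK K ^^ k) g x) k * t ^ k)) (at t)"
    unfolding expLK_def by (rule termdiffs_strong_converges_everywhere) (rule expLK_summable[OF K g])
  moreover have "diffs (\<lambda>k. (- 1) ^ k / fact k * (LK K ^^ k) g x) k * t ^ k =
      - ((- 1) ^ k / fact k * (LK K ^^ k) (LK K g) x * t ^ k)" for k
  proof -
    have f: "real (Suc k) / fact (Suc k) = 1 / fact k"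
      unfolding fact_Suc of_nat_mult by (simp del: of_nat_Suc)
    have "diffs (\<lambda>k. (- 1) ^ k / fact k * (LK K ^^ k) g x) k * t ^ k =
        (real (Suc k) / fact (Suc k)) * ((- 1) ^ Suc k * (LK K ^^ Suc k) g x * t ^ k)"
      by (simp add: diffs_def del: fact_Suc of_nat_Suc)
    then show ?thesis unfolding f by (simp add: funpow_swap1)
  qed
  moreover have "(\<Sum>k. - ((- 1) ^ k / fact k * (LK K ^^ k) (LK K g) x * t ^ k)) = - expLK K (LK K g) t x"
    unfolding expLK_def by (intro suminf_minus expLK_summable[OF K] LK_off)
  ultimately show ?thesis by (simp add: expLK_LK[OF K g])
qed

section \<open>Positivity, upper bounds and domain monotonicity of the finite flow\<close>

definition heat :: "'v set \<Rightarrow> ('v \<Rightarrow> real) \<Rightarrow> real \<Rightarrow> 'v \<Rightarrow> real" where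
  "heat K f = expLK K (trunc K f)"

lemma trunc_off: "x \<notin> K \<Longrightarrow> trunc K f x = 0"
  by (simp add: trunc_def)

lemma heat_off: "x \<notin> K \<Longrightarrow> heat K f t x = 0"
  by (simp add: heat_def expLK_def LK_funpow_off trunc_off)

lemma heat_0: "heat K f 0 = trunc K f"
  unfolding heat_def expLK_def by (intro ext, subst powser_zero) simp

lemma bounded_heat: "finite K \<Longrightarrow> bounded (range (heat K f t))"
  by (rule bounded_if_finite_support[of K]) (auto simp: heat_off)

lemma heat_deriv:
  "finite K \<Longrightarrow> ((\<lambda>t. heat K f t x) has_real_derivative - LK K (heat K f t) x) (at t)"
  unfolding heat_def by (rule expLK_deriv) (auto simp: trunc_off)

lemma heat_deriv':
  "finite K \<Longrightarrow> x \<in> K \<Longrightarrow> ((\<lambda>t. heat K f t x) has_real_derivative - Ltilde b c m (heat K f t) x) (at t)"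
  using heat_deriv[of K f x t] LK_eq_Ltilde[of K "heat K f t" x] heat_off by auto

lemma heat_continuous_on: "finite K \<Longrightarrow> continuous_on S (\<lambda>t. heat K f t x)"
  using heat_deriv[of K f x] by (meson DERIV_isCont continuous_at_imp_continuous_on)

lemma LK_pow_heat: "finite K \<Longrightarrow> (LK K ^^ k) (heat K f t) = expLK K ((LK K ^^ k) (trunc K f)) t"
proof (induction k)
  case (Suc k)
  have "LK K (expLK K g t) = expLK K (LK K g) t" if "\<And>x. x \<notin> K \<Longrightarrow> g x = 0" for g
    using expLK_LK[OF Suc.prems that] by (simp add: fun_eq_iff)
  then show ?case using Suc by (simp add: LK_funpow_off trunc_off)
qed (simp add: heat_def)

lemma LK_pow_heat_deriv:
  assumes "finite K"
  shows "((\<lambda>t. (LK K ^^ k) (heat K f t) x) has_real_derivative - (LK K ^^ Suc k) (heat K f t) x) (at t)"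
  using expLK_deriv[OF assms, of "(LK K ^^ k) (trunc K f)" x t] assms
  by (simp add: LK_pow_heat LK_funpow_off trunc_off)

lemma heat_nonneg:
  assumes "finite K" "\<And>x. x \<in> K \<Longrightarrow> 0 \<le> f x" "0 \<le> t"
  shows "0 \<le> heat K f t x"
  by (rule parabolic_minimum_principle[where K = K, OF assms(1) _ _ _ _ assms(3)])
     (use assms in \<open>auto simp: heat_off heat_0 trunc_def heat_continuous_on intro: heat_deriv' order_refl\<close>)

text \<open>Since c is nonnegative, a nonnegative constant C is a supersolution, and off K it lies
  above the boundary value 0.\<close>

lemma heat_le:
  assumes K: "finite K" and f: "\<And>x. x \<in> K \<Longrightarrow> f x \<le> C" and C: "0 \<le> C" and t: "0 \<le> t"
  shows "heat K f t x \<le> C"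
proof -
  have "0 \<le> C - heat K f t x"
  proof (rule parabolic_minimum_principle[OF K _ _ _ _ t])
    fix s :: real and x assume s: "0 < s" "x \<in> K"
    have "Ltilde b c m (\<lambda>x. C - heat K f s x) x = C * c x / m x - Ltilde b c m (heat K f s) x"
      by (subst Ltilde_diff) (auto simp: Ltilde_const bounded_heat K)
    moreover have "((\<lambda>s. C - heat K f s x) has_real_derivative Ltilde b c m (heat K f s) x) (at s)"
      using heat_deriv'[OF K s(2), of f s] by (auto intro!: derivative_eq_intros)
    ultimately show "\<exists>D. ((\<lambda>s. C - heat K f s x) has_real_derivative D) (at s) \<and>
        - Ltilde b c m (\<lambda>x. C - heat K f s x) x \<le> D"
      using C by (intro exI[of _ "Ltilde b c m (heat K f s) x"]) auto
  qed (use f C in \<open>auto simp: heat_off heat_0 trunc_def intro!: continuous_intros heat_continuous_on K\<close>)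
  then show ?thesis by simp
qed

text \<open>The comparison runs on the smaller set K: there both flows solve the same equation, and
  off K the flow of K is 0 while that of K' is nonnegative.\<close>

lemma heat_mono:
  assumes K: "finite K'" "K \<subseteq> K'" and f: "\<And>x. f x \<le> f' x" "\<And>x. 0 \<le> f' x" and t: "0 \<le> t"
  shows "heat K f t x \<le> heat K' f' t x"
proof -
  have fK: "finite K" using K finite_subset by blast
  have "0 \<le> heat K' f' t x - heat K f t x"
  proof (rule parabolic_minimum_principle[OF fK _ _ _ _ t])
    fix s :: real and x assume s: "0 < s" "x \<in> K"
    then have x: "x \<in> K'" using K by blast
    have "Ltilde b c m (\<lambda>x. heat K' f' s x - heat K f s x) x = Ltilde b c m (heat K' f' s) x - Ltilde b c m (heat K f s) x"
      by (intro Ltilde_diff bounded_heat K fK)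
    moreover have "((\<lambda>s. heat K' f' s x - heat K f s x) has_real_derivative
         - Ltilde b c m (heat K' f' s) x + Ltilde b c m (heat K f s) x) (at s)"
      using heat_deriv'[OF K(1) x, of f' s] heat_deriv'[OF fK s(2), of f s]
      by (auto intro!: derivative_eq_intros)
    ultimately show "\<exists>D. ((\<lambda>s. heat K' f' s x - heat K f s x) has_real_derivative D) (at s) \<and>
        - Ltilde b c m (\<lambda>x. heat K' f' s x - heat K f s x) x \<le> D"
      by (intro exI) (auto intro: order_refl)
  qed (use K f in \<open>auto simp: heat_off heat_0 trunc_def heat_nonneg intro!: continuous_intros heat_continuous_on K fK\<close>)
  then show ?thesis by simp
qed

section \<open>Energy form and energy estimates\<close>

sublocale M: weight m by unfold_locales simp

sublocale C: weight c by unfold_locales simp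

text \<open>Together with \<open>grad\<close>, this presents the energy as half of a squared l2 norm
  over ordered pairs plus the squared norm with weight c, so that Cauchy-Schwarz and Fatou carry
  over from weighted l2 spaces.\<close>

definition bw :: "'v \<times> 'v \<Rightarrow> real" where "bw = (\<lambda>(x, y). b x y)"

definition grad :: "('v \<Rightarrow> real) \<Rightarrow> 'v \<times> 'v \<Rightarrow> real" where "grad u = (\<lambda>(x, y). u x - u y)"

sublocale E: weight bw by unfold_locales (auto simp: bw_def)

lemma gen_form_eq: "gen_form b c u v = 1/2 * l2_inner bw (grad u) (grad v) + l2_inner c u v"
  by (simp add: gen_form_def l2_inner_def bw_def grad_def case_prod_unfold)

lemma energy_finite_iff: "energy_finite b c u \<longleftrightarrow> in_l2 bw (grad u) \<and> in_l2 c u"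
  by (simp add: energy_finite_def in_l2_def bw_def grad_def case_prod_unfold)

lemma grad_diff: "grad (\<lambda>x. u x - v x) = (\<lambda>p. grad u p - grad v p)"
  by (auto simp: grad_def fun_eq_iff)

lemma energy_finite_diff:
  "energy_finite b c u \<Longrightarrow> energy_finite b c v \<Longrightarrow> energy_finite b c (\<lambda>x. u x - v x)"
  by (simp add: energy_finite_iff grad_diff E.in_l2_diff C.in_l2_diff)

lemma gen_form_diff_left:
  "energy_finite b c u \<Longrightarrow> energy_finite b c v \<Longrightarrow> energy_finite b c w \<Longrightarrow>
    gen_form b c (\<lambda>x. u x - v x) w = gen_form b c u w - gen_form b c v w"
  by (simp add: gen_form_eq energy_finite_iff grad_diff E.l2_inner_diff_left C.l2_inner_diff_left
      right_diff_distrib)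

lemma gen_form_commute: "gen_form b c u v = gen_form b c v u"
  by (simp add: gen_form_eq E.l2_inner_commute[of "grad u"] C.l2_inner_commute[of u])

lemma gen_form_diff_right:
  "energy_finite b c u \<Longrightarrow> energy_finite b c v \<Longrightarrow> energy_finite b c w \<Longrightarrow>
    gen_form b c w (\<lambda>x. u x - v x) = gen_form b c w u - gen_form b c w v"
  using gen_form_diff_left by (simp add: gen_form_commute[of w])

lemma gen_form_self: "gen_form b c u u = 1/2 * (l2_norm bw (grad u))\<^sup>2 + (l2_norm c u)\<^sup>2"
  by (simp add: gen_form_eq E.l2_inner_self C.l2_inner_self)

lemma gen_form_self_nonneg: "0 \<le> gen_form b c u u"
  by (simp add: gen_form_self)

text \<open>Continuity of the form in its second argument. Both parts are estimated by
  Cauchy-Schwarz, and both half the gradient norm of v and its norm with weight c are at most the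
  square root of the energy of v. The factor depending on u only has to be finite.\<close>

lemma gen_form_bound:
  assumes "energy_finite b c u" "energy_finite b c v"
  shows "\<bar>gen_form b c u v\<bar> \<le> (l2_norm bw (grad u) + l2_norm c u) * sqrt (gen_form b c v v)"
proof -
  let ?q = "sqrt (gen_form b c v v)"
  have 1: "1/2 * l2_norm bw (grad v) \<le> ?q"
    by (rule real_le_rsqrt) (auto simp: gen_form_self power_mult_distrib power2_eq_square[of "1/2"]
        field_simps power_divide)
  have 2: "l2_norm c v \<le> ?q"
    by (rule real_le_rsqrt) (auto simp: gen_form_self)
  have "\<bar>gen_form b c u v\<bar> \<le> 1/2 * \<bar>l2_inner bw (grad u) (grad v)\<bar> + \<bar>l2_inner c u v\<bar>"
    unfolding gen_form_eq by linarith
  also have "\<dots> \<le> l2_norm bw (grad u) * (1/2 * l2_norm bw (grad v)) + l2_norm c u * l2_norm c v"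
    using E.l2_cauchy_schwarz[of "grad u" "grad v"] C.l2_cauchy_schwarz[of u v] assms
    by (simp add: energy_finite_iff)
  also have "\<dots> \<le> l2_norm bw (grad u) * ?q + l2_norm c u * ?q"
    by (intro add_mono mult_left_mono 1 2) auto
  finally show ?thesis by (simp add: distrib_right)
qed

section \<open>Green's formula\<close>

lemma row_supported_sum:
  fixes k :: "'v \<Rightarrow> 'v \<Rightarrow> real"
  assumes F: "finite F" and C: "\<And>x y. \<bar>k x y\<bar> \<le> C" and off: "\<And>x y. x \<notin> F \<Longrightarrow> k x y = 0"
  shows "(\<lambda>(x, y). b x y * k x y) summable_on UNIV"
    and "(\<Sum>\<^sub>\<infinity>(x, y). b x y * k x y) = (\<Sum>x\<in>F. \<Sum>\<^sub>\<infinity>y. b x y * k x y)"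
proof -
  have row: "(\<lambda>y. norm (b x y * k x y)) summable_on UNIV" for x
    using b_mult_abs_summable[of "k x" x] C by (auto simp: abs_mult bounded_iff)
  have S: "(\<lambda>(x, y). b x y * k x y) summable_on F \<times> UNIV"
    by (rule abs_summable_summable, rule Infinite_Sum.abs_summable_on_Sigma_iff[THEN iffD2]) (use row F in auto)
  have off': "x \<in> F" if "k x y \<noteq> 0" for x y using off that by blast
  have eq: "(\<lambda>(x, y). b x y * k x y) summable_on F \<times> UNIV \<longleftrightarrow> (\<lambda>(x, y). b x y * k x y) summable_on UNIV"
    by (rule summable_on_cong_neutral) (auto dest: off')
  show "(\<lambda>(x, y). b x y * k x y) summable_on UNIV" using S eq by simp
  have "(\<Sum>\<^sub>\<infinity>(x, y). b x y * k x y) = (\<Sum>\<^sub>\<infinity>(x, y)\<in>F \<times> UNIV. b x y * k x y)"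
    by (rule infsum_cong_neutral) (auto dest: off')
  also have "\<dots> = (\<Sum>\<^sub>\<infinity>x\<in>F. \<Sum>\<^sub>\<infinity>y. b x y * k x y)"
    using infsum_Sigma_banach[OF S] by simp
  finally show "(\<Sum>\<^sub>\<infinity>(x, y). b x y * k x y) = (\<Sum>x\<in>F. \<Sum>\<^sub>\<infinity>y. b x y * k x y)"
    using F by simp
qed

text \<open>The support of \<open>\<phi> x - \<phi> y\<close> contains infinitely many rows, so the
  sum is split as f plus f composed with the swap of coordinates, where f lives on the finitely many
  rows in F. By symmetry of b the two have the same sum, whence the factor 2.\<close>

lemma green_pairs:
  assumes u: "bounded (range u)" and F: "finite F" and off: "\<And>x. x \<notin> F \<Longrightarrow> \<phi> x = 0"
  shows "(\<lambda>(x, y). b x y * (u x - u y) * (\<phi> x - \<phi> y)) summable_on UNIV"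
    and "(\<Sum>\<^sub>\<infinity>(x, y). b x y * (u x - u y) * (\<phi> x - \<phi> y))
          = 2 * (\<Sum>x\<in>F. (\<Sum>\<^sub>\<infinity>y. b x y * (u x - u y)) * \<phi> x)"
proof -
  obtain A where A: "\<And>x. \<bar>u x\<bar> \<le> A" using u by (auto simp: bounded_iff)
  obtain B where B: "\<And>x. \<bar>\<phi> x\<bar> \<le> B"
    using bounded_if_finite_support[of F \<phi>] F off unfolding bounded_iff by auto
  define k where "k x y = (u x - u y) * \<phi> x" for x y
  define f where "f = (\<lambda>(x, y). b x y * k x y)"
  have "\<bar>k x y\<bar> \<le> (A + A) * B" for x y
  proof -
    have "\<bar>u x - u y\<bar> \<le> A + A" using A[of x] A[of y] by linarith
    then show ?thesis
      unfolding k_def abs_mult by (intro mult_mono) (use B in \<open>auto intro: order_trans[OF abs_ge_zero]\<close>)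
  qed
  note R = row_supported_sum[OF F this]
  have f: "f summable_on UNIV" unfolding f_def by (rule R(1)) (simp add: k_def off)
  have fsum: "infsum f UNIV = (\<Sum>x\<in>F. (\<Sum>\<^sub>\<infinity>y. b x y * (u x - u y)) * \<phi> x)"
    unfolding f_def by (subst R(2)) (auto simp: k_def off mult.assoc[symmetric] infsum_cmult_left')
  have sw: "bij_betw prod.swap (UNIV :: ('v \<times> 'v) set) UNIV" by (simp add: bij_betw_def)
  have fs: "(f \<circ> prod.swap) summable_on UNIV"
    using summable_on_reindex_bij_betw[OF sw, of f] f by (simp add: o_def)
  have fssum: "infsum (f \<circ> prod.swap) UNIV = infsum f UNIV"
    using infsum_reindex_bij_betw[OF sw, of f] by (simp add: o_def)
  have eq: "(\<lambda>(x, y). b x y * (u x - u y) * (\<phi> x - \<phi> y)) = (\<lambda>p. f p + (f \<circ> prod.swap) p)"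
    by (auto simp: f_def k_def b_sym fun_eq_iff algebra_simps)
  show "(\<lambda>(x, y). b x y * (u x - u y) * (\<phi> x - \<phi> y)) summable_on UNIV"
    unfolding eq by (intro summable_on_add f fs)
  show "(\<Sum>\<^sub>\<infinity>(x, y). b x y * (u x - u y) * (\<phi> x - \<phi> y))
          = 2 * (\<Sum>x\<in>F. (\<Sum>\<^sub>\<infinity>y. b x y * (u x - u y)) * \<phi> x)"
    unfolding eq by (subst infsum_add[OF f fs]) (simp add: fssum fsum)
qed

lemma infsum_finite_support:
  fixes f :: "'v \<Rightarrow> real"
  assumes "finite F" "\<And>x. x \<notin> F \<Longrightarrow> f x = 0"
  shows "f summable_on UNIV" "infsum f UNIV = sum f F"
proof -
  have "f summable_on F \<longleftrightarrow> f summable_on UNIV"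
    by (rule summable_on_cong_neutral) (use assms in auto)
  then show "f summable_on UNIV" using assms by simp
  have "infsum f UNIV = infsum f F" by (rule infsum_cong_neutral) (use assms in auto)
  then show "infsum f UNIV = sum f F" using assms by simp
qed

text \<open>The link between the form and the formal operator. It gives the positivity of the finite
  energies and later identifies L on the limit flow with \<open>Ltilde\<close>.\<close>

lemma green:
  assumes u: "bounded (range u)" and F: "finite F" and off: "\<And>x. x \<notin> F \<Longrightarrow> \<phi> x = 0"
  shows "gen_form b c u \<phi> = (\<Sum>x\<in>F. m x * Ltilde b c m u x * \<phi> x)"
proof -
  have "(\<Sum>\<^sub>\<infinity>x. c x * u x * \<phi> x) = (\<Sum>x\<in>F. c x * u x * \<phi> x)"
    by (rule infsum_finite_support[OF F]) (simp add: off)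
  moreover have "(\<Sum>\<^sub>\<infinity>(x, y). b x y * (u x - u y) * (\<phi> x - \<phi> y))
          = 2 * (\<Sum>x\<in>F. (\<Sum>\<^sub>\<infinity>y. b x y * (u x - u y)) * \<phi> x)"
    by (rule green_pairs(2)[OF assms])
  ultimately show ?thesis
    by (simp add: gen_form_def) (simp add: Ltilde_def sum.distrib[symmetric] distrib_left distrib_right mult.assoc[symmetric])
qed

lemma finite_support_in_l2:
  fixes \<phi> :: "'v \<Rightarrow> real"
  assumes "finite F" "\<And>x. x \<notin> F \<Longrightarrow> \<phi> x = 0"
  shows "in_l2 \<mu> \<phi>"
  unfolding in_l2_def by (rule infsum_finite_support[OF assms(1)]) (simp add: assms(2))

lemma finite_support_energy:
  fixes \<phi> :: "'v \<Rightarrow> real"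
  assumes "finite F" "\<And>x. x \<notin> F \<Longrightarrow> \<phi> x = 0"
  shows "energy_finite b c \<phi>"
  using green_pairs(1)[OF bounded_if_finite_support[OF assms] assms] finite_support_in_l2[OF assms, where \<mu> = c]
  by (simp add: energy_finite_def in_l2_def power2_eq_square mult.assoc)

lemma l2_inner_finite_support:
  fixes \<phi> :: "'v \<Rightarrow> real"
  assumes "finite F" "\<And>x. x \<notin> F \<Longrightarrow> \<phi> x = 0"
  shows "l2_inner \<mu> u \<phi> = (\<Sum>x\<in>F. \<mu> x * u x * \<phi> x)"
  unfolding l2_inner_def by (rule infsum_finite_support[OF assms(1)]) (simp add: assms(2))

section \<open>Energies along the finite flow\<close>

lemma LK_form_nonneg:
  assumes "finite K" "\<And>x. x \<notin> K \<Longrightarrow> f x = 0"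
  shows "(\<Sum>x\<in>K. m x * LK K f x * f x) = gen_form b c f f"
    and "0 \<le> (\<Sum>x\<in>K. m x * LK K f x * f x)"
proof -
  show "(\<Sum>x\<in>K. m x * LK K f x * f x) = gen_form b c f f"
    using assms by (simp add: green[OF bounded_if_finite_support[OF assms] assms] LK_eq_Ltilde cong: sum.cong)
  then show "0 \<le> (\<Sum>x\<in>K. m x * LK K f x * f x)" using gen_form_self_nonneg by simp
qed

text \<open>heatF K f k t is the energy (L^k u, u) of the heat flow u at time t. The step from the decay of
  one energy to the next only uses that all of them are nonnegative, so the resulting bounds do
  not depend on K.\<close>

definition heatF :: "'v set \<Rightarrow> ('v \<Rightarrow> real) \<Rightarrow> nat \<Rightarrow> real \<Rightarrow> real" where
  "heatF K f k t = (\<Sum>x\<in>K. m x * (LK K ^^ k) (heat K f t) x * heat K f t x)"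

lemma LK_pow_sym:
  assumes "finite K"
  shows "(\<Sum>x\<in>K. m x * (LK K ^^ (i + j)) f x * h x) = (\<Sum>x\<in>K. m x * (LK K ^^ i) f x * (LK K ^^ j) h x)"
proof (induction j arbitrary: h)
  case (Suc j)
  have "(\<Sum>x\<in>K. m x * (LK K ^^ (i + Suc j)) f x * h x) = (\<Sum>x\<in>K. m x * LK K ((LK K ^^ (i + j)) f) x * h x)"
    by simp
  also have "\<dots> = (\<Sum>x\<in>K. m x * (LK K ^^ (i + j)) f x * LK K h x)"
    by (subst LK_sym[OF assms]) (simp add: mult_ac)
  also have "\<dots> = (\<Sum>x\<in>K. m x * (LK K ^^ i) f x * (LK K ^^ j) (LK K h) x)" by (rule Suc.IH)
  finally show ?case by (simp add: funpow_swap1)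
qed simp

lemma heatF_even:
  assumes "finite K"
  shows "heatF K f (2 * j) t = (\<Sum>x\<in>K. m x * ((LK K ^^ j) (heat K f t) x)\<^sup>2)"
  using LK_pow_sym[OF assms, of j j "heat K f t" "heat K f t"]
  by (simp add: heatF_def mult_2 power2_eq_square mult.assoc)

text \<open>By symmetry an even power can be split equally between the two factors, giving a sum of
  squares. An odd power leaves one \<open>LK K\<close> between two equal vectors, and that pairing
  is an energy.\<close>

lemma heatF_nonneg:
  assumes "finite K"
  shows "0 \<le> heatF K f k t"
proof (cases "even k")
  case True
  then show ?thesis by (auto simp: heatF_even[OF assms] elim!: evenE intro!: sum_nonneg)
next
  case False
  then obtain j where k: "k = Suc (2 * j)" by (auto elim: oddE)
  let ?h = "(LK K ^^ j) (heat K f t)"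
  have "heatF K f k t = (\<Sum>x\<in>K. m x * LK K ?h x * ?h x)"
    using LK_pow_sym[OF assms, of "Suc j" j "heat K f t" "heat K f t"] by (simp add: heatF_def k mult_2)
  also have "\<dots> \<ge> 0"
    by (rule LK_form_nonneg(2)[OF assms]) (simp add: LK_funpow_off heat_off)
  finally show ?thesis .
qed

lemma heatF_deriv:
  assumes "finite K"
  shows "((\<lambda>t. heatF K f k t) has_real_derivative - 2 * heatF K f (Suc k) t) (at t)"
proof -
  let ?u = "heat K f t"
  have *: "(\<Sum>x\<in>K. m x * (LK K ^^ k) ?u x * LK K ?u x) = (\<Sum>x\<in>K. m x * (LK K ^^ Suc k) ?u x * ?u x)"
    using LK_pow_sym[OF assms, of k 1 ?u ?u] by simp
  have "((\<lambda>t. heatF K f k t) has_real_derivative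
     (\<Sum>x\<in>K. m x * - (LK K ^^ Suc k) ?u x * ?u x + m x * (LK K ^^ k) ?u x * - LK K ?u x)) (at t)"
    unfolding heatF_def
    by (intro DERIV_sum)
       (auto intro!: derivative_eq_intros LK_pow_heat_deriv[OF assms] heat_deriv[OF assms] simp del: funpow.simps)
  moreover have "(\<Sum>x\<in>K. m x * - (LK K ^^ Suc k) ?u x * ?u x + m x * (LK K ^^ k) ?u x * - LK K ?u x)
      = - 2 * heatF K f (Suc k) t"
    using * by (simp add: heatF_def sum.distrib sum_subtractf sum_negf del: funpow.simps)
  ultimately show ?thesis by simp
qed

lemma heatF_antimono:
  assumes "finite K" "s \<le> t"
  shows "heatF K f k t \<le> heatF K f k s"
  using assms heatF_nonneg[OF assms(1)] heatF_deriv[OF assms(1)]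
  by (intro DERIV_nonpos_imp_nonincreasing[OF assms(2)])
     (metis mult_nonpos_nonneg neg_le_0_iff_le zero_le_numeral)

text \<open>By the mean value theorem the drop of one energy between s and t is 2 (t - s) times the
  next energy at some intermediate time, and this next energy is nonincreasing.\<close>

lemma heatF_step:
  assumes K: "finite K" and st: "s < t"
  shows "heatF K f (Suc k) t \<le> heatF K f k s / (2 * (t - s))"
proof -
  obtain z where z: "s < z" "z < t" "heatF K f k t - heatF K f k s = (t - s) * (- 2 * heatF K f (Suc k) z)"
    using MVT2[OF st heatF_deriv[OF K]] by blast
  have "(t - s) * heatF K f (Suc k) t \<le> (t - s) * heatF K f (Suc k) z"
    using st z by (intro mult_left_mono heatF_antimono K) auto
  then have "2 * (t - s) * heatF K f (Suc k) t \<le> heatF K f k s"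
    using z(3) heatF_nonneg[OF K, of f k t] by (simp add: algebra_simps)
  then show ?thesis using st by (simp add: field_simps)
qed

lemma heatF_decay:
  assumes K: "finite K" and d: "0 < d"
  shows "heatF K f k (real k * d) \<le> heatF K f 0 0 / (2 * d) ^ k"
proof (induction k)
  case (Suc k)
  have "heatF K f (Suc k) (real (Suc k) * d) \<le> heatF K f k (real k * d) / (2 * d)"
    using heatF_step[OF K, of "real k * d" "real (Suc k) * d" f k] d by (simp add: algebra_simps)
  also have "\<dots> \<le> heatF K f 0 0 / (2 * d) ^ k / (2 * d)"
    using d by (intro divide_right_mono Suc) auto
  finally show ?case by (simp add: mult.commute)
qed simp

lemma heat_pow_l2:
  assumes "finite K"
  shows "in_l2 m ((LK K ^^ j) (heat K f t))"
    and "(l2_norm m ((LK K ^^ j) (heat K f t)))\<^sup>2 = heatF K f (2 * j) t"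
proof -
  have off: "x \<notin> K \<Longrightarrow> (LK K ^^ j) (heat K f t) x = 0" for x by (simp add: LK_funpow_off heat_off)
  show "in_l2 m ((LK K ^^ j) (heat K f t))" by (rule finite_support_in_l2[OF assms off])
  have "l2_inner m ((LK K ^^ j) (heat K f t)) ((LK K ^^ j) (heat K f t))
      = (\<Sum>x\<in>K. m x * (LK K ^^ j) (heat K f t) x * (LK K ^^ j) (heat K f t) x)"
    by (rule l2_inner_finite_support[OF assms off])
  from this show "(l2_norm m ((LK K ^^ j) (heat K f t)))\<^sup>2 = heatF K f (2 * j) t"
    unfolding M.l2_inner_self heatF_even[OF assms] by (simp add: power2_eq_square mult.assoc)
qed

lemma heatF_0_le:
  assumes K: "finite K" and f: "in_l2 m f"
  shows "heatF K f 0 0 \<le> (l2_norm m f)\<^sup>2"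
proof -
  have "heatF K f 0 0 = (l2_norm m (trunc K f))\<^sup>2"
    using heat_pow_l2(2)[OF K, of 0 f 0] by (simp add: heat_0)
  also have "\<dots> \<le> (l2_norm m f)\<^sup>2"
    by (intro power_mono M.l2_norm_le f) (auto simp: trunc_def)
  finally show ?thesis .
qed

lemma heat_pow_l2_decay:
  assumes K: "finite K" and f: "in_l2 m f" and t: "0 < t" and j: "0 < j"
  shows "l2_norm m ((LK K ^^ j) (heat K f t)) \<le> l2_norm m f / (t / real j) ^ j"
proof (rule power2_le_imp_le)
  \<comment> \<open>The time t is spent in 2 j steps of length t / (2 j), each contributing a factor
    j / t.\<close>
  have "heatF K f (2 * j) t \<le> heatF K f 0 0 / (t / real j) ^ (2 * j)"
    using heatF_decay[OF K, of "t / (2 * real j)" f "2 * j"] t j by simp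
  also have "\<dots> \<le> (l2_norm m f)\<^sup>2 / (t / real j) ^ (2 * j)"
    using t by (intro divide_right_mono heatF_0_le K f) auto
  finally show "(l2_norm m ((LK K ^^ j) (heat K f t)))\<^sup>2 \<le> (l2_norm m f / (t / real j) ^ j)\<^sup>2"
    unfolding heat_pow_l2(2)[OF K] power_divide[of "l2_norm m f"] power_mult[symmetric]
    by (simp add: mult.commute)
qed (use t in auto)

lemma heat_l2_le:
  assumes K: "finite K" and f: "in_l2 m f" and t: "0 \<le> t"
  shows "l2_norm m (heat K f t) \<le> l2_norm m f"
proof (rule power2_le_imp_le)
  show "(l2_norm m (heat K f t))\<^sup>2 \<le> (l2_norm m f)\<^sup>2"
    using heat_pow_l2(2)[OF K, of 0 f t] heatF_0_le[OF K f] heatF_antimono[OF K t, of f 0] by simp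
qed simp

text \<open>A second order Taylor estimate in norm, reduced to scalar functions by pairing
  everything with the remainder R itself: the pairings \<open>F j\<close> satisfy F j' = - F (j +
  1), so two mean value estimates bound the squared norm of R by h^2 times a bound for
  \<open>F 2\<close>, and one factor \<open>l2_norm m R\<close> cancels. The condition on h keeps
  all times above t / 2, where the decay estimate for the second power produces the constant t /
  4.\<close>

lemma heat_taylor:
  assumes K: "finite K" and f: "in_l2 m f" and t: "0 < t" and h: "\<bar>h\<bar> \<le> t / 2"
  shows "l2_norm m (\<lambda>x. heat K f (t + h) x - heat K f t x + h * LK K (heat K f t) x)
     \<le> h\<^sup>2 * (l2_norm m f / (t / 4) ^ 2)"
proof -
  define R where "R x = heat K f (t + h) x - heat K f t x + h * LK K (heat K f t) x" for x
  have R0: "R x = 0" if "x \<notin> K" for x using that by (simp add: R_def heat_off LK_off)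
  have Rl2: "in_l2 m R" by (rule finite_support_in_l2[OF K R0])
  define D where "D = l2_norm m f / (t / 4) ^ 2 * l2_norm m R"
  define F where "F j s = l2_inner m ((LK K ^^ j) (heat K f s)) R" for j s
  have F: "F j s = (\<Sum>x\<in>K. m x * (LK K ^^ j) (heat K f s) x * R x)" for j s
    unfolding F_def by (rule l2_inner_finite_support[OF K R0])
  have dF: "(F j has_real_derivative - F (Suc j) s) (at s)" for j s
  proof -
    have "((\<lambda>s. \<Sum>x\<in>K. m x * (LK K ^^ j) (heat K f s) x * R x) has_real_derivative
       (\<Sum>x\<in>K. m x * - (LK K ^^ Suc j) (heat K f s) x * R x)) (at s)"
      by (intro DERIV_sum) (auto intro!: derivative_eq_intros LK_pow_heat_deriv[OF K] simp del: funpow.simps)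
    then show ?thesis unfolding F[abs_def] by (simp add: sum_negf del: funpow.simps)
  qed
  have F2: "\<bar>F 2 s\<bar> \<le> D" if s: "t / 2 \<le> s" for s
  proof -
    have s0: "0 < s" using s t by linarith
    have "l2_norm m ((LK K ^^ 2) (heat K f s)) \<le> l2_norm m f / (s / 2) ^ 2"
      using heat_pow_l2_decay[OF K f s0, of 2] by simp
    also have "\<dots> \<le> l2_norm m f / (t / 4) ^ 2"
      using s t s0 by (intro divide_left_mono power_mono mult_pos_pos zero_less_power) auto
    finally have "l2_norm m ((LK K ^^ 2) (heat K f s)) * l2_norm m R \<le> D"
      unfolding D_def by (rule mult_right_mono) simp
    then show ?thesis
      unfolding F_def using M.l2_cauchy_schwarz[OF heat_pow_l2(1)[OF K, of 2 f s] Rl2] by linarith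
  qed
  have D0: "0 \<le> D" by (simp add: D_def)
  define S where "S = {t - \<bar>h\<bar> .. t + \<bar>h\<bar>}"
  have S: "s \<in> S \<Longrightarrow> t / 2 \<le> s" "s \<in> S \<Longrightarrow> \<bar>s - t\<bar> \<le> \<bar>h\<bar>" for s using h unfolding S_def by auto
  have F1: "\<bar>F 1 s - F 1 t\<bar> \<le> D * \<bar>h\<bar>" if s: "s \<in> S" for s
  proof -
    have "norm (F 1 s - F 1 t) \<le> D * norm (s - t)"
    proof (rule field_differentiable_bound[of S "F 1" "\<lambda>s. - F 2 s"])
      fix r assume r: "r \<in> S"
      show "(F 1 has_field_derivative - F 2 r) (at r within S)"
        using DERIV_subset[OF dF[of 1 r], of S] by (simp add: numeral_2_eq_2)
      show "norm (- F 2 r) \<le> D" using F2[OF S(1)[OF r]] by simp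
    qed (use s in \<open>auto simp: S_def\<close>)
    also have "\<dots> \<le> D * \<bar>h\<bar>" using S(2)[OF s] D0 by (intro mult_left_mono) auto
    finally show ?thesis by simp
  qed
  \<comment> \<open>Adding the linear term makes the derivative of \<psi> equal to F 1 t - F 1 s,
    which is of order h on S; its increment from t to t + h is exactly the squared norm of
    R.\<close>
  define \<psi> where "\<psi> s = F 0 s + s * F 1 t" for s
  have "norm (\<psi> (t + h) - \<psi> t) \<le> D * \<bar>h\<bar> * norm (t + h - t)"
  proof (rule field_differentiable_bound[of S \<psi> "\<lambda>s. - F 1 s + F 1 t"])
    fix s assume s: "s \<in> S"
    show "(\<psi> has_field_derivative - F 1 s + F 1 t) (at s within S)"
      unfolding \<psi>_def
      using DERIV_subset[OF DERIV_add[OF dF[of 0 s] DERIV_cmult_right[OF DERIV_ident, of "F 1 t"]]]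
      by (simp add: mult.commute)
    show "norm (- F 1 s + F 1 t) \<le> D * \<bar>h\<bar>" using F1[OF s] by simp
  qed (auto simp: S_def)
  then have "\<bar>\<psi> (t + h) - \<psi> t\<bar> \<le> D * h\<^sup>2" by (simp add: power2_eq_square)
  moreover have "\<psi> (t + h) - \<psi> t = (l2_norm m R)\<^sup>2"
  proof -
    have "(l2_norm m R)\<^sup>2 = (\<Sum>x\<in>K. m x * R x * R x)"
      unfolding M.l2_inner_self[symmetric] by (rule l2_inner_finite_support[OF K R0])
    also have "\<dots> = (\<Sum>x\<in>K. m x * heat K f (t + h) x * R x - m x * heat K f t x * R x
        + h * (m x * LK K (heat K f t) x * R x))"
      by (intro sum.cong refl, subst (2) R_def) (simp add: algebra_simps)
    also have "\<dots> = F 0 (t + h) - F 0 t + h * F 1 t"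
      by (simp add: F sum.distrib sum_subtractf sum_distrib_left)
    finally show ?thesis by (simp add: \<psi>_def distrib_right)
  qed
  ultimately have "(l2_norm m R) * l2_norm m R \<le> (h\<^sup>2 * (l2_norm m f / (t / 4) ^ 2)) * l2_norm m R"
    by (simp add: D_def power2_eq_square mult_ac)
  then have "l2_norm m R \<le> h\<^sup>2 * (l2_norm m f / (t / 4) ^ 2)"
    by (cases "l2_norm m R = 0") (simp, metis M.l2_norm_nonneg mult_right_le_imp_le order_less_le)
  then show ?thesis unfolding R_def[abs_def] .
qed

section \<open>Uniqueness of semigroup orbits\<close>

text \<open>Only the total energy is known to converge, not its two parts. So the killing part over
  a finite set F is subtracted first, where pointwise convergence is enough, Fatou's lemma is
  applied to the gradient part, and F is then allowed to grow.\<close>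

lemma gen_form_fatou:
  assumes lim: "\<And>x. (\<lambda>n. f n x) \<longlonglongrightarrow> h x" and fin: "\<And>n. energy_finite b c (f n)"
    and q: "(\<lambda>n. gen_form b c (f n) (f n)) \<longlonglongrightarrow> q"
  shows "energy_finite b c h" and "gen_form b c h h \<le> q"
proof -
  have step: "in_l2 bw (grad h) \<and> (l2_norm bw (grad h))\<^sup>2 \<le> 2 * (q - (\<Sum>x\<in>F. c x * (h x)\<^sup>2))"
    if F: "finite F" for F
  proof -
    have 1: "(\<lambda>n. bw p * (grad (f n) p)\<^sup>2) \<longlonglongrightarrow> bw p * (grad h p)\<^sup>2" for p
      unfolding grad_def by (cases p) (auto intro!: tendsto_intros lim)
    have 2: "(\<lambda>n. 2 * (gen_form b c (f n) (f n) - (\<Sum>x\<in>F. c x * (f n x)\<^sup>2)))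
        \<longlonglongrightarrow> 2 * (q - (\<Sum>x\<in>F. c x * (h x)\<^sup>2))"
      by (intro tendsto_intros q lim)
    have 3: "(\<lambda>p. bw p * (grad (f n) p)\<^sup>2) summable_on UNIV \<and>
       (\<Sum>\<^sub>\<infinity>p. bw p * (grad (f n) p)\<^sup>2) \<le> 2 * (gen_form b c (f n) (f n) - (\<Sum>x\<in>F. c x * (f n x)\<^sup>2))" for n
    proof -
      have "(\<Sum>x\<in>F. c x * (f n x)\<^sup>2) \<le> (l2_norm c (f n))\<^sup>2"
        using fin[of n] unfolding C.l2_norm_sq energy_finite_iff in_l2_def
        by (intro finite_sum_le_infsum F) auto
      then show ?thesis
        using fin[of n] by (simp add: energy_finite_iff in_l2_def gen_form_self flip: E.l2_norm_sq)
    qed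
    note F = infsum_fatou[OF 1 _ always_eventually[OF allI[OF 3]] 2]
    show ?thesis using F by (simp add: in_l2_def E.l2_norm_sq)
  qed
  have c: "(\<Sum>x\<in>F. c x * (h x)\<^sup>2) \<le> q - 1/2 * (l2_norm bw (grad h))\<^sup>2" if "finite F" for F
    using step[OF that] by simp
  have cs: "(\<lambda>x. c x * (h x)\<^sup>2) summable_on UNIV"
    using c by (intro nonneg_bdd_above_summable_on) (auto intro!: bdd_aboveI2)
  show "energy_finite b c h" using step[of "{}"] cs by (simp add: energy_finite_iff in_l2_def)
  have "(l2_norm c h)\<^sup>2 \<le> q - 1/2 * (l2_norm bw (grad h))\<^sup>2"
    unfolding C.l2_norm_sq using c by (intro infsum_le_finite_sums cs) auto
  then show "gen_form b c h h \<le> q" by (simp add: gen_form_self)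
qed

section \<open>The form domain and the operator L\<close>

lemma fin_supp_off: "x \<notin> {x. \<phi> x \<noteq> 0} \<Longrightarrow> \<phi> x = 0"
  by simp

lemma fin_supp_form_domain:
  assumes "fin_supp \<phi>"
  shows "form_domain b c m \<phi>"
proof -
  have "(\<lambda>n. l2_norm m (\<lambda>x. \<phi> x - \<phi> x)) \<longlonglongrightarrow> 0"
    "(\<lambda>n. gen_form b c (\<lambda>x. \<phi> x - \<phi> x) (\<lambda>x. \<phi> x - \<phi> x)) \<longlonglongrightarrow> 0"
    by (simp_all add: l2_norm_def gen_form_def case_prod_unfold)
  moreover have F: "finite {x. \<phi> x \<noteq> 0}" using assms by (simp add: fin_supp_def)
  ultimately show ?thesis
    unfolding form_domain_def
    by (intro conjI exI[of _ "\<lambda>_. \<phi>"] allI assms finite_support_energy[OF F fin_supp_off]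
        finite_support_in_l2[OF F fin_supp_off])
qed

text \<open>Point masses belong to the form domain and determine a representative pointwise, which
  gives the definite description in \<open>L_op\<close> its meaning.\<close>

lemma L_rep_unique:
  assumes "L_rep b c m u w1" "L_rep b c m u w2"
  shows "w1 = w2"
proof
  fix x
  define \<delta> where "\<delta> y = (if y = x then 1 else 0 :: real)" for y :: 'v
  have "fin_supp \<delta>" by (simp add: fin_supp_def \<delta>_def)
  then have "l2_inner m w1 \<delta> = l2_inner m w2 \<delta>"
    using assms fin_supp_form_domain unfolding L_rep_def by metis
  moreover have "l2_inner m w \<delta> = m x * w x" for w
    by (subst l2_inner_finite_support[of "{x}"]) (auto simp: \<delta>_def)
  ultimately show "w1 x = w2 x" by simp
qed

lemma L_op_eq: "L_rep b c m u w \<Longrightarrow> L_op b c m u = w"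
  unfolding L_op_def using L_rep_unique by blast

text \<open>Testing with finitely supported functions suffices: every element of the form domain is
  approximated by them in the form norm, for which both sides are continuous.\<close>

lemma L_repI:
  assumes u: "energy_finite b c u" and w: "in_l2 m w"
    and eq: "\<And>\<phi>. fin_supp \<phi> \<Longrightarrow> gen_form b c u \<phi> = l2_inner m w \<phi>"
  shows "L_rep b c m u w"
  unfolding L_rep_def
proof (intro conjI allI impI w)
  fix v assume "form_domain b c m v"
  then obtain \<phi> where v: "in_l2 m v" "energy_finite b c v" and \<phi>: "\<And>n. fin_supp (\<phi> n)"
    "(\<lambda>n. l2_norm m (\<lambda>x. \<phi> n x - v x)) \<longlonglongrightarrow> 0"
    "(\<lambda>n. gen_form b c (\<lambda>x. \<phi> n x - v x) (\<lambda>x. \<phi> n x - v x)) \<longlonglongrightarrow> 0"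
    unfolding form_domain_def by blast
  have \<phi>l2: "in_l2 m (\<phi> n)" and \<phi>E: "energy_finite b c (\<phi> n)" for n
    using fin_supp_form_domain[OF \<phi>(1)[of n]] by (auto simp: form_domain_def)
  let ?A = "l2_norm bw (grad u) + l2_norm c u"
  have "(\<lambda>n. ?A * sqrt (gen_form b c (\<lambda>x. \<phi> n x - v x) (\<lambda>x. \<phi> n x - v x))
      + l2_norm m w * l2_norm m (\<lambda>x. \<phi> n x - v x)) \<longlonglongrightarrow> ?A * sqrt 0 + l2_norm m w * 0"
    by (intro tendsto_intros \<phi>)
  moreover have "\<bar>gen_form b c u v - l2_inner m w v\<bar> \<le>
      ?A * sqrt (gen_form b c (\<lambda>x. \<phi> n x - v x) (\<lambda>x. \<phi> n x - v x))
      + l2_norm m w * l2_norm m (\<lambda>x. \<phi> n x - v x)" for n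
  proof -
    have "gen_form b c u v - l2_inner m w v =
        - gen_form b c u (\<lambda>x. \<phi> n x - v x) + l2_inner m w (\<lambda>x. \<phi> n x - v x)"
      using eq[OF \<phi>(1)[of n]] gen_form_diff_right[OF \<phi>E v(2) u] M.l2_inner_diff_right[OF \<phi>l2 v(1) w]
      by simp
    then show ?thesis
      using gen_form_bound[OF u energy_finite_diff[OF \<phi>E v(2)], of n]
        M.l2_cauchy_schwarz[OF w M.in_l2_diff[OF \<phi>l2 v(1)], of n] by linarith
  qed
  ultimately have "\<bar>gen_form b c u v - l2_inner m w v\<bar> \<le> ?A * sqrt 0 + l2_norm m w * 0"
    by (intro LIMSEQ_le_const) auto
  then show "gen_form b c u v = l2_inner m w v" by simp
qed

lemma L_rep_diff_nonneg:
  assumes "form_domain b c m u1" "form_domain b c m u2" "L_rep b c m u1 w1" "L_rep b c m u2 w2"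
  shows "0 \<le> l2_inner m (\<lambda>x. w1 x - w2 x) (\<lambda>x. u1 x - u2 x)"
proof -
  have E: "energy_finite b c u1" "energy_finite b c u2" "in_l2 m u1" "in_l2 m u2" "in_l2 m w1" "in_l2 m w2"
    using assms by (auto simp: form_domain_def L_rep_def)
  have "gen_form b c (\<lambda>x. u1 x - u2 x) (\<lambda>x. u1 x - u2 x) = l2_inner m (\<lambda>x. w1 x - w2 x) (\<lambda>x. u1 x - u2 x)"
    using assms E unfolding L_rep_def
    by (simp add: gen_form_diff_left gen_form_diff_right energy_finite_diff
        M.l2_inner_diff_left M.l2_inner_diff_right M.in_l2_diff)
  then show ?thesis using gen_form_self_nonneg by metis
qed

text \<open>For the difference D of two orbits and the difference W of their images under L, the
  squared norm of D has derivative -2 (W, D), which is nonpositive because L is monotone. Norm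
  continuity at 0 ties it to the initial value 0.\<close>

lemma sg_orbit_unique:
  assumes 1: "sg_orbit b c m f U1" and 2: "sg_orbit b c m f U2" and t: "0 \<le> t"
  shows "U1 t = U2 t"
proof -
  define D where "D s x = U1 s x - U2 s x" for s x
  define W where "W s x = L_op b c m (U1 s) x - L_op b c m (U2 s) x" for s x
  have l2: "in_l2 m (U1 s)" "in_l2 m (U2 s)" "in_l2 m (D s)" if "0 \<le> s" for s
    using 1 2 that unfolding sg_orbit_def D_def by (auto intro!: M.in_l2_diff)
  have Lrep: "L_rep b c m (U s) (L_op b c m (U s))" "form_domain b c m (U s)"
    if "0 < s" "sg_orbit b c m f U" for U s
    using that L_op_eq unfolding sg_orbit_def L_dom_def by auto
  have Wl2: "in_l2 m (W s)" if "0 < s" for s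
    using Lrep[OF that 1] Lrep[OF that 2] unfolding W_def by (intro M.in_l2_diff) (auto simp: L_rep_def)
  have pos: "0 \<le> l2_inner m (W s) (D s)" if "0 < s" for s
    using L_rep_diff_nonneg[OF Lrep(2)[OF that 1] Lrep(2)[OF that 2] Lrep(1)[OF that 1] Lrep(1)[OF that 2]]
    by (simp add: W_def[abs_def] D_def[abs_def])
  have cont: "continuous_on {0..} (\<lambda>s. l2_norm m (D s))"
    unfolding continuous_on_def
  proof
    fix s :: real assume s: "s \<in> {0..}"
    have "((\<lambda>r. l2_norm m (\<lambda>x. U1 r x - U1 s x) + l2_norm m (\<lambda>x. U2 r x - U2 s x)) \<longlongrightarrow> 0 + 0) (at s within {0..})"
      using 1 2 s unfolding sg_orbit_def by (intro tendsto_add) auto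
    then have lim: "((\<lambda>r. l2_norm m (\<lambda>x. U1 r x - U1 s x) + l2_norm m (\<lambda>x. U2 r x - U2 s x)) \<longlongrightarrow> 0) (at s within {0..})"
      by simp
    have "\<forall>\<^sub>F r in at s within {0..}. norm (l2_norm m (D r) - l2_norm m (D s))
       \<le> l2_norm m (\<lambda>x. U1 r x - U1 s x) + l2_norm m (\<lambda>x. U2 r x - U2 s x)"
    proof (unfold eventually_at_filter, intro always_eventually allI impI)
      fix r :: real assume r: "r \<in> {0..}"
      have "l2_norm m (D r) \<le> l2_norm m (\<lambda>x. D r x - D s x) + l2_norm m (D s)"
        "l2_norm m (D s) \<le> l2_norm m (\<lambda>x. D r x - D s x) + l2_norm m (D r)"
        using M.l2_norm_triangle_diff[OF l2(3) l2(3), of r s] M.l2_norm_triangle_diff[OF l2(3) l2(3), of s r] r s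
        by (auto simp: M.l2_norm_minus_commute[of "D s" "D r"])
      moreover have "l2_norm m (\<lambda>x. D r x - D s x) \<le>
          l2_norm m (\<lambda>x. U1 r x - U1 s x) + l2_norm m (\<lambda>x. U2 r x - U2 s x)"
      proof -
        have "l2_norm m (\<lambda>x. (U1 r x - U1 s x) + -1 * (U2 r x - U2 s x)) \<le>
            l2_norm m (\<lambda>x. U1 r x - U1 s x) + l2_norm m (\<lambda>x. -1 * (U2 r x - U2 s x))"
          using l2 r s by (intro M.l2_norm_triangle M.in_l2_scale M.in_l2_diff) auto
        then show ?thesis unfolding M.l2_norm_scale by (simp add: D_def algebra_simps)
      qed
      ultimately show "norm (l2_norm m (D r) - l2_norm m (D s))
       \<le> l2_norm m (\<lambda>x. U1 r x - U1 s x) + l2_norm m (\<lambda>x. U2 r x - U2 s x)"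
        by (simp add: abs_le_iff)
    qed
    then show "((\<lambda>r. l2_norm m (D r)) \<longlongrightarrow> l2_norm m (D s)) (at s within {0..})"
      by (rule LIM_zero_cancel[OF Lim_null_comparison[OF _ lim]])
  qed
  have deriv: "((\<lambda>s. (l2_norm m (D s))\<^sup>2) has_real_derivative - 2 * l2_inner m (W s) (D s)) (at s)"
    if s: "0 < s" for s
  proof -
    define A where "A h x = (D (s + h) x - D s x) / h + W s x" for h x
    have ev: "\<forall>\<^sub>F h in at (0::real). h \<noteq> 0 \<and> 0 < s + h"
      unfolding eventually_at using s by (intro exI[of _ s]) (auto simp: dist_real_def)
    have A1: "(\<lambda>x. (D (s + h) x - D s x) / h) = (\<lambda>x. (1/h) * (D (s + h) x - D s x))" for h by auto
    have Al2: "in_l2 m (A h)" if "0 < s + h" for h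
    proof -
      have "in_l2 m (\<lambda>x. (D (s + h) x - D s x) / h)"
        unfolding A1 using that s by (intro M.in_l2_scale M.in_l2_diff l2(3)) auto
      then show ?thesis unfolding A_def[abs_def] by (rule M.in_l2_add[OF _ Wl2[OF s]])
    qed
    have A0: "((\<lambda>h. l2_norm m (A h)) \<longlongrightarrow> 0) (at 0)"
    proof (rule Lim_null_comparison)
      let ?a = "\<lambda>U h x. (U (s + h) x - U s x) / h + L_op b c m (U s) x"
      show "((\<lambda>h. l2_norm m (?a U1 h) + l2_norm m (?a U2 h)) \<longlongrightarrow> 0) (at 0)"
        using 1 2 s unfolding sg_orbit_def by (intro tendsto_eq_intros) auto
      show "\<forall>\<^sub>F h in at 0. norm (l2_norm m (A h)) \<le> l2_norm m (?a U1 h) + l2_norm m (?a U2 h)"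
        using ev
      proof eventually_elim
        case (elim h)
        have a: "in_l2 m (?a U h)" if "sg_orbit b c m f U" for U
        proof -
          have "in_l2 m (U (s + h))" "in_l2 m (U s)" using that elim s unfolding sg_orbit_def by auto
          from M.in_l2_scale[OF M.in_l2_diff[OF this], of "1/h"]
          have "in_l2 m (\<lambda>x. (U (s + h) x - U s x) / h)" by simp
          then show ?thesis using Lrep(1)[OF s that] by (intro M.in_l2_add) (auto simp: L_rep_def)
        qed
        have "l2_norm m (\<lambda>x. ?a U1 h x + -1 * ?a U2 h x) \<le> l2_norm m (?a U1 h) + l2_norm m (\<lambda>x. -1 * ?a U2 h x)"
          by (intro M.l2_norm_triangle M.in_l2_scale a 1 2)
        moreover have "(\<lambda>x. ?a U1 h x + -1 * ?a U2 h x) = A h"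
          by (auto simp: A_def D_def W_def fun_eq_iff diff_divide_distrib)
        ultimately show ?case unfolding M.l2_norm_scale by simp
      qed
    qed
    \<comment> \<open>Since D (s + h) = D s + h (A h - W s), expanding the square shows that this
      expression is the difference quotient of the squared norm. A h tends to 0 in norm, so only the
      middle term survives.\<close>
    have "((\<lambda>h. 2 * l2_inner m (A h) (D s) - 2 * l2_inner m (W s) (D s) + h * (l2_norm m (\<lambda>x. A h x - W s x))\<^sup>2)
       \<longlongrightarrow> 2 * 0 - 2 * l2_inner m (W s) (D s) + 0) (at 0)"
    proof (intro tendsto_intros)
      show "((\<lambda>h. l2_inner m (A h) (D s)) \<longlongrightarrow> 0) (at 0)"
      proof (rule Lim_null_comparison)
        show "((\<lambda>h. l2_norm m (A h) * l2_norm m (D s)) \<longlongrightarrow> 0) (at 0)"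
          using tendsto_mult_left_zero[OF A0] by simp
        show "\<forall>\<^sub>F h in at 0. norm (l2_inner m (A h) (D s)) \<le> l2_norm m (A h) * l2_norm m (D s)"
          using ev by eventually_elim (use s in \<open>auto intro!: M.l2_cauchy_schwarz Al2 l2\<close>)
      qed
      show "((\<lambda>h. h * (l2_norm m (\<lambda>x. A h x - W s x))\<^sup>2) \<longlongrightarrow> 0) (at 0)"
      proof (rule Lim_null_comparison)
        have "((\<lambda>h. \<bar>h\<bar> * (l2_norm m (A h) + l2_norm m (W s))\<^sup>2) \<longlongrightarrow> \<bar>0\<bar> * (0 + l2_norm m (W s))\<^sup>2) (at 0)"
          by (intro tendsto_intros A0)
        then show "((\<lambda>h. \<bar>h\<bar> * (l2_norm m (A h) + l2_norm m (W s))\<^sup>2) \<longlongrightarrow> 0) (at 0)" by simp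
        show "\<forall>\<^sub>F h in at 0. norm (h * (l2_norm m (\<lambda>x. A h x - W s x))\<^sup>2) \<le> \<bar>h\<bar> * (l2_norm m (A h) + l2_norm m (W s))\<^sup>2"
          using ev
        proof eventually_elim
          case (elim h)
          have "l2_norm m (\<lambda>x. A h x + -1 * W s x) \<le> l2_norm m (A h) + l2_norm m (\<lambda>x. -1 * W s x)"
            using elim by (intro M.l2_norm_triangle M.in_l2_scale Al2 Wl2 s) auto
          then have "l2_norm m (\<lambda>x. A h x - W s x) \<le> l2_norm m (A h) + l2_norm m (W s)"
            unfolding M.l2_norm_scale by simp
          then show ?case by (simp add: abs_mult mult_left_mono power_mono)
        qed
      qed
    qed
    moreover have "\<forall>\<^sub>F h in at 0. 2 * l2_inner m (A h) (D s) - 2 * l2_inner m (W s) (D s)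
        + h * (l2_norm m (\<lambda>x. A h x - W s x))\<^sup>2 = ((l2_norm m (D (s + h)))\<^sup>2 - (l2_norm m (D s))\<^sup>2) / h"
      using ev
    proof eventually_elim
      case (elim h)
      have AW: "in_l2 m (\<lambda>x. A h x - W s x)" using elim by (intro M.in_l2_diff Al2 Wl2 s) auto
      have "D (s + h) = (\<lambda>x. D s x + h * (A h x - W s x))"
        using elim by (auto simp: A_def fun_eq_iff)
      then have "(l2_norm m (D (s + h)))\<^sup>2 = (l2_norm m (D s))\<^sup>2
          + 2 * (h * (l2_inner m (A h) (D s) - l2_inner m (W s) (D s))) + h\<^sup>2 * (l2_norm m (\<lambda>x. A h x - W s x))\<^sup>2"
        using M.l2_norm_add_sq[OF l2(3) M.in_l2_scale[OF AW], of s h] s elim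
        by (simp add: M.l2_inner_scale_right M.l2_norm_scale power_mult_distrib
            M.l2_inner_diff_left[OF Al2 Wl2 l2(3)] M.l2_inner_commute[of "D s"])
      then show ?case using elim by (simp add: field_simps power2_eq_square)
    qed
    ultimately show ?thesis unfolding DERIV_def by (auto elim: Lim_transform_eventually)
  qed
  have "(l2_norm m (D t))\<^sup>2 \<le> (l2_norm m (D 0))\<^sup>2"
  proof (rule DERIV_nonpos_imp_decreasing_open[OF t])
    fix s assume "0 < s" "s < t"
    then show "\<exists>y. ((\<lambda>s. (l2_norm m (D s))\<^sup>2) has_real_derivative y) (at s) \<and> y \<le> 0"
      using deriv[of s] pos[of s] by (intro exI[of _ "- 2 * l2_inner m (W s) (D s)"]) auto
  next
    show "continuous_on {0..t} (\<lambda>s. (l2_norm m (D s))\<^sup>2)"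
      by (intro continuous_intros continuous_on_subset[OF cont]) auto
  qed
  moreover have "D 0 = (\<lambda>_. 0)" using 1 2 by (auto simp: D_def sg_orbit_def)
  ultimately have "l2_norm m (D t) = 0" by (simp add: l2_norm_def)
  then have "D t x = 0" for x by (rule M.l2_norm_eq_0D[OF l2(3)[OF t]]) simp
  then show ?thesis by (simp add: D_def fun_eq_iff)
qed

text \<open>At a fixed vertex \<open>Ltilde\<close> of a bounded function is bounded, so the
  Lipschitz constant in time involves only the vertex and the bound B. It therefore does not depend
  on the finite set and survives limits.\<close>

lemma lipschitz_of_bounded_heat:
  fixes w :: "real \<Rightarrow> 'v \<Rightarrow> real"
  assumes deriv: "\<And>t. 0 \<le> t \<Longrightarrow> ((\<lambda>s. w s x) has_real_derivative - Ltilde b c m (w t) x) (at t)"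
    and B: "\<And>t y. 0 \<le> t \<Longrightarrow> \<bar>w t y\<bar> \<le> B" and s: "0 \<le> s" "0 \<le> t"
  shows "\<bar>w t x - w s x\<bar> \<le> 2 * deg x * B / m x * \<bar>t - s\<bar>"
proof -
  have "norm (w t x - w s x) \<le> 2 * deg x * B / m x * norm (t - s)"
  proof (rule field_differentiable_bound[of "{0..}" "\<lambda>t. w t x" "\<lambda>t. - Ltilde b c m (w t) x"])
    fix r :: real assume r: "r \<in> {0..}"
    show "((\<lambda>t. w t x) has_field_derivative - Ltilde b c m (w r) x) (at r within {0..})"
      using r by (intro DERIV_subset[OF deriv]) auto
    show "norm (- Ltilde b c m (w r) x) \<le> 2 * deg x * B / m x"
      using r by (simp add: Ltilde_le B)
  qed (use s in auto)
  then show ?thesis by simp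
qed

lemma heat_lipschitz:
  assumes K: "finite K" and f: "\<And>x. 0 \<le> f x" "\<And>x. f x \<le> B" and s: "0 \<le> s" "0 \<le> t"
  shows "\<bar>heat K f t x - heat K f s x\<bar> \<le> 2 * deg x * B / m x * \<bar>t - s\<bar>"
proof -
  have B: "0 \<le> B" using f order_trans by blast
  have "0 \<le> heat K f r y" "heat K f r y \<le> B" if "0 \<le> r" for r y
    using that by (auto intro!: heat_nonneg heat_le K f B)
  then have bd: "\<bar>heat K f r y\<bar> \<le> B" if "0 \<le> r" for r y using that by simp
  show ?thesis
  proof (cases "x \<in> K")
    case True
    show ?thesis by (rule lipschitz_of_bounded_heat[OF heat_deriv'[OF K True] bd s])
  qed (use B in \<open>simp add: heat_off\<close>)
qed

end

section \<open>The semigroup as a monotone limit\<close>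

locale exhausted_graph = graph_measure b c m
  for b :: "'v \<Rightarrow> 'v \<Rightarrow> real" and c m :: "'v \<Rightarrow> real" +
  fixes X :: "nat \<Rightarrow> 'v set"
  assumes finite_X [simp]: "finite (X n)" and incseq_X: "incseq X" and cover: "(\<Union>n. X n) = UNIV"
begin

lemma eventually_in_X: "\<forall>\<^sub>F n in sequentially. x \<in> X n"
proof -
  obtain N where "x \<in> X N" using cover by blast
  then have "n \<ge> N \<Longrightarrow> x \<in> X n" for n using incseqD[OF incseq_X, of N n] by blast
  then show ?thesis by (auto simp: eventually_sequentially)
qed

lemma eventually_subset_X: "finite F \<Longrightarrow> \<forall>\<^sub>F n in sequentially. F \<subseteq> X n"
  using eventually_ball_finite[of F "\<lambda>n x. x \<in> X n" sequentially] eventually_in_X by (simp add: subset_iff Ball_def)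

definition heatlim :: "('v \<Rightarrow> real) \<Rightarrow> real \<Rightarrow> 'v \<Rightarrow> real" where
  "heatlim f t x = lim (\<lambda>n. heat (X n) f t x)"

lemma heat_X_incseq:
  assumes "\<And>x. 0 \<le> f x" "0 \<le> t"
  shows "incseq (\<lambda>n. heat (X n) f t x)"
  using incseq_X assms by (auto intro!: incseq_SucI heat_mono dest: incseq_SucD)

lemma heat_tendsto_le:
  assumes f: "\<And>x. 0 \<le> f x" "\<And>x. f x \<le> B" and t: "0 \<le> t"
  shows "(\<lambda>n. heat (X n) f t x) \<longlonglongrightarrow> heatlim f t x" and "heat (X n) f t x \<le> heatlim f t x"
proof -
  have "0 \<le> B" using f order_trans by blast
  then have "\<forall>n. heat (X n) f t x \<le> B" using f t by (auto intro!: heat_le)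
  from incseq_convergent[OF heat_X_incseq[OF f(1) t] this]
  obtain L where L: "(\<lambda>n. heat (X n) f t x) \<longlonglongrightarrow> L" "\<forall>n. heat (X n) f t x \<le> L" by blast
  moreover have "heatlim f t x = L" unfolding heatlim_def by (rule limI[OF L(1)])
  ultimately show "(\<lambda>n. heat (X n) f t x) \<longlonglongrightarrow> heatlim f t x" "heat (X n) f t x \<le> heatlim f t x"
    by auto
qed

context
  fixes g :: "'v \<Rightarrow> real" and B :: real
  assumes g0: "\<And>x. 0 \<le> g x" and gB: "\<And>x. g x \<le> B" and gfs: "fin_supp g"
begin

lemma finite_support_g: "finite {x. g x \<noteq> 0}" using gfs by (simp add: fin_supp_def)

lemma g_in_l2: "in_l2 m g"
  by (rule finite_support_in_l2[OF finite_support_g]) simp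

lemma B_nonneg: "0 \<le> B" using g0 gB order_trans by blast

lemma heat_X_bound: "0 \<le> t \<Longrightarrow> \<bar>heat (X n) g t x\<bar> \<le> B"
  using heat_nonneg[of "X n" g t x] heat_le[of "X n" g B t x] g0 gB B_nonneg by simp

lemma heatlim_tendsto: "0 \<le> t \<Longrightarrow> (\<lambda>n. heat (X n) g t x) \<longlonglongrightarrow> heatlim g t x"
  by (rule heat_tendsto_le(1)[OF g0 gB])

lemma heatlim_bound: "0 \<le> t \<Longrightarrow> \<bar>heatlim g t x\<bar> \<le> B"
  by (rule LIMSEQ_le_const2[OF tendsto_rabs[OF heatlim_tendsto]]) (auto intro: heat_X_bound)

lemma heat_X_le_heatlim: "0 \<le> t \<Longrightarrow> heat (X n) g t x \<le> heatlim g t x"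
  by (rule heat_tendsto_le(2)[OF g0 gB])

lemma bounded_heatlim: "0 \<le> t \<Longrightarrow> bounded (range (heatlim g t))"
  using heatlim_bound unfolding bounded_iff by auto

section \<open>Convergence of the finite flows in l2 and in energy\<close>

lemma heat_X_in_l2: "in_l2 m (heat (X n) g t)"
  using heat_pow_l2(1)[of "X n" 0 g t] by simp

lemma heatlim_l2: "0 \<le> t \<Longrightarrow> in_l2 m (heatlim g t)" "0 \<le> t \<Longrightarrow> l2_norm m (heatlim g t) \<le> l2_norm m g"
  using M.l2_norm_fatou[of "\<lambda>n. heat (X n) g t" "heatlim g t" "l2_norm m g"] heatlim_tendsto heat_X_in_l2 heat_l2_le g_in_l2
  by auto

text \<open>The approximation is nonnegative and from below, so the limit itself is a square
  summable majorant of the error.\<close>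

lemma heat_X_l2_tendsto:
  assumes t: "0 \<le> t"
  shows "(\<lambda>n. l2_norm m (\<lambda>x. heat (X n) g t x - heatlim g t x)) \<longlonglongrightarrow> 0"
proof (rule M.l2_norm_tendsto_dominated[OF heatlim_l2(1)[OF t]])
  show "(\<lambda>n. heat (X n) g t x - heatlim g t x) \<longlonglongrightarrow> 0" for x
    using tendsto_diff[OF heatlim_tendsto[OF t, of x] tendsto_const[of "heatlim g t x"]] by simp
  show "\<forall>\<^sub>F n in sequentially. \<forall>x. \<bar>heat (X n) g t x - heatlim g t x\<bar> \<le> \<bar>heatlim g t x\<bar>"
  proof (intro always_eventually allI)
    fix n x show "\<bar>heat (X n) g t x - heatlim g t x\<bar> \<le> \<bar>heatlim g t x\<bar>"
      using heat_X_le_heatlim[OF t, of n x] heat_nonneg[of "X n" g t x] g0 t by simp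
  qed
qed

lemma LK_heat_X_tendsto:
  assumes t: "0 \<le> t"
  shows "(\<lambda>n. LK (X n) (heat (X n) g t) x) \<longlonglongrightarrow> Ltilde b c m (heatlim g t) x"
proof -
  have "(\<lambda>n. Ltilde b c m (heat (X n) g t) x) \<longlonglongrightarrow> Ltilde b c m (heatlim g t) x"
    using t by (intro Ltilde_tendsto[where C = B] always_eventually allI heat_X_bound bounded_heatlim heatlim_tendsto)
  moreover have "\<forall>\<^sub>F n in sequentially. Ltilde b c m (heat (X n) g t) x = LK (X n) (heat (X n) g t) x"
    using eventually_in_X[of x] by eventually_elim (simp add: LK_eq_Ltilde heat_off)
  ultimately show ?thesis by (rule Lim_transform_eventually)
qed

lemma LK_heat_X_l2: "0 < t \<Longrightarrow> in_l2 m (LK (X n) (heat (X n) g t)) \<and> l2_norm m (LK (X n) (heat (X n) g t)) \<le> l2_norm m g / t"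
  using heat_pow_l2(1)[of "X n" 1 g t] heat_pow_l2_decay[of "X n" g t 1] g_in_l2 by simp

lemma Ltilde_heatlim_in_l2: "0 < t \<Longrightarrow> in_l2 m (Ltilde b c m (heatlim g t))"
  by (rule M.l2_norm_fatou(1)[OF LK_heat_X_tendsto always_eventually[OF allI[OF LK_heat_X_l2]]]) auto

text \<open>The energy of u_n is the pairing of its \<open>LK\<close> image with u_n. The image
  converges weakly and is bounded in norm, while u_n converges in norm to U, so splitting u_n as U +
  (u_n - U) gives the limit.\<close>

lemma heat_X_energy_tendsto:
  assumes t: "0 < t"
  shows "(\<lambda>n. gen_form b c (heat (X n) g t) (heat (X n) g t)) \<longlonglongrightarrow> l2_inner m (Ltilde b c m (heatlim g t)) (heatlim g t)"
proof -
  have t0: "0 \<le> t" using t by simp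
  let ?u = "\<lambda>n. heat (X n) g t" and ?U = "heatlim g t"
  let ?v = "\<lambda>n. LK (X n) (?u n)"
  note Ul2 = heatlim_l2(1)[OF t0]
  have "(\<lambda>n. l2_inner m (?v n) ?U) \<longlonglongrightarrow> l2_inner m (Ltilde b c m ?U) ?U"
    by (rule M.l2_inner_tendsto_weak[OF always_eventually[OF allI[OF LK_heat_X_l2[OF t]]] LK_heat_X_tendsto[OF t0] Ul2])
  moreover have "(\<lambda>n. l2_inner m (?v n) (\<lambda>x. ?u n x - ?U x)) \<longlonglongrightarrow> 0"
  proof (rule Lim_null_comparison)
    show "(\<lambda>n. l2_norm m g / t * l2_norm m (\<lambda>x. ?u n x - ?U x)) \<longlonglongrightarrow> 0"
      using tendsto_mult_left[OF heat_X_l2_tendsto[OF t0], of "l2_norm m g / t"] by simp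
    show "\<forall>\<^sub>F n in sequentially. norm (l2_inner m (?v n) (\<lambda>x. ?u n x - ?U x))
        \<le> l2_norm m g / t * l2_norm m (\<lambda>x. ?u n x - ?U x)"
    proof (intro always_eventually allI)
      fix n
      have "norm (l2_inner m (?v n) (\<lambda>x. ?u n x - ?U x)) \<le> l2_norm m (?v n) * l2_norm m (\<lambda>x. ?u n x - ?U x)"
        unfolding real_norm_def using LK_heat_X_l2[OF t, of n] by (intro M.l2_cauchy_schwarz M.in_l2_diff heat_X_in_l2 Ul2) auto
      also have "\<dots> \<le> l2_norm m g / t * l2_norm m (\<lambda>x. ?u n x - ?U x)"
        using LK_heat_X_l2[OF t, of n] by (intro mult_right_mono) auto
      finally show "norm (l2_inner m (?v n) (\<lambda>x. ?u n x - ?U x)) \<le> l2_norm m g / t * l2_norm m (\<lambda>x. ?u n x - ?U x)" .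
    qed
  qed
  ultimately have "(\<lambda>n. l2_inner m (?v n) ?U + l2_inner m (?v n) (\<lambda>x. ?u n x - ?U x)) \<longlonglongrightarrow> l2_inner m (Ltilde b c m ?U) ?U + 0"
    by (rule tendsto_add)
  moreover have "l2_inner m (?v n) ?U + l2_inner m (?v n) (\<lambda>x. ?u n x - ?U x) = gen_form b c (?u n) (?u n)" for n
  proof -
    have "l2_inner m (?v n) ?U + l2_inner m (?v n) (\<lambda>x. ?u n x - ?U x) = l2_inner m (?v n) (?u n)"
      using M.l2_inner_diff_right[OF heat_X_in_l2 Ul2, of "?v n" n] LK_heat_X_l2[OF t, of n] by simp
    also have "\<dots> = (\<Sum>x\<in>X n. m x * LK (X n) (?u n) x * ?u n x)"
      by (rule l2_inner_finite_support) (auto simp: heat_off)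
    also have "\<dots> = gen_form b c (?u n) (?u n)"
      by (rule LK_form_nonneg(1)) (auto simp: heat_off)
    finally show ?thesis .
  qed
  ultimately show ?thesis by simp
qed

lemma heat_X_energy_finite: "energy_finite b c (heat (X n) g t)"
  by (rule finite_support_energy[of "X n"]) (auto simp: heat_off)

lemma heatlim_energy:
  assumes t: "0 < t"
  shows "energy_finite b c (heatlim g t)"
    and "gen_form b c (heatlim g t) (heatlim g t) \<le> l2_inner m (Ltilde b c m (heatlim g t)) (heatlim g t)"
  using gen_form_fatou[OF heatlim_tendsto heat_X_energy_finite heat_X_energy_tendsto[OF t]] t by auto

text \<open>Convergence in the form norm: Q(u - U) = Q(u) - 2 (u, LU) + Q(U), where Q(u) and (u, LU) both tend
  to (LU, U), and Q(U) is at most (LU, U) by Fatou's lemma.\<close>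

lemma heatlim_form_domain:
  assumes t: "0 < t"
  shows "form_domain b c m (heatlim g t)"
proof -
  have t0: "0 \<le> t" using t by simp
  let ?u = "\<lambda>n. heat (X n) g t" and ?U = "heatlim g t"
  let ?V = "Ltilde b c m ?U"
  have fs: "fin_supp (?u n)" for n
    unfolding fin_supp_def by (rule finite_subset[of _ "X n"]) (auto intro: ccontr simp: heat_off)
  have weak: "(\<lambda>n. l2_inner m (?u n) ?V) \<longlonglongrightarrow> l2_inner m ?U ?V"
    by (rule M.l2_inner_tendsto_weak[where B = "l2_norm m g", OF _ heatlim_tendsto[OF t0] Ltilde_heatlim_in_l2[OF t]])
       (use heat_X_in_l2 heat_l2_le[OF finite_X g_in_l2 t0] in auto)
  have "(\<lambda>n. gen_form b c (\<lambda>x. ?u n x - ?U x) (\<lambda>x. ?u n x - ?U x)) \<longlonglongrightarrow> 0"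
  proof (rule Lim_null_comparison)
    let ?a = "\<lambda>n. gen_form b c (?u n) (?u n) - 2 * l2_inner m (?u n) ?V + l2_inner m ?V ?U"
    have "?a \<longlonglongrightarrow> l2_inner m ?V ?U - 2 * l2_inner m ?U ?V + l2_inner m ?V ?U"
      by (intro tendsto_intros heat_X_energy_tendsto[OF t] weak)
    then show "?a \<longlonglongrightarrow> 0" by (simp add: M.l2_inner_commute[of ?U])
    show "\<forall>\<^sub>F n in sequentially. norm (gen_form b c (\<lambda>x. ?u n x - ?U x) (\<lambda>x. ?u n x - ?U x)) \<le> ?a n"
    proof (intro always_eventually allI)
      fix n
      have "gen_form b c ?U (?u n) = (\<Sum>x\<in>X n. m x * ?V x * ?u n x)"
        by (rule green[OF bounded_heatlim[OF t0]]) (auto simp: heat_off)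
      also have "\<dots> = l2_inner m ?V (?u n)"
        by (rule l2_inner_finite_support[symmetric]) (auto simp: heat_off)
      finally have *: "gen_form b c ?U (?u n) = l2_inner m (?u n) ?V" by (simp add: M.l2_inner_commute)
      have "gen_form b c (\<lambda>x. ?u n x - ?U x) (\<lambda>x. ?u n x - ?U x)
          = gen_form b c (?u n) (?u n) - 2 * gen_form b c ?U (?u n) + gen_form b c ?U ?U"
        using heat_X_energy_finite heatlim_energy(1)[OF t]
        by (simp add: gen_form_diff_left gen_form_diff_right energy_finite_diff gen_form_commute[of "?u n" ?U])
      then show "norm (gen_form b c (\<lambda>x. ?u n x - ?U x) (\<lambda>x. ?u n x - ?U x)) \<le> ?a n"
        using gen_form_self_nonneg[of "\<lambda>x. ?u n x - ?U x"] heatlim_energy(2)[OF t] * by simp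
    qed
  qed
  then show ?thesis
    unfolding form_domain_def
    by (intro conjI exI[of _ ?u] allI heatlim_l2(1)[OF t0] heatlim_energy(1)[OF t] heat_X_l2_tendsto[OF t0] fs)
qed

section \<open>The limit flow as a strong orbit in l2\<close>

lemma heatlim_L_rep:
  assumes t: "0 < t"
  shows "L_rep b c m (heatlim g t) (Ltilde b c m (heatlim g t))"
proof (rule L_repI[OF heatlim_energy(1)[OF t] Ltilde_heatlim_in_l2[OF t]])
  fix \<phi> :: "'v \<Rightarrow> real" assume "fin_supp \<phi>"
  then have F: "finite {x. \<phi> x \<noteq> 0}" by (simp add: fin_supp_def)
  have "bounded (range (heatlim g t))" using bounded_heatlim[of t] t by simp
  have "gen_form b c (heatlim g t) \<phi> = (\<Sum>x | \<phi> x \<noteq> 0. m x * Ltilde b c m (heatlim g t) x * \<phi> x)"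
    by (rule green[OF \<open>bounded (range (heatlim g t))\<close> F fin_supp_off])
  also have "\<dots> = l2_inner m (Ltilde b c m (heatlim g t)) \<phi>"
    by (rule l2_inner_finite_support[OF F fin_supp_off, symmetric])
  finally show "gen_form b c (heatlim g t) \<phi> = l2_inner m (Ltilde b c m (heatlim g t)) \<phi>"
    .
qed

text \<open>The Taylor estimate of the finite flows, divided by h, does not depend on n and so
  passes to the pointwise limit by Fatou's lemma.\<close>

lemma heatlim_difference_quotient:
  assumes t: "0 < t" and h: "\<bar>h\<bar> \<le> t / 2" "h \<noteq> 0"
  shows "l2_norm m (\<lambda>x. (heatlim g (t + h) x - heatlim g t x) / h + Ltilde b c m (heatlim g t) x)
      \<le> \<bar>h\<bar> * (l2_norm m g / (t / 4) ^ 2)"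
proof (rule M.l2_norm_fatou(2))
  have th: "0 \<le> t + h" "0 \<le> t" using h t by auto
  let ?f = "\<lambda>n x. (heat (X n) g (t + h) x - heat (X n) g t x) / h + LK (X n) (heat (X n) g t) x"
  show "(\<lambda>n. ?f n x) \<longlonglongrightarrow> (heatlim g (t + h) x - heatlim g t x) / h + Ltilde b c m (heatlim g t) x" for x
    using h by (intro tendsto_intros heatlim_tendsto th LK_heat_X_tendsto)
  show "\<forall>\<^sub>F n in sequentially. in_l2 m (?f n) \<and> l2_norm m (?f n) \<le> \<bar>h\<bar> * (l2_norm m g / (t / 4) ^ 2)"
  proof (intro always_eventually allI conjI)
    fix n
    show "in_l2 m (?f n)" by (rule finite_support_in_l2[of "X n"]) (auto simp: heat_off LK_off)
    have eq: "?f n = (\<lambda>x. (1/h) * (heat (X n) g (t + h) x - heat (X n) g t x + h * LK (X n) (heat (X n) g t) x))"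
      using h by (auto simp: field_simps)
    have "l2_norm m (?f n) \<le> \<bar>1/h\<bar> * (h\<^sup>2 * (l2_norm m g / (t / 4) ^ 2))"
      unfolding eq M.l2_norm_scale using heat_taylor[OF finite_X g_in_l2 t h(1), of n] by (intro mult_left_mono) auto
    also have "\<dots> = \<bar>h\<bar> * (l2_norm m g / (t / 4) ^ 2)"
      using h by (simp add: power2_eq_square abs_mult_self_eq[symmetric, of h] del: abs_mult_self_eq)
    finally show "l2_norm m (?f n) \<le> \<bar>h\<bar> * (l2_norm m g / (t / 4) ^ 2)" .
  qed
qed

lemma heatlim_0: "heatlim g 0 = g"
proof
  fix x
  have "(\<lambda>n. heat (X n) g 0 x) \<longlonglongrightarrow> g x"
    by (rule tendsto_eventually, rule eventually_mono[OF eventually_in_X[of x]]) (simp add: heat_0 trunc_def)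
  then show "heatlim g 0 x = g x" using heatlim_tendsto[of 0 x] LIMSEQ_unique by blast
qed

lemma heatlim_lipschitz:
  assumes "0 \<le> s" "0 \<le> t"
  shows "\<bar>heatlim g t x - heatlim g s x\<bar> \<le> 2 * deg x * B / m x * \<bar>t - s\<bar>"
  by (rule LIMSEQ_le_const2[OF tendsto_rabs[OF tendsto_diff[OF heatlim_tendsto heatlim_tendsto]]])
     (use assms heat_lipschitz[OF finite_X g0 gB] in auto)

text \<open>The flow contracts the norm, so the squared distance from g is at most 2 (g - U s, g).
  As g has finite support this is a finite sum, for which pointwise continuity at 0 is
  enough.\<close>

lemma heatlim_l2_continuous_0: "((\<lambda>s. l2_norm m (\<lambda>x. heatlim g s x - g x)) \<longlongrightarrow> 0) (at 0 within {0..})"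
proof -
  let ?F = "{x. g x \<noteq> 0}"
  have lim: "((\<lambda>s. heatlim g s x) \<longlongrightarrow> g x) (at 0 within {0..})" for x
  proof (rule LIM_zero_cancel, rule Lim_null_comparison)
    show "\<forall>\<^sub>F s in at 0 within {0..}. norm (heatlim g s x - g x) \<le> 2 * deg x * B / m x * \<bar>s\<bar>"
      using heatlim_lipschitz[of 0 _ x] by (auto simp: eventually_at_filter heatlim_0)
    have "((\<lambda>s. 2 * deg x * B / m x * \<bar>s\<bar>) \<longlongrightarrow> 2 * deg x * B / m x * \<bar>0\<bar>) (at 0 within {0..})"
      by (intro tendsto_intros) auto
    then show "((\<lambda>s. 2 * deg x * B / m x * \<bar>s\<bar>) \<longlongrightarrow> 0) (at 0 within {0..})" by simp
  qed
  have "((\<lambda>s. 2 * (\<Sum>x\<in>?F. m x * (g x - heatlim g s x) * g x)) \<longlongrightarrow> 2 * (\<Sum>x\<in>?F. m x * (g x - g x) * g x)) (at 0 within {0..})"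
    by (intro tendsto_intros lim)
  then have sq: "((\<lambda>s. sqrt (2 * (\<Sum>x\<in>?F. m x * (g x - heatlim g s x) * g x))) \<longlongrightarrow> 0) (at 0 within {0..})"
    using tendsto_real_sqrt by fastforce
  show ?thesis
  proof (rule Lim_null_comparison[OF _ sq])
    show "\<forall>\<^sub>F s in at 0 within {0..}. norm (l2_norm m (\<lambda>x. heatlim g s x - g x))
        \<le> sqrt (2 * (\<Sum>x\<in>?F. m x * (g x - heatlim g s x) * g x))"
      unfolding eventually_at_filter
    proof (intro always_eventually allI impI)
      fix s :: real assume "s \<in> {0..}"
      then have s: "0 \<le> s" by simp
      have "(l2_norm m (\<lambda>x. heatlim g s x - g x))\<^sup>2
          = (l2_norm m (heatlim g s))\<^sup>2 - 2 * l2_inner m (heatlim g s) g + (l2_norm m g)\<^sup>2"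
        by (rule M.l2_norm_diff_sq[OF heatlim_l2(1)[OF s] g_in_l2])
      also have "\<dots> \<le> 2 * (l2_inner m g g - l2_inner m (heatlim g s) g)"
        using power_mono[OF heatlim_l2(2)[OF s], of 2] by (simp add: M.l2_inner_self)
      also have "\<dots> = 2 * (\<Sum>x\<in>?F. m x * (g x - heatlim g s x) * g x)"
      proof -
        have "l2_inner m u g = (\<Sum>x\<in>?F. m x * u x * g x)" for u
          by (rule l2_inner_finite_support[OF finite_support_g fin_supp_off])
        then show ?thesis by (simp add: sum_subtractf algebra_simps)
      qed
      finally show "norm (l2_norm m (\<lambda>x. heatlim g s x - g x))
        \<le> sqrt (2 * (\<Sum>x\<in>?F. m x * (g x - heatlim g s x) * g x))"
        by (simp add: real_le_rsqrt)
    qed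
  qed
qed

lemma heatlim_quotient_tendsto:
  assumes t: "0 < t"
  shows "((\<lambda>h. l2_norm m (\<lambda>x. (heatlim g (t + h) x - heatlim g t x) / h + Ltilde b c m (heatlim g t) x)) \<longlongrightarrow> 0) (at 0)"
proof (rule Lim_null_comparison)
  have "((\<lambda>h. \<bar>h\<bar> * (l2_norm m g / (t / 4) ^ 2)) \<longlongrightarrow> \<bar>0\<bar> * (l2_norm m g / (t / 4) ^ 2)) (at (0::real))"
    by (intro tendsto_intros)
  then show "((\<lambda>h. \<bar>h\<bar> * (l2_norm m g / (t / 4) ^ 2)) \<longlongrightarrow> 0) (at (0::real))" by simp
  show "\<forall>\<^sub>F h in at 0. norm (l2_norm m (\<lambda>x. (heatlim g (t + h) x - heatlim g t x) / h + Ltilde b c m (heatlim g t) x))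
     \<le> \<bar>h\<bar> * (l2_norm m g / (t / 4) ^ 2)"
    unfolding eventually_at using t heatlim_difference_quotient[OF t]
    by (intro exI[of _ "t / 2"]) (auto simp: dist_real_def)
qed

lemma heatlim_l2_continuous:
  assumes t: "0 < t"
  shows "((\<lambda>s. l2_norm m (\<lambda>x. heatlim g s x - heatlim g t x)) \<longlongrightarrow> 0) (at t)"
proof -
  let ?V = "Ltilde b c m (heatlim g t)"
  let ?q = "\<lambda>h x. (heatlim g (t + h) x - heatlim g t x) / h + ?V x"
  have "((\<lambda>h. l2_norm m (\<lambda>x. heatlim g (t + h) x - heatlim g t x)) \<longlongrightarrow> 0) (at 0)"
  proof (rule Lim_null_comparison)
    have "((\<lambda>h. \<bar>h\<bar> * (l2_norm m (?q h) + l2_norm m ?V)) \<longlongrightarrow> \<bar>0\<bar> * (0 + l2_norm m ?V)) (at 0)"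
      by (intro tendsto_intros heatlim_quotient_tendsto t)
    then show "((\<lambda>h. \<bar>h\<bar> * (l2_norm m (?q h) + l2_norm m ?V)) \<longlongrightarrow> 0) (at 0)" by simp
    have "norm (l2_norm m (\<lambda>x. heatlim g (t + h) x - heatlim g t x)) \<le> \<bar>h\<bar> * (l2_norm m (?q h) + l2_norm m ?V)"
      if h: "h \<noteq> 0" "\<bar>h\<bar> < t" for h
    proof -
      have th: "0 \<le> t + h" "0 \<le> t" using h t by auto
      have "in_l2 m (\<lambda>x. (1/h) * (heatlim g (t + h) x - heatlim g t x))"
        by (intro M.in_l2_scale M.in_l2_diff heatlim_l2 th)
      then have q: "in_l2 m (?q h)" by (intro M.in_l2_add Ltilde_heatlim_in_l2 t) simp
      have eq: "(\<lambda>x. heatlim g (t + h) x - heatlim g t x) = (\<lambda>x. h * (?q h x + -1 * ?V x))"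
        using h by auto
      have "l2_norm m (\<lambda>x. ?q h x + -1 * ?V x) \<le> l2_norm m (?q h) + l2_norm m (\<lambda>x. -1 * ?V x)"
        by (intro M.l2_norm_triangle q M.in_l2_scale Ltilde_heatlim_in_l2 t)
      then have le: "l2_norm m (\<lambda>x. ?q h x + -1 * ?V x) \<le> l2_norm m (?q h) + l2_norm m ?V"
        unfolding M.l2_norm_scale by simp
      have "l2_norm m (\<lambda>x. heatlim g (t + h) x - heatlim g t x) = \<bar>h\<bar> * l2_norm m (\<lambda>x. ?q h x + -1 * ?V x)"
        by (subst eq, rule M.l2_norm_scale)
      then show ?thesis
        unfolding real_norm_def abs_of_nonneg[OF M.l2_norm_nonneg] using mult_left_mono[OF le abs_ge_zero[of h]] by linarith
    qed
    then show "\<forall>\<^sub>F h in at 0. norm (l2_norm m (\<lambda>x. heatlim g (t + h) x - heatlim g t x))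
        \<le> \<bar>h\<bar> * (l2_norm m (?q h) + l2_norm m ?V)"
      unfolding eventually_at using t by (intro exI[of _ t]) (auto simp: dist_real_def)
  qed
  then show ?thesis by (subst LIM_offset_zero_iff) auto
qed

lemma sg_orbit_heatlim: "sg_orbit b c m g (heatlim g)"
  unfolding sg_orbit_def
proof (intro conjI allI impI heatlim_0 heatlim_l2(1))
  fix t :: real assume "0 \<le> t"
  then show "((\<lambda>s. l2_norm m (\<lambda>x. heatlim g s x - heatlim g t x)) \<longlongrightarrow> 0) (at t within {0..})"
    using heatlim_l2_continuous_0 heatlim_l2_continuous[of t] by (cases "t = 0") (auto simp: heatlim_0 intro: tendsto_within_subset)
next
  fix t :: real assume t: "0 < t"
  show "L_dom b c m (heatlim g t)" using heatlim_form_domain[OF t] heatlim_L_rep[OF t] by (auto simp: L_dom_def)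
  show "((\<lambda>h. l2_norm m (\<lambda>x. (heatlim g (t + h) x - heatlim g t x) / h + L_op b c m (heatlim g t) x)) \<longlongrightarrow> 0) (at 0)"
    using heatlim_quotient_tendsto[OF t] by (simp add: L_op_eq[OF heatlim_L_rep[OF t]])
qed

lemma sg_eq_heatlim: "0 \<le> t \<Longrightarrow> sg b c m t g = heatlim g t"
  unfolding sg_def using sg_orbit_heatlim sg_orbit_unique by blast

end

end

section \<open>Exponentially weighted time averages\<close>

lemma borel_measurable_continuous_on_atLeast:
  fixes f :: "real \<Rightarrow> real"
  shows "continuous_on {0..} f \<Longrightarrow> (\<lambda>t. indicator {0..} t *\<^sub>R f t) \<in> borel_measurable lborel"
  using borel_measurable_continuous_on_indicator[of "{0..}" f] by simp

context
  fixes \<alpha> :: real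
  assumes \<alpha>: "0 < \<alpha>"
begin

lemma exp_weight_nn_integral:
  "(\<integral>\<^sup>+t. ennreal (\<alpha> * exp (- (t * \<alpha>))) * indicator {0..} t \<partial>lborel) = 1"
proof -
  have "((\<lambda>t. - exp (- (t * \<alpha>))) \<longlongrightarrow> - 0) at_top"
    using \<alpha> by (intro tendsto_minus filterlim_compose[OF exp_at_bot]
        filterlim_compose[OF filterlim_uminus_at_bot_at_top] filterlim_at_top_mult_tendsto_pos[OF tendsto_const _ filterlim_ident])
  then have "(\<integral>\<^sup>+t. ennreal (\<alpha> * exp (- (t * \<alpha>))) * indicator {0..} t \<partial>lborel) = ennreal (- 0 - (- exp (- (0 * \<alpha>))))"
    using \<alpha> by (intro nn_integral_FTC_atLeast[where F = "\<lambda>t. - exp (- (t * \<alpha>))"])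
      (auto intro!: derivative_eq_intros)
  then show ?thesis by simp
qed

lemma exp_weight_integrable: "set_integrable lborel {0..} (\<lambda>t. \<alpha> * exp (- (t * \<alpha>)))"
  and exp_weight_integral: "(LBINT t:{0..}. \<alpha> * exp (- (t * \<alpha>))) = 1"
proof -
  have "(\<integral>\<^sup>+t. ennreal (indicator {0..} t *\<^sub>R (\<alpha> * exp (- (t * \<alpha>)))) \<partial>lborel) = ennreal 1"
    unfolding ennreal_1 exp_weight_nn_integral[symmetric]
    by (intro nn_integral_cong) (auto simp: indicator_def)
  then have "has_bochner_integral lborel (\<lambda>t. indicator {0..} t *\<^sub>R (\<alpha> * exp (- (t * \<alpha>)))) 1"
    using \<alpha> by (intro has_bochner_integral_nn_integral) auto
  then show "set_integrable lborel {0..} (\<lambda>t. \<alpha> * exp (- (t * \<alpha>)))"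
    and "(LBINT t:{0..}. \<alpha> * exp (- (t * \<alpha>))) = 1"
    unfolding set_integrable_def set_lebesgue_integral_def by (auto simp: has_bochner_integral_iff)
qed

lemma exp_weight_mult_integrable:
  assumes \<phi>: "continuous_on {0..} \<phi>" and bd: "\<And>t. 0 \<le> t \<Longrightarrow> \<bar>\<phi> t\<bar> \<le> C"
  shows "set_integrable lborel {0..} (\<lambda>t. \<alpha> * exp (- (t * \<alpha>)) * \<phi> t)"
proof (rule set_integrable_bound)
  show "set_integrable lborel {0..} (\<lambda>t. (\<alpha> * exp (- (t * \<alpha>))) * C)"
    using exp_weight_integrable by (rule set_integrable_mult_left)
  show "set_borel_measurable lborel {0..} (\<lambda>t. \<alpha> * exp (- (t * \<alpha>)) * \<phi> t)"
    unfolding set_borel_measurable_def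
    by (intro borel_measurable_continuous_on_atLeast continuous_intros \<phi>)
  show "AE t in lborel. t \<in> {0..} \<longrightarrow> norm (\<alpha> * exp (- (t * \<alpha>)) * \<phi> t) \<le> norm (\<alpha> * exp (- (t * \<alpha>)) * C)"
  proof (intro AE_I2 impI)
    fix t :: real assume "t \<in> {0..}"
    then have "\<bar>\<phi> t\<bar> \<le> \<bar>C\<bar>" using bd[of t] by simp
    then show "norm (\<alpha> * exp (- (t * \<alpha>)) * \<phi> t) \<le> norm (\<alpha> * exp (- (t * \<alpha>)) * C)"
      by (simp add: abs_mult mult_left_mono)
  qed
qed

lemma exp_weight_tendsto:
  assumes cont: "\<And>n. continuous_on {0..} (\<phi> n)" "continuous_on {0..} \<psi>"
    and bd: "\<And>n t. 0 \<le> t \<Longrightarrow> \<bar>\<phi> n t\<bar> \<le> C" and lim: "\<And>t. 0 \<le> t \<Longrightarrow> (\<lambda>n. \<phi> n t) \<longlonglongrightarrow> \<psi> t"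
  shows "(\<lambda>n. LBINT t:{0..}. \<alpha> * exp (- (t * \<alpha>)) * \<phi> n t) \<longlonglongrightarrow> (LBINT t:{0..}. \<alpha> * exp (- (t * \<alpha>)) * \<psi> t)"
  unfolding set_lebesgue_integral_def
proof (rule integral_dominated_convergence)
  have "set_integrable lborel {0..} (\<lambda>t. (\<alpha> * exp (- (t * \<alpha>))) * C)"
    using exp_weight_integrable by (rule set_integrable_mult_left)
  then show "integrable lborel (\<lambda>t. indicator {0..} t *\<^sub>R ((\<alpha> * exp (- (t * \<alpha>))) * C))"
    by (simp add: set_integrable_def)
  show "(\<lambda>t. indicator {0..} t *\<^sub>R (\<alpha> * exp (- (t * \<alpha>)) * \<psi> t)) \<in> borel_measurable lborel"
    "(\<lambda>t. indicator {0..} t *\<^sub>R (\<alpha> * exp (- (t * \<alpha>)) * \<phi> n t)) \<in> borel_measurable lborel" for n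
    by (intro borel_measurable_continuous_on_atLeast continuous_intros cont)+
  show "AE t in lborel. (\<lambda>n. indicator {0..} t *\<^sub>R (\<alpha> * exp (- (t * \<alpha>)) * \<phi> n t))
      \<longlonglongrightarrow> indicator {0..} t *\<^sub>R (\<alpha> * exp (- (t * \<alpha>)) * \<psi> t)"
    by (intro AE_I2) (auto simp: indicator_def intro!: tendsto_intros lim)
  show "AE t in lborel. norm (indicator {0..} t *\<^sub>R (\<alpha> * exp (- (t * \<alpha>)) * \<phi> n t))
      \<le> indicator {0..} t *\<^sub>R ((\<alpha> * exp (- (t * \<alpha>))) * C)" for n
    using \<alpha> bd by (intro AE_I2) (auto simp: indicator_def abs_mult)
qed

text \<open>Integration by parts, as the fundamental theorem for the product of weight and \<phi> on
  the open half line. Boundedness of \<phi> kills the boundary term at infinity, and continuity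
  supplies the one at 0, where no derivative is assumed.\<close>

lemma exp_weight_deriv:
  assumes \<phi>: "continuous_on {0..} \<phi>" "\<And>t. 0 \<le> t \<Longrightarrow> \<bar>\<phi> t\<bar> \<le> C"
    and \<phi>': "continuous_on {0..} \<phi>'" "\<And>t. 0 \<le> t \<Longrightarrow> \<bar>\<phi>' t\<bar> \<le> D"
    and deriv: "\<And>t. 0 < t \<Longrightarrow> (\<phi> has_real_derivative \<phi>' t) (at t)"
  shows "(LBINT t:{0..}. \<alpha> * exp (- (t * \<alpha>)) * \<phi>' t)
    = \<alpha> * (LBINT t:{0..}. \<alpha> * exp (- (t * \<alpha>)) * \<phi> t) - \<alpha> * \<phi> 0"
proof -
  define F where "F t = \<alpha> * exp (- (t * \<alpha>)) * \<phi> t" for t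
  define f where "f t = \<alpha> * exp (- (t * \<alpha>)) * \<phi>' t - \<alpha> * (\<alpha> * exp (- (t * \<alpha>)) * \<phi> t)" for t
  note I = exp_weight_mult_integrable[OF \<phi>] exp_weight_mult_integrable[OF \<phi>']
  have fint: "set_integrable lborel {0..} f"
    unfolding f_def using I by (intro set_integral_diff set_integrable_mult_right) auto
  have fcont: "continuous_on {0..} f" unfolding f_def by (intro continuous_intros \<phi> \<phi>')
  have "(LBINT t=0..\<infinity>. f t) = 0 - \<alpha> * \<phi> 0"
  proof (rule interval_integral_FTC_integrable)
    show "(0::ereal) < \<infinity>" by simp
    fix x :: real assume "0 < ereal x" "ereal x < \<infinity>"
    then have x: "0 < x" by simp
    show "(F has_vector_derivative f x) (at x)"
      unfolding F_def f_def has_real_derivative_iff_has_vector_derivative[symmetric]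
      using deriv[OF x] by (auto intro!: derivative_eq_intros)
    show "isCont f x" using fcont x by (simp add: continuous_on_interior)
  next
    show "set_integrable lborel (einterval 0 \<infinity>) f"
      by (rule set_integrable_subset[OF fint]) (auto simp: einterval_def)
    have "continuous_on {0..} F" unfolding F_def by (intro continuous_intros \<phi>)
    then have "(F \<longlongrightarrow> F 0) (at 0 within {0..})" by (simp add: continuous_on_def)
    then have "(F \<longlongrightarrow> F 0) (at_right 0)" by (rule tendsto_within_subset) auto
    then show "((F \<circ> real_of_ereal) \<longlongrightarrow> \<alpha> * \<phi> 0) (at_right 0)"
      by (simp add: zero_ereal_def ereal_tendsto_simps1 F_def)
    have "(F \<longlongrightarrow> 0) at_top"
    proof (rule Lim_null_comparison)
      show "\<forall>\<^sub>F t in at_top. norm (F t) \<le> \<alpha> * exp (- (t * \<alpha>)) * C"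
        using eventually_ge_at_top[of 0] by eventually_elim
          (use \<alpha> \<phi>(2) in \<open>auto simp: F_def abs_mult intro!: mult_left_mono\<close>)
      have "((\<lambda>t. exp (- (t * \<alpha>))) \<longlongrightarrow> 0) at_top"
        using \<alpha> by (intro filterlim_compose[OF exp_at_bot]
          filterlim_compose[OF filterlim_uminus_at_bot_at_top] filterlim_at_top_mult_tendsto_pos[OF tendsto_const _ filterlim_ident])
      from tendsto_mult_left_zero[OF tendsto_mult_right_zero[OF this, of \<alpha>], of C]
      show "((\<lambda>t. \<alpha> * exp (- (t * \<alpha>)) * C) \<longlongrightarrow> 0) at_top" .
    qed
    then show "((F \<circ> real_of_ereal) \<longlongrightarrow> 0) (at_left \<infinity>)"
      by (simp add: ereal_tendsto_simps1)
  qed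
  moreover have "(LBINT t=0..\<infinity>. f t) = (LBINT t:{0..}. f t)"
    unfolding interval_lebesgue_integral_0_infty
  proof (rule set_integral_cong_set)
    show "set_borel_measurable lborel {0..} f"
      using fint unfolding set_integrable_def set_borel_measurable_def by (rule borel_measurable_integrable)
    have "set_integrable lborel {0<..} f" by (rule set_integrable_subset[OF fint]) auto
    then show "set_borel_measurable lborel {0<..} f"
      unfolding set_integrable_def set_borel_measurable_def by (rule borel_measurable_integrable)
    show "AE x in lborel. ((x::real) \<in> {0..}) = (x \<in> {0<..})"
      using AE_lborel_singleton[of "0::real"] by eventually_elim auto
  qed
  moreover have "(LBINT t:{0..}. f t) = (LBINT t:{0..}. \<alpha> * exp (- (t * \<alpha>)) * \<phi>' t)
      - \<alpha> * (LBINT t:{0..}. \<alpha> * exp (- (t * \<alpha>)) * \<phi> t)"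
    unfolding f_def using I by (subst set_integral_diff) (auto intro: set_integrable_mult_right)
  ultimately show ?thesis by simp
qed

lemma exp_weight_mono:
  assumes "continuous_on {0..} \<phi>" "\<And>t. 0 \<le> t \<Longrightarrow> \<bar>\<phi> t\<bar> \<le> C"
    and "continuous_on {0..} \<psi>" "\<And>t. 0 \<le> t \<Longrightarrow> \<bar>\<psi> t\<bar> \<le> C"
    and "\<And>t. 0 \<le> t \<Longrightarrow> \<phi> t \<le> \<psi> t"
  shows "(LBINT t:{0..}. \<alpha> * exp (- (t * \<alpha>)) * \<phi> t) \<le> (LBINT t:{0..}. \<alpha> * exp (- (t * \<alpha>)) * \<psi> t)"
  using assms \<alpha> by (intro set_integral_mono exp_weight_mult_integrable) auto

lemma exp_weight_eq_0D:
  assumes \<phi>: "continuous_on {0..} \<phi>" "\<And>t. 0 \<le> t \<Longrightarrow> 0 \<le> \<phi> t" "\<And>t. 0 \<le> t \<Longrightarrow> \<phi> t \<le> C"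
    and 0: "(LBINT t:{0..}. \<alpha> * exp (- (t * \<alpha>)) * \<phi> t) = 0" and t: "0 \<le> t"
  shows "\<phi> t = 0"
proof -
  let ?f = "\<lambda>t. \<alpha> * exp (- (t * \<alpha>)) * \<phi> t"
  have int: "set_integrable lborel {0..} ?f"
    by (rule exp_weight_mult_integrable[OF \<phi>(1), of C]) (use \<phi> in auto)
  \<comment> \<open>A compact interval is needed to conclude that a continuous nonnegative integrand
    vanishes; t + 1 keeps it nondegenerate when t = 0.\<close>
  have int': "set_integrable lborel {0..t + 1} ?f" by (rule set_integrable_subset[OF int]) auto
  have nn: "0 \<le> s \<Longrightarrow> 0 \<le> ?f s" for s using \<alpha> \<phi>(2) by simp
  have "(LBINT s:{0..t + 1}. ?f s) \<le> (LBINT s:{0..}. ?f s)"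
    unfolding set_lebesgue_integral_def
    using int int' nn by (intro integral_mono) (auto simp: set_integrable_def indicator_def)
  moreover have "0 \<le> (LBINT s:{0..t + 1}. ?f s)"
    using nn unfolding set_lebesgue_integral_def by (intro integral_nonneg_AE AE_I2) (auto simp: indicator_def)
  ultimately have "(LBINT s:{0..t + 1}. ?f s) = 0" using 0 by simp
  then have "integral {0..t + 1} ?f = 0" using set_borel_integral_eq_integral(2)[OF int'] by simp
  moreover have "continuous_on {0..t + 1} ?f" by (intro continuous_intros continuous_on_subset[OF \<phi>(1)]) auto
  ultimately have "\<forall>s\<in>{0..t + 1}. ?f s = 0"
    using t nn by (subst integral_eq_0_iff[symmetric]) auto
  then show ?thesis using t \<alpha> by auto
qed

end

section \<open>The function 1 - M\<close>

context graph_measure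
begin

text \<open>The oriented integral is differentiable at every real t, so the derivative at 0 is
  two-sided as well.\<close>

definition heatint :: "'v set \<Rightarrow> ('v \<Rightarrow> real) \<Rightarrow> real \<Rightarrow> 'v \<Rightarrow> real" where
  "heatint K f t x = (LBINT s=0..t. heat K f s x)"

lemma heatint_0 [simp]: "heatint K f 0 x = 0"
  by (simp add: heatint_def zero_ereal_def)

lemma heatint_off: "x \<notin> K \<Longrightarrow> heatint K f t x = 0"
  by (simp add: heatint_def heat_off)

lemma heatint_deriv:
  assumes K: "finite K"
  shows "((\<lambda>t. heatint K f t x) has_real_derivative heat K f t x) (at t)"
proof -
  \<comment> \<open>This interval has both the base point 0 and t in its interior, whatever the sign
    of t.\<close>
  have "((\<lambda>u. LBINT s=(0::real)..u. heat K f s x) has_vector_derivative heat K f t x) (at t within {-\<bar>t\<bar> - 1..\<bar>t\<bar> + 1})"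
    by (rule interval_integral_FTC2) (auto intro: heat_continuous_on[OF K])
  moreover have "at t within {-\<bar>t\<bar> - 1..\<bar>t\<bar> + 1} = at t"
    by (rule at_within_Icc_at) auto
  ultimately show ?thesis
    by (simp add: heatint_def zero_ereal_def has_real_derivative_iff_has_vector_derivative)
qed

lemma heatint_nonneg:
  assumes K: "finite K" and f: "\<And>x. 0 \<le> f x" and t: "0 \<le> t"
  shows "0 \<le> heatint K f t x"
proof -
  have "heatint K f 0 x \<le> heatint K f t x"
    by (rule DERIV_nonneg_imp_nondecreasing[OF t]) (rule exI, rule conjI[OF heatint_deriv[OF K]], rule heat_nonneg[OF K f])
  then show ?thesis by simp
qed

lemma LK_add: "LK K (\<lambda>y. f y + g y) x = LK K f x + LK K g x"
  by (simp add: LK_def distrib_left sum.distrib diff_divide_distrib add_divide_distrib)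

text \<open>The heat equation integrated in time: the sum of \<open>LK\<close> of the time integral
  and the flow has derivative 0, and at time 0 it is the truncated initial value.\<close>

lemma LK_heatint:
  assumes K: "finite K"
  shows "LK K (heatint K f t) x = trunc K f x - heat K f t x"
proof (cases "x \<in> K")
  case True
  define D where "D t = LK K (heatint K f t) x + heat K f t x" for t
  have "(D has_real_derivative 0) (at s)" for s
  proof -
    have "((\<lambda>t. (deg x * heatint K f t x - (\<Sum>y\<in>K. b x y * heatint K f t y)) / m x + heat K f t x)
       has_real_derivative (deg x * heat K f s x - (\<Sum>y\<in>K. b x y * heat K f s y)) / m x + - LK K (heat K f s) x) (at s)"
      by (intro DERIV_add DERIV_cdivide DERIV_diff DERIV_cmult DERIV_sum heatint_deriv[OF K] heat_deriv[OF K])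
    then show ?thesis using True by (simp add: D_def[abs_def] LK_def)
  qed
  then have "D t = D 0" by (intro DERIV_isconst_all) blast
  moreover have "LK K (heatint K f 0) x = 0" by (simp add: LK_def)
  ultimately show ?thesis by (simp add: D_def heat_0)
qed (simp add: LK_off trunc_off heat_off)

text \<open>MK and NK are the Dirichlet approximations of M and 1 - M: on K, NK solves the heat equation
  with initial value 0, and off K it has the boundary value 1.\<close>

definition MK :: "'v set \<Rightarrow> real \<Rightarrow> 'v \<Rightarrow> real" where
  "MK K t x = heat K (\<lambda>_. 1) t x + heatint K (\<lambda>y. c y / m y) t x"

definition NK :: "'v set \<Rightarrow> real \<Rightarrow> 'v \<Rightarrow> real" where
  "NK K t x = 1 - MK K t x"

lemma MK_off: "x \<notin> K \<Longrightarrow> MK K t x = 0" and NK_off: "x \<notin> K \<Longrightarrow> NK K t x = 1"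
  by (simp_all add: NK_def MK_def heat_off heatint_off)

lemma NK_0: "x \<in> K \<Longrightarrow> NK K 0 x = 0"
  by (simp add: NK_def MK_def heat_0 trunc_def)

lemma MK_nonneg: "finite K \<Longrightarrow> 0 \<le> t \<Longrightarrow> 0 \<le> MK K t x"
  unfolding MK_def by (intro add_nonneg_nonneg heat_nonneg heatint_nonneg) (auto intro: divide_nonneg_pos)

lemma NK_le_1: "finite K \<Longrightarrow> 0 \<le> t \<Longrightarrow> NK K t x \<le> 1"
  using MK_nonneg by (simp add: NK_def)

lemma bounded_NK:
  assumes "finite K"
  shows "bounded (range (NK K t))"
proof -
  have "bounded (range (MK K t))" by (rule bounded_if_finite_support[OF assms MK_off])
  then show ?thesis unfolding NK_def[abs_def] by (intro bounded_minus_comp) auto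
qed

text \<open>The constant 1 contributes c/m to \<open>Ltilde\<close>, and the time integral in
  \<open>MK\<close> produces the same term on K by the integrated heat equation. The two cancel,
  leaving a homogeneous equation.\<close>

lemma NK_deriv:
  assumes K: "finite K" and x: "x \<in> K"
  shows "((\<lambda>t. NK K t x) has_real_derivative - Ltilde b c m (NK K t) x) (at t)"
proof -
  have "((\<lambda>t. NK K t x) has_real_derivative
      0 - (- LK K (heat K (\<lambda>_. 1) t) x + heat K (\<lambda>y. c y / m y) t x)) (at t)"
    unfolding NK_def MK_def by (intro DERIV_diff DERIV_const DERIV_add heat_deriv heatint_deriv K)
  moreover have "Ltilde b c m (NK K t) x = c x / m x - Ltilde b c m (MK K t) x"
    unfolding NK_def by (subst Ltilde_diff) (auto simp: Ltilde_const intro: bounded_if_finite_support[OF K MK_off])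
  moreover have "Ltilde b c m (MK K t) x = LK K (MK K t) x"
    by (rule LK_eq_Ltilde[symmetric, OF K _ x]) (rule MK_off)
  moreover have "LK K (MK K t) x = LK K (heat K (\<lambda>_. 1) t) x + (c x / m x - heat K (\<lambda>y. c y / m y) t x)"
    unfolding MK_def[abs_def] LK_add LK_heatint[OF K] using x by (simp add: trunc_def)
  ultimately show ?thesis by simp
qed

lemma NK_continuous_on:
  assumes "finite K"
  shows "continuous_on S (\<lambda>t. NK K t x)"
proof (cases "x \<in> K")
  case True
  then show ?thesis using NK_deriv[OF assms] by (meson DERIV_isCont continuous_at_imp_continuous_on)
qed (simp add: NK_off)

text \<open>C times \<open>NK\<close> starts from 0 and has the largest boundary value compatible
  with the bound C. The equation is required of N only on K, so the statement applies to the zero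
  function, to \<open>NK\<close> of a larger set and to solutions on all of V. These give, in turn,
  positivity, monotonicity in K and maximality of the limit.\<close>

lemma bounded_solution_le_NK:
  assumes K: "finite K" and C: "0 \<le> C" and N: "\<And>t x. 0 \<le> t \<Longrightarrow> N t x \<le> C"
    and N0: "\<And>x. x \<in> K \<Longrightarrow> N 0 x \<le> 0"
    and cont: "\<And>x. x \<in> K \<Longrightarrow> continuous_on {0..} (\<lambda>t. N t x)"
    and bd: "\<And>t. 0 < t \<Longrightarrow> bounded (range (N t))"
    and deriv: "\<And>t x. 0 < t \<Longrightarrow> x \<in> K \<Longrightarrow> ((\<lambda>s. N s x) has_real_derivative - Ltilde b c m (N t) x) (at t)"
    and t: "0 \<le> t"
  shows "N t x \<le> C * NK K t x"
proof -
  have "0 \<le> C * NK K t x - N t x"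
  proof (rule parabolic_minimum_principle[OF K _ _ _ _ t])
    fix s :: real and x assume s: "0 < s" "x \<in> K"
    have "Ltilde b c m (\<lambda>x. C * NK K s x - N s x) x = C * Ltilde b c m (NK K s) x - Ltilde b c m (N s) x"
      using bounded_scaleR_comp[OF bounded_NK[OF K, of s], of C]
      by (subst Ltilde_diff) (auto simp: Ltilde_scale bd s)
    moreover have "((\<lambda>s. C * NK K s x - N s x) has_real_derivative
        C * - Ltilde b c m (NK K s) x - - Ltilde b c m (N s) x) (at s)"
      by (intro DERIV_diff DERIV_cmult NK_deriv K deriv s)
    ultimately show "\<exists>D. ((\<lambda>s. C * NK K s x - N s x) has_real_derivative D) (at s) \<and>
        - Ltilde b c m (\<lambda>x. C * NK K s x - N s x) x \<le> D" by (intro exI) auto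
  qed (use N N0 in \<open>auto simp: NK_off NK_0 intro!: continuous_intros NK_continuous_on K cont\<close>)
  then show ?thesis by simp
qed

lemma NK_nonneg:
  assumes "finite K" "0 \<le> t"
  shows "0 \<le> NK K t x"
  using bounded_solution_le_NK[of K 1 "\<lambda>_ _. 0" t x] assms Ltilde_const[of 0] by auto

lemma NK_antimono:
  assumes "finite K'" "K \<subseteq> K'" "0 \<le> t"
  shows "NK K' t x \<le> NK K t x"
  using bounded_solution_le_NK[of K 1 "NK K'" t x] assms finite_subset[OF assms(2,1)]
  by (auto simp: NK_le_1 NK_0 subset_iff NK_continuous_on bounded_NK NK_deriv)

end

context exhausted_graph
begin

section \<open>The decreasing limit and its heat equation\<close>

definition Nlim :: "real \<Rightarrow> 'v \<Rightarrow> real" where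
  "Nlim t x = lim (\<lambda>n. NK (X n) t x)"

lemma NK_X_bounds: "0 \<le> t \<Longrightarrow> 0 \<le> NK (X n) t x" "0 \<le> t \<Longrightarrow> NK (X n) t x \<le> 1"
  "0 \<le> t \<Longrightarrow> \<bar>NK (X n) t x\<bar> \<le> 1"
  using NK_nonneg[OF finite_X] NK_le_1[OF finite_X] by (auto simp: abs_le_iff intro: order_trans[of "- 1" 0])

lemma NK_tendsto:
  assumes t: "0 \<le> t"
  shows "(\<lambda>n. NK (X n) t x) \<longlonglongrightarrow> Nlim t x"
proof -
  have "decseq (\<lambda>n. NK (X n) t x)"
    using incseq_X t by (auto intro!: decseq_SucI NK_antimono dest: incseq_SucD)
  moreover have "\<forall>n. 0 \<le> NK (X n) t x" using NK_X_bounds t by simp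
  ultimately obtain L where "(\<lambda>n. NK (X n) t x) \<longlonglongrightarrow> L" using decseq_convergent by blast
  then show ?thesis unfolding Nlim_def by (simp add: limI)
qed

lemma Nlim_bounds:
  assumes "0 \<le> t"
  shows "0 \<le> Nlim t x" "Nlim t x \<le> 1" "\<bar>Nlim t x\<bar> \<le> 1"
proof -
  show "0 \<le> Nlim t x" "Nlim t x \<le> 1"
    using LIMSEQ_le_const[OF NK_tendsto[OF assms]] LIMSEQ_le_const2[OF NK_tendsto[OF assms]] NK_X_bounds assms
    by blast+
  then show "\<bar>Nlim t x\<bar> \<le> 1" by simp
qed

lemma bounded_Nlim: "0 \<le> t \<Longrightarrow> bounded (range (Nlim t))"
  using Nlim_bounds(3) unfolding bounded_iff by auto

lemma Nlim_0: "Nlim 0 x = 0"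
proof -
  have "(\<lambda>n. NK (X n) 0 x) \<longlonglongrightarrow> 0"
    by (rule tendsto_eventually, rule eventually_mono[OF eventually_in_X[of x]]) (simp add: NK_0)
  then show ?thesis using NK_tendsto[of 0 x] LIMSEQ_unique by blast
qed

lemma Ltilde_NK_tendsto: "0 \<le> t \<Longrightarrow> (\<lambda>n. Ltilde b c m (NK (X n) t) x) \<longlonglongrightarrow> Ltilde b c m (Nlim t) x"
  by (rule Ltilde_tendsto[where C = 1]) (auto simp: NK_X_bounds bounded_Nlim NK_tendsto)

lemma Nlim_lipschitz:
  assumes "0 \<le> s" "0 \<le> t"
  shows "\<bar>Nlim t x - Nlim s x\<bar> \<le> 2 * deg x * 1 / m x * \<bar>t - s\<bar>"
proof (rule tendsto_upperbound[OF tendsto_rabs[OF tendsto_diff[OF NK_tendsto NK_tendsto]]])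
  show "\<forall>\<^sub>F n in sequentially. \<bar>NK (X n) t x - NK (X n) s x\<bar> \<le> 2 * deg x * 1 / m x * \<bar>t - s\<bar>"
    using eventually_in_X[of x]
    by eventually_elim (rule lipschitz_of_bounded_heat[OF NK_deriv NK_X_bounds(3)], use assms in auto)
qed (use assms in auto)

lemma Nlim_continuous_on: "continuous_on {0..} (\<lambda>t. Nlim t x)"
proof (rule continuous_on_iff[THEN iffD2], intro ballI allI impI)
  fix s e :: real assume s: "s \<in> {0..}" and e: "0 < e"
  define A where "A = 2 * deg x * 1 / m x + 1"
  have A: "0 < A" unfolding A_def by (intro add_nonneg_pos divide_nonneg_pos) auto
  show "\<exists>d>0. \<forall>t\<in>{0..}. dist t s < d \<longrightarrow> dist (Nlim t x) (Nlim s x) < e"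
  proof (intro exI[of _ "e / A"] conjI ballI impI)
    fix t assume t: "t \<in> {0..}" "dist t s < e / A"
    have "\<bar>Nlim t x - Nlim s x\<bar> \<le> A * \<bar>t - s\<bar>"
      using Nlim_lipschitz[of s t x] s t by (simp add: A_def distrib_right)
    also have "\<dots> < e" using t(2) A by (simp add: dist_real_def field_simps)
    finally show "dist (Nlim t x) (Nlim s x) < e" by (simp add: dist_real_def)
  qed (use e A in auto)
qed

lemma Ltilde_Nlim_continuous_on: "continuous_on {0..} (\<lambda>t. Ltilde b c m (Nlim t) x)"
  unfolding continuous_on_def
proof
  fix t :: real assume t: "t \<in> {0..}"
  show "((\<lambda>s. Ltilde b c m (Nlim s) x) \<longlongrightarrow> Ltilde b c m (Nlim t) x) (at t within {0..})"
  proof (rule Ltilde_tendsto[where C = 1])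
    show "\<forall>\<^sub>F s in at t within {0..}. \<forall>y. \<bar>Nlim s y\<bar> \<le> 1"
      using Nlim_bounds(3) by (auto simp: eventually_at_filter)
    show "bounded (range (Nlim t))" using t bounded_Nlim by simp
    show "((\<lambda>s. Nlim s y) \<longlongrightarrow> Nlim t y) (at t within {0..})" for y
      using Nlim_continuous_on t by (auto simp: continuous_on_def)
  qed
qed

text \<open>Pointwise convergence does not carry derivatives to the limit, but the integrated
  equation passes by dominated convergence, with the vertexwise bound on \<open>Ltilde\<close> as
  majorant. The differential equation is then recovered from continuity of the limiting
  integrand.\<close>

lemma Nlim_integral:
  assumes t: "0 \<le> t"
  shows "Nlim t x = integral {0..t} (\<lambda>s. - Ltilde b c m (Nlim s) x)"
proof -
  \<comment> \<open>The index is shifted by N because the approximation solves the equation at x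
    only once x belongs to the finite set.\<close>
  obtain N where N: "\<And>n. n \<ge> N \<Longrightarrow> x \<in> X n"
    using eventually_in_X[of x] by (auto simp: eventually_sequentially)
  let ?f = "\<lambda>n s. - Ltilde b c m (NK (X (n + N)) s) x"
  have I: "(?f n has_integral NK (X (n + N)) t x - NK (X (n + N)) 0 x) {0..t}" for n
    using NK_deriv[OF finite_X N[of "n + N"]]
    by (intro fundamental_theorem_of_calculus t)
       (auto simp: has_real_derivative_iff_has_vector_derivative intro: has_vector_derivative_at_within)
  have "(\<lambda>n. integral {0..t} (?f n)) \<longlonglongrightarrow> integral {0..t} (\<lambda>s. - Ltilde b c m (Nlim s) x)"
  proof (rule dominated_convergence(2))
    show "?f n integrable_on {0..t}" for n using I by blast
    show "(\<lambda>_. 2 * deg x * 1 / m x) integrable_on {0..t}" by (rule integrable_const_ivl)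
    show "norm (?f n s) \<le> 2 * deg x * 1 / m x" if "s \<in> {0..t}" for n s
      using Ltilde_le[of "NK (X (n + N)) s" 1 x] NK_X_bounds(3) that by simp
    show "(\<lambda>n. ?f n s) \<longlonglongrightarrow> - Ltilde b c m (Nlim s) x" if "s \<in> {0..t}" for s
      using that LIMSEQ_ignore_initial_segment[OF Ltilde_NK_tendsto, of s N x] by (intro tendsto_minus) auto
  qed
  moreover have "integral {0..t} (?f n) = NK (X (n + N)) t x" for n
    using integral_unique[OF I[of n]] N[of "n + N"] by (simp add: NK_0)
  ultimately show ?thesis
    using LIMSEQ_unique LIMSEQ_ignore_initial_segment[OF NK_tendsto[OF t], of N x] by simp
qed

lemma Nlim_deriv:
  assumes t: "0 < t"
  shows "((\<lambda>s. Nlim s x) has_real_derivative - Ltilde b c m (Nlim t) x) (at t)"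
proof -
  have "((\<lambda>u. integral {0..u} (\<lambda>s. - Ltilde b c m (Nlim s) x)) has_real_derivative - Ltilde b c m (Nlim t) x)
      (at t within {0..t + 1})"
    using t by (intro integral_has_real_derivative continuous_intros
        continuous_on_subset[OF Ltilde_Nlim_continuous_on]) auto
  then have "((\<lambda>u. integral {0..u} (\<lambda>s. - Ltilde b c m (Nlim s) x)) has_real_derivative - Ltilde b c m (Nlim t) x) (at t)"
    using t by (simp add: at_within_Icc_at)
  then show ?thesis
  proof (rule has_field_derivative_transform_within)
    show "integral {0..s} (\<lambda>s. - Ltilde b c m (Nlim s) x) = Nlim s x" if "dist s t < t" for s
      using that by (intro Nlim_integral[symmetric]) (auto simp: dist_real_def)
  qed (use t in auto)
qed

lemma heat_solution_Nlim: "heat_solution b c m Nlim"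
  unfolding heat_solution_def Ftilde_def
  using Nlim_continuous_on Nlim_deriv b_mult_abs_summable bounded_Nlim by auto

text \<open>Two suprema are interchanged. For an admissible g, the semigroup is the limit of its
  finite flows, which lie below those of f. Conversely the flow of f on X n sees only the truncation
  of f to X n, and this truncation is itself admissible. Extended values are needed since f may be
  unbounded, as c/m can be.\<close>

lemma sg_ext_tendsto:
  assumes f: "\<And>x. 0 \<le> f x" and t: "0 \<le> t"
  shows "(\<lambda>n. ennreal (heat (X n) f t x)) \<longlonglongrightarrow> sg_ext b c m t f x"
proof -
  have inc: "incseq (\<lambda>n. ennreal (heat (X n) f t x))"
    using heat_X_incseq[where f = f and x = x, OF f t] by (auto simp: incseq_def intro: ennreal_leI)
  have "sg_ext b c m t f x = (SUP n. ennreal (heat (X n) f t x))"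
  proof (rule antisym)
    show "sg_ext b c m t f x \<le> (SUP n. ennreal (heat (X n) f t x))"
      unfolding sg_ext_def
    proof (rule SUP_least, clarify)
      fix g assume g: "fin_supp g" "\<forall>y. 0 \<le> g y \<and> g y \<le> f y"
      have "bounded (range g)"
        by (rule bounded_if_finite_support[of "{x. g x \<noteq> 0}"]) (use g in \<open>auto simp: fin_supp_def\<close>)
      then obtain B where B: "\<And>y. g y \<le> B" by (auto simp: bounded_iff abs_le_iff)
      have eq: "sg b c m t g x = heatlim g t x"
        using sg_eq_heatlim[of g B t] g B t by simp
      have lim: "(\<lambda>n. ennreal (heat (X n) g t x)) \<longlonglongrightarrow> ennreal (heatlim g t x)"
        using g B t by (intro tendsto_ennrealI heat_tendsto_le(1)) auto
      show "ennreal (sg b c m t g x) \<le> (SUP n. ennreal (heat (X n) f t x))"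
        unfolding eq
      proof (rule LIMSEQ_le_const2[OF lim], intro exI allI impI)
        fix n
        have "heat (X n) g t x \<le> heat (X n) f t x"
          using g f t by (intro heat_mono) auto
        then show "ennreal (heat (X n) g t x) \<le> (SUP n. ennreal (heat (X n) f t x))"
          using order_trans[OF ennreal_leI SUP_upper[of n UNIV "\<lambda>n. ennreal (heat (X n) f t x)"]] by simp
      qed
    qed
    show "(SUP n. ennreal (heat (X n) f t x)) \<le> sg_ext b c m t f x"
    proof (rule SUP_least)
      fix n
      let ?g = "trunc (X n) f"
      have g: "fin_supp ?g" "\<And>y. 0 \<le> ?g y" "\<And>y. ?g y \<le> f y"
        using f by (auto simp: fin_supp_def trunc_def intro: finite_subset[OF _ finite_X[of n]])
      have "bounded (range ?g)"
        by (rule bounded_if_finite_support[of "X n"]) (auto simp: trunc_def)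
      then obtain B where B: "\<And>y. ?g y \<le> B" by (auto simp: bounded_iff abs_le_iff)
      have "heat (X n) f t x = heat (X n) ?g t x"
        by (simp add: heat_def trunc_def[abs_def] cong: if_cong)
      also have "\<dots> \<le> heatlim ?g t x" by (rule heat_tendsto_le(2)[OF g(2) B t])
      also have "\<dots> = sg b c m t ?g x" using sg_eq_heatlim[OF g(2) B g(1) t] by simp
      finally have "ennreal (heat (X n) f t x) \<le> ennreal (sg b c m t ?g x)" by (rule ennreal_leI)
      also have "\<dots> \<le> sg_ext b c m t f x"
        unfolding sg_ext_def using g by (intro SUP_upper) auto
      finally show "ennreal (heat (X n) f t x) \<le> sg_ext b c m t f x" .
    qed
  qed
  then show ?thesis using LIMSEQ_SUP[OF inc] by simp
qed

text \<open>The time integral converges by monotone convergence in [0,\<infinity>], which tolerates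
  an unbounded c/m. The finite approximations of the whole expression equal 1 - \<open>NK\<close>,
  so its limit is finite and \<open>enn2real\<close> loses nothing.\<close>

lemma Mfun_eq:
  assumes t: "0 \<le> t"
  shows "Mfun b c m t x = 1 - Nlim t x"
proof -
  let ?q = "\<lambda>y. c y / m y"
  have q: "0 \<le> ?q y" for y by (auto intro: divide_nonneg_pos)
  let ?f = "\<lambda>n s. indicator {0..t} s * ennreal (heat (X n) ?q s x)"
  have "(\<lambda>n. \<integral>\<^sup>+s. ?f n s \<partial>lborel) \<longlonglongrightarrow> (\<integral>\<^sup>+s. indicator {0..t} s * sg_ext b c m s ?q x \<partial>lborel)"
  proof (rule nn_integral_LIMSEQ)
    show "incseq ?f"
    proof (rule incseq_SucI, rule le_funI)
      fix n s
      show "?f n s \<le> ?f (Suc n) s"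
        using incseq_SucD[OF heat_X_incseq[where f = ?q and x = x and t = s, OF q]] by (auto simp: indicator_def intro: ennreal_leI)
    qed
    show "?f n \<in> borel_measurable lborel" for n
      using borel_measurable_continuous_onI[OF heat_continuous_on[OF finite_X, of UNIV n ?q x]] by measurable
    show "(\<lambda>n. ?f n s) \<longlonglongrightarrow> indicator {0..t} s * sg_ext b c m s ?q x" for s
      using sg_ext_tendsto[of ?q s x] q by (auto simp: indicator_def)
  qed
  moreover have "(\<integral>\<^sup>+s. ?f n s \<partial>lborel) = ennreal (heatint (X n) ?q t x)" for n
    using nn_integral_FTC_Icc[of "\<lambda>s. heat (X n) ?q s x" 0 t "\<lambda>t. heatint (X n) ?q t x"]
      heatint_deriv[OF finite_X] heat_nonneg[OF finite_X q] t
      borel_measurable_continuous_onI[OF heat_continuous_on[OF finite_X, of UNIV n ?q x]]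
    by (simp add: mult.commute)
  ultimately have "(\<lambda>n. ennreal (heat (X n) (\<lambda>_. 1) t x) + ennreal (heatint (X n) ?q t x)) \<longlonglongrightarrow>
     sg_ext b c m t (\<lambda>_. 1) x + (\<integral>\<^sup>+s. indicator {0..t} s * sg_ext b c m s ?q x \<partial>lborel)"
    using t by (intro tendsto_add sg_ext_tendsto) auto
  moreover have "ennreal (heat (X n) (\<lambda>_. 1) t x) + ennreal (heatint (X n) ?q t x) = ennreal (1 - NK (X n) t x)" for n
  proof -
    have "0 \<le> heat (X n) (\<lambda>_. 1) t x" by (rule heat_nonneg) (use t in auto)
    moreover have "0 \<le> heatint (X n) ?q t x" by (rule heatint_nonneg[OF finite_X q t])
    ultimately show ?thesis by (simp add: NK_def MK_def)
  qed
  moreover have "(\<lambda>n. ennreal (1 - NK (X n) t x)) \<longlonglongrightarrow> ennreal (1 - Nlim t x)"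
    by (intro tendsto_ennrealI tendsto_intros NK_tendsto t)
  ultimately have "sg_ext b c m t (\<lambda>_. 1) x + (\<integral>\<^sup>+s. indicator {0..t} s * sg_ext b c m s ?q x \<partial>lborel)
      = ennreal (1 - Nlim t x)"
    by (simp add: LIMSEQ_unique)
  then show ?thesis using Nlim_bounds[OF t, of x] by (simp add: Mfun_def)
qed

end

section \<open>The resolvent equation\<close>

context graph_measure
begin

lemma adj_continuous_on:
  assumes cont: "\<And>y. continuous_on {0..} (\<lambda>t. N t y)" and bd: "\<And>t y. 0 \<le> t \<Longrightarrow> \<bar>N t y\<bar> \<le> C"
  shows "continuous_on {0..} (\<lambda>t::real. adj (N t) x)"
  unfolding continuous_on_def
proof
  fix t :: real assume t: "t \<in> {0..}"
  show "((\<lambda>s. adj (N s) x) \<longlongrightarrow> adj (N t) x) (at t within {0..})"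
    by (rule adj_tendsto[where C = C])
       (use cont bd t in \<open>auto simp: eventually_at_filter continuous_on_def\<close>)
qed

lemma Ltilde_continuous_on:
  assumes cont: "\<And>y. continuous_on {0..} (\<lambda>t. N t y)" and bd: "\<And>t y. 0 \<le> t \<Longrightarrow> \<bar>N t y\<bar> \<le> C"
  shows "continuous_on {0..} (\<lambda>t::real. Ltilde b c m (N t) x)"
proof -
  have "bounded (range (N t))" if "0 \<le> t" for t using bd[OF that] by (auto simp: bounded_iff)
  then have "continuous_on {0..} (\<lambda>t. Ltilde b c m (N t) x)
      \<longleftrightarrow> continuous_on {0..} (\<lambda>t. (deg x * N t x - adj (N t) x) / m x)"
    by (intro continuous_on_cong) (auto simp: Ltilde_bounded)
  also have "\<dots>" by (intro continuous_intros cont adj_continuous_on[OF cont bd]) auto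
  finally show ?thesis .
qed

text \<open>Kato's inequality at one vertex: multiply the equation by the sign s of
  \<open>l x\<close> and use s * l y \<le> |l y| in the series. For \<open>l x = 0\<close> the sign
  is 0 and the estimate still holds.\<close>

lemma Ltilde_abs_subsolution:
  assumes l: "bounded (range l)" and eq: "Ltilde b c m l x + \<alpha> * l x = 0"
  shows "Ltilde b c m (\<lambda>y. \<bar>l y\<bar>) x + \<alpha> * \<bar>l x\<bar> \<le> 0"
proof -
  define s where "s = sgn (l x)"
  have l': "bounded (range (\<lambda>y. \<bar>l y\<bar>))" using l by (simp add: bounded_iff)
  have "s * adj l x = (\<Sum>\<^sub>\<infinity>y. s * (b x y * l y))" by (simp add: adj_def infsum_cmult_right')
  also have "\<dots> \<le> adj (\<lambda>y. \<bar>l y\<bar>) x"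
    unfolding adj_def
  proof (intro infsum_mono summable_on_cmult_right b_mult_summable l l')
    fix y
    have "s * l y \<le> \<bar>l y\<bar>" by (auto simp: s_def sgn_if)
    then show "s * (b x y * l y) \<le> b x y * \<bar>l y\<bar>"
      using mult_left_mono[of "s * l y" "\<bar>l y\<bar>" "b x y"] by (simp add: mult.left_commute)
  qed
  finally have "deg x * \<bar>l x\<bar> - adj (\<lambda>y. \<bar>l y\<bar>) x \<le> s * (deg x * l x - adj l x)"
    by (simp add: right_diff_distrib s_def mult_sgn_abs linordered_idom_class.abs_sgn)
  then have "Ltilde b c m (\<lambda>y. \<bar>l y\<bar>) x \<le> s * Ltilde b c m l x"
    using divide_right_mono[OF _ m_nonneg[of x]] by (simp add: Ltilde_bounded l l')
  also have "\<dots> = - \<alpha> * \<bar>l x\<bar>"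
    using eq by (simp add: s_def abs_sgn eq_neg_iff_add_eq_0[symmetric])
  finally show ?thesis by simp
qed

end

text \<open>The mean of N over an exponentially distributed time with rate \<alpha>, that is,
  \<alpha> times the Laplace transform. The weight has mass 1, so bounds 0 and 1 are
  preserved.\<close>

definition exp_mean :: "real \<Rightarrow> (real \<Rightarrow> 'a \<Rightarrow> real) \<Rightarrow> 'a \<Rightarrow> real" where
  "exp_mean \<alpha> N y = (LBINT t:{0..}. \<alpha> * exp (- (t * \<alpha>)) * N t y)"

lemma exp_mean_bounds:
  assumes \<alpha>: "0 < \<alpha>" and cont: "continuous_on {0..} (\<lambda>t. N t y)"
    and bd: "\<And>t. 0 \<le> t \<Longrightarrow> 0 \<le> N t y" "\<And>t. 0 \<le> t \<Longrightarrow> N t y \<le> 1"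
  shows "0 \<le> exp_mean \<alpha> N y" "exp_mean \<alpha> N y \<le> 1"
proof -
  have "(LBINT t:{0..}. \<alpha> * exp (- (t * \<alpha>)) * 0) \<le> exp_mean \<alpha> N y"
    unfolding exp_mean_def by (rule exp_weight_mono[OF \<alpha>, where C = 1]) (use cont bd in auto)
  then show "0 \<le> exp_mean \<alpha> N y" by simp
  have "exp_mean \<alpha> N y \<le> (LBINT t:{0..}. \<alpha> * exp (- (t * \<alpha>)) * 1)"
    unfolding exp_mean_def by (rule exp_weight_mono[OF \<alpha>, where C = 1]) (use cont bd in auto)
  then show "exp_mean \<alpha> N y \<le> 1" using exp_weight_integral[OF \<alpha>] by simp
qed

context exhausted_graph
begin

lemma sum_X_tendsto:
  fixes f :: "'v \<Rightarrow> real"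
  assumes "f summable_on UNIV"
  shows "(\<lambda>n. \<Sum>y\<in>X n. f y) \<longlonglongrightarrow> (\<Sum>\<^sub>\<infinity>y. f y)"
proof (rule filterlim_compose[OF infsum_tendsto[OF assms]])
  show "filterlim X (finite_subsets_at_top UNIV) sequentially"
    unfolding filterlim_iff eventually_finite_subsets_at_top
    using eventually_subset_X by (fastforce elim: eventually_mono)
qed

text \<open>\<open>Ltilde\<close> commutes with the mean, and integration by parts turns the time
  derivative into multiplication by \<alpha> because N starts from 0. The heat equation and the
  initial value are asked for at the single vertex x, so that the result serves the finite
  approximations on X n as well as their limit.\<close>

lemma exp_mean_solution:
  assumes \<alpha>: "0 < \<alpha>" and cont: "\<And>y. continuous_on {0..} (\<lambda>t. N t y)"
    and bd: "\<And>t y. 0 \<le> t \<Longrightarrow> 0 \<le> N t y" "\<And>t y. 0 \<le> t \<Longrightarrow> N t y \<le> 1"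
    and N0: "N 0 x = 0"
    and deriv: "\<And>t. 0 < t \<Longrightarrow> ((\<lambda>s. N s x) has_real_derivative - Ltilde b c m (N t) x) (at t)"
  shows "Ltilde b c m (exp_mean \<alpha> N) x + \<alpha> * exp_mean \<alpha> N x = 0"
proof -
  let ?k = "\<lambda>t. \<alpha> * exp (- (t * \<alpha>))"
  have bd': "\<bar>N t y\<bar> \<le> 1" if "0 \<le> t" for t y using bd[OF that] by (simp add: abs_le_iff order_trans[of "- 1" 0])
  have bN: "bounded (range (N t))" if "0 \<le> t" for t using bd'[OF that] by (auto simp: bounded_iff)
  have wb: "0 \<le> exp_mean \<alpha> N y" "exp_mean \<alpha> N y \<le> 1" for y
    by (rule exp_mean_bounds[OF \<alpha> cont bd]; assumption)+
  have bw: "bounded (range (exp_mean \<alpha> N))"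
    unfolding bounded_iff using wb by (intro exI[of _ 1]) auto
  have intN: "set_integrable lborel {0..} (\<lambda>t. ?k t * N t y)" for y
    by (rule exp_weight_mult_integrable[OF \<alpha> cont bd'])
  have adjN: "\<bar>adj (N t) x\<bar> \<le> deg x * 1" if "0 \<le> t" for t by (rule adj_le) (rule bd'[OF that])
  note adjc = adj_continuous_on[OF cont bd']
  have intadj: "set_integrable lborel {0..} (\<lambda>t. ?k t * adj (N t) x)"
    by (rule exp_weight_mult_integrable[OF \<alpha> adjc adjN])
  \<comment> \<open>The series over V and the time integral are exchanged along X n: finite sums
    commute with the integral, and the partial sums are dominated by \<open>deg x\<close>.\<close>
  have "(\<lambda>n. \<Sum>y\<in>X n. b x y * exp_mean \<alpha> N y) \<longlonglongrightarrow> adj (exp_mean \<alpha> N) x"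
    unfolding adj_def by (rule sum_X_tendsto[OF b_mult_summable[OF bw]])
  moreover have "(\<Sum>y\<in>X n. b x y * exp_mean \<alpha> N y) = (LBINT t:{0..}. ?k t * (\<Sum>y\<in>X n. b x y * N t y))" for n
  proof -
    have "(LBINT t:{0..}. ?k t * (\<Sum>y\<in>X n. b x y * N t y)) = (LBINT t:{0..}. \<Sum>y\<in>X n. b x y * (?k t * N t y))"
      by (simp add: sum_distrib_left mult_ac)
    also have "\<dots> = (\<Sum>y\<in>X n. LBINT t:{0..}. b x y * (?k t * N t y))"
      unfolding set_lebesgue_integral_def scaleR_sum_right
      using intN by (intro Bochner_Integration.integral_sum) (auto simp: set_integrable_def mult.left_commute)
    finally show ?thesis by (simp add: exp_mean_def)
  qed
  moreover have "(\<lambda>n. LBINT t:{0..}. ?k t * (\<Sum>y\<in>X n. b x y * N t y)) \<longlonglongrightarrow> (LBINT t:{0..}. ?k t * adj (N t) x)"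
  proof (rule exp_weight_tendsto[OF \<alpha> _ adjc, where C = "deg x"])
    fix n and t :: real assume t: "0 \<le> t"
    have "\<bar>\<Sum>y\<in>X n. b x y * N t y\<bar> \<le> (\<Sum>y\<in>X n. b x y)"
      by (rule order_trans[OF sum_abs]) (auto intro!: sum_mono mult_left_le bd'[OF t] simp: abs_mult)
    also have "\<dots> \<le> (\<Sum>\<^sub>\<infinity>y. b x y)" by (intro finite_sum_le_infsum b_summable) auto
    also have "\<dots> \<le> deg x" by (simp add: deg_def)
    finally show "\<bar>\<Sum>y\<in>X n. b x y * N t y\<bar> \<le> deg x" .
  next
    fix t :: real assume t: "0 \<le> t"
    show "(\<lambda>n. \<Sum>y\<in>X n. b x y * N t y) \<longlonglongrightarrow> adj (N t) x"
      unfolding adj_def by (rule sum_X_tendsto[OF b_mult_summable[OF bN[OF t]]])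
  qed (intro continuous_intros cont)
  ultimately have adjw: "adj (exp_mean \<alpha> N) x = (LBINT t:{0..}. ?k t * adj (N t) x)"
    using LIMSEQ_unique by simp
  have "(LBINT t:{0..}. ?k t * Ltilde b c m (N t) x)
      = (LBINT t:{0..}. deg x / m x * (?k t * N t x) - 1 / m x * (?k t * adj (N t) x))"
    by (rule set_lebesgue_integral_cong) (auto simp: Ltilde_bounded[OF bN] diff_divide_distrib right_diff_distrib)
  also have "\<dots> = deg x / m x * exp_mean \<alpha> N x - 1 / m x * adj (exp_mean \<alpha> N) x"
    unfolding exp_mean_def[of \<alpha> N x] adjw
    by (subst set_integral_diff(2)) (auto simp only: set_integral_mult_right intro!: set_integrable_mult_right intN intadj)
  also have "\<dots> = Ltilde b c m (exp_mean \<alpha> N) x"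
    by (simp add: Ltilde_bounded[OF bw] diff_divide_distrib)
  finally have "(LBINT t:{0..}. ?k t * Ltilde b c m (N t) x) = Ltilde b c m (exp_mean \<alpha> N) x" .
  moreover have "(LBINT t:{0..}. ?k t * - Ltilde b c m (N t) x) = \<alpha> * exp_mean \<alpha> N x - \<alpha> * N 0 x"
    unfolding exp_mean_def
  proof (rule exp_weight_deriv[OF \<alpha> cont bd' _ _ deriv])
    show "continuous_on {0..} (\<lambda>t. - Ltilde b c m (N t) x)"
      by (intro continuous_on_minus Ltilde_continuous_on[OF cont bd'])
    show "\<bar>- Ltilde b c m (N t) x\<bar> \<le> 2 * deg x * 1 / m x" if "0 \<le> t" for t
      unfolding abs_minus_cancel by (rule Ltilde_le) (rule bd'[OF that])
  qed
  moreover have "(LBINT t:{0..}. ?k t * - Ltilde b c m (N t) x) = - (LBINT t:{0..}. ?k t * Ltilde b c m (N t) x)"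
    by (simp add: set_lebesgue_integral_def)
  ultimately show ?thesis using N0 by simp
qed

section \<open>The function w: maximality and nontriviality\<close>

lemma wfun_eq: "wfun b c m \<alpha> = exp_mean \<alpha> Nlim"
  unfolding wfun_def exp_mean_def by (intro ext set_lebesgue_integral_cong) (auto simp: Mfun_eq)

lemma wfun_bounds:
  assumes "0 < \<alpha>"
  shows "0 \<le> wfun b c m \<alpha> x" "wfun b c m \<alpha> x \<le> 1"
  unfolding wfun_eq using exp_mean_bounds[OF assms Nlim_continuous_on] Nlim_bounds by auto

lemma wfun_solution:
  assumes "0 < \<alpha>"
  shows "Ltilde b c m (wfun b c m \<alpha>) x + \<alpha> * wfun b c m \<alpha> x = 0"
  unfolding wfun_eq
  by (rule exp_mean_solution[OF assms]) (auto simp: Nlim_bounds Nlim_0 Nlim_continuous_on Nlim_deriv)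

lemma wfun_maximal:
  assumes \<alpha>: "0 < \<alpha>" and l: "\<And>x. 0 \<le> l x" "\<And>x. l x \<le> 1"
    and sub: "\<And>x. Ltilde b c m l x + \<alpha> * l x \<le> 0"
  shows "l x \<le> wfun b c m \<alpha> x"
proof -
  have "l x \<le> exp_mean \<alpha> (NK (X n)) x" for n
  proof -
    let ?w = "exp_mean \<alpha> (NK (X n))"
    have wb: "0 \<le> ?w y" "?w y \<le> 1" for y
      by (rule exp_mean_bounds[OF \<alpha>];
          simp add: NK_continuous_on NK_X_bounds)+
    have bw: "bounded (range ?w)" unfolding bounded_iff using wb by (intro exI[of _ 1]) auto
    have bl: "bounded (range l)" unfolding bounded_iff using l by (intro exI[of _ 1]) auto
    have "0 \<le> ?w x - l x"
    proof (rule elliptic_minimum_principle[OF finite_X _ _ \<alpha>])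
      \<comment> \<open>Off X n the approximation is constantly 1 in time, so its mean is the total
        mass 1 and the bound on l settles the boundary condition.\<close>
      fix y assume "y \<notin> X n"
      then have "?w y = 1" using exp_weight_integral[OF \<alpha>] by (simp add: exp_mean_def NK_off)
      then show "0 \<le> ?w y - l y" using l by simp
    next
      fix y assume y: "y \<in> X n"
      have "Ltilde b c m ?w y + \<alpha> * ?w y = 0"
        by (rule exp_mean_solution[OF \<alpha>])
           (auto simp: NK_continuous_on NK_X_bounds NK_0 y intro: NK_deriv)
      then show "0 \<le> Ltilde b c m (\<lambda>x. ?w x - l x) y + \<alpha> * (?w y - l y)"
        using sub[of y] by (simp add: Ltilde_diff[OF bw bl] right_diff_distrib)
    qed
    then show ?thesis by simp
  qed
  moreover have "(\<lambda>n. exp_mean \<alpha> (NK (X n)) x) \<longlonglongrightarrow> exp_mean \<alpha> Nlim x"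
    unfolding exp_mean_def
    by (rule exp_weight_tendsto[OF \<alpha> NK_continuous_on[OF finite_X] Nlim_continuous_on NK_X_bounds(3) NK_tendsto])
  ultimately show ?thesis unfolding wfun_eq by (intro LIMSEQ_le_const) auto
qed

text \<open>The weight is strictly positive and \<open>Nlim\<close> is nonnegative and continuous in
  time, so the mean at a vertex vanishes only if \<open>Nlim\<close> vanishes there at all times.
  The right-hand side is free of \<alpha>, which is why some \<alpha> and every \<alpha> amount to
  the same.\<close>

lemma wfun_nonzero_iff:
  assumes \<alpha>: "0 < \<alpha>"
  shows "wfun b c m \<alpha> \<noteq> (\<lambda>_. 0) \<longleftrightarrow> (\<exists>x. \<exists>t>0. Mfun b c m t x < 1)"
proof
  assume "wfun b c m \<alpha> \<noteq> (\<lambda>_. 0)"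
  then obtain x where x: "exp_mean \<alpha> Nlim x \<noteq> 0" by (auto simp: wfun_eq fun_eq_iff)
  have "\<exists>t\<ge>0. Nlim t x \<noteq> 0"
  proof (rule ccontr)
    assume "\<not> (\<exists>t\<ge>0. Nlim t x \<noteq> 0)"
    then have "exp_mean \<alpha> Nlim x = (LBINT t:{0..}. \<alpha> * exp (- (t * \<alpha>)) * 0)"
      unfolding exp_mean_def by (intro set_lebesgue_integral_cong) auto
    with x show False by simp
  qed
  then obtain t where t: "0 \<le> t" "Nlim t x \<noteq> 0" by blast
  then have "0 < t" using Nlim_0[of x] by (cases "t = 0") auto
  moreover have "Mfun b c m t x < 1" using Mfun_eq[OF t(1), of x] Nlim_bounds(1)[OF t(1), of x] t(2) by simp
  ultimately show "\<exists>x. \<exists>t>0. Mfun b c m t x < 1" by blast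
next
  assume "\<exists>x. \<exists>t>0. Mfun b c m t x < 1"
  then obtain x t where t: "0 < t" "Mfun b c m t x < 1" by blast
  then have "Nlim t x \<noteq> 0" using Mfun_eq[of t x] by auto
  then have "wfun b c m \<alpha> x \<noteq> 0"
    using exp_weight_eq_0D[OF \<alpha> Nlim_continuous_on Nlim_bounds(1,2), of x t] t
    by (auto simp: wfun_eq exp_mean_def)
  then show "wfun b c m \<alpha> \<noteq> (\<lambda>_. 0)" by auto
qed

text \<open>One direction takes \<open>Nlim\<close> itself as the solution. For the other, a
  nonnegative solution bounded by C with initial value 0 lies below C times \<open>Nlim\<close>, so
  it can be nonzero only where \<open>Nlim\<close> is.\<close>

lemma Mfun_less_1_iff:
  "(\<exists>x. \<exists>t>0. Mfun b c m t x < 1) \<longleftrightarrow>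
    (\<exists>N. heat_solution b c m N \<and> (\<forall>t\<ge>0. \<forall>x. 0 \<le> N t x) \<and>
       (\<exists>C. \<forall>t\<ge>0. \<forall>x. N t x \<le> C) \<and> (\<forall>x. N 0 x = 0) \<and> (\<exists>t\<ge>0. \<exists>x. N t x \<noteq> 0))"
proof
  assume "\<exists>x. \<exists>t>0. Mfun b c m t x < 1"
  then obtain x t where t: "0 < t" "Mfun b c m t x < 1" by blast
  then have "0 \<le> t" "Nlim t x \<noteq> 0" using Mfun_eq[of t x] by auto
  then show "\<exists>N. heat_solution b c m N \<and> (\<forall>t\<ge>0. \<forall>x. 0 \<le> N t x) \<and>
       (\<exists>C. \<forall>t\<ge>0. \<forall>x. N t x \<le> C) \<and> (\<forall>x. N 0 x = 0) \<and> (\<exists>t\<ge>0. \<exists>x. N t x \<noteq> 0)"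
    using heat_solution_Nlim Nlim_bounds Nlim_0 by (intro exI[of _ Nlim]) blast
next
  assume "\<exists>N. heat_solution b c m N \<and> (\<forall>t\<ge>0. \<forall>x. 0 \<le> N t x) \<and>
       (\<exists>C. \<forall>t\<ge>0. \<forall>x. N t x \<le> C) \<and> (\<forall>x. N 0 x = 0) \<and> (\<exists>t\<ge>0. \<exists>x. N t x \<noteq> 0)"
  then obtain N C t x where N: "heat_solution b c m N" "\<And>t x. 0 \<le> t \<Longrightarrow> 0 \<le> N t x"
      "\<And>t x. 0 \<le> t \<Longrightarrow> N t x \<le> C" "\<And>x. N 0 x = 0" and t: "0 \<le> t" "N t x \<noteq> 0"
    by blast
  have C: "0 \<le> C" using N(2,3)[of 0 x] by simp
  have bN: "bounded (range (N s))" if "0 < s" for s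
    unfolding bounded_iff using N(2,3)[of s] that by (intro exI[of _ C]) auto
  have "N t x \<le> C * NK (X n) t x" for n
    using N(1) by (intro bounded_solution_le_NK C N(3) bN t) (auto simp: heat_solution_def N(4))
  moreover have "(\<lambda>n. C * NK (X n) t x) \<longlonglongrightarrow> C * Nlim t x"
    by (intro tendsto_intros NK_tendsto t)
  ultimately have "N t x \<le> C * Nlim t x" by (intro LIMSEQ_le_const) auto
  then have "Nlim t x \<noteq> 0" using N(2)[OF t(1), of x] t(2) by auto
  then have "0 < Nlim t x" using Nlim_bounds(1)[OF t(1), of x] by simp
  then have "Mfun b c m t x < 1" using Mfun_eq[OF t(1)] by simp
  moreover have "0 < t" using t N(4) by (cases "t = 0") auto
  ultimately show "\<exists>x. \<exists>t>0. Mfun b c m t x < 1" by blast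
qed

text \<open>Division by the bound C brings l into the range [0, 1], where maximality of w applies; C
  is positive because l is not identically 0.\<close>

lemma subsolution_imp_wfun_nonzero:
  assumes \<alpha>: "0 < \<alpha>" and l: "l \<noteq> (\<lambda>_. 0)" "\<forall>x. 0 \<le> l x" "\<exists>C. \<forall>x. \<bar>l x\<bar> \<le> C"
    and sub: "\<forall>x. Ltilde b c m l x + \<alpha> * l x \<le> 0"
  shows "wfun b c m \<alpha> \<noteq> (\<lambda>_. 0)"
proof -
  obtain x where x: "l x \<noteq> 0" using l(1) by auto
  obtain C where C: "\<And>x. \<bar>l x\<bar> \<le> C" using l(3) by blast
  have C0: "0 < C" using C[of x] x by linarith
  have "1 / C * l x \<le> wfun b c m \<alpha> x"
  proof (rule wfun_maximal[OF \<alpha>])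
    fix y
    show "0 \<le> 1 / C * l y" using l(2) C0 by simp
    show "1 / C * l y \<le> 1" using C[of y] C0 by (simp add: divide_le_eq abs_le_iff)
    have "1 / C * (Ltilde b c m l y + \<alpha> * l y) \<le> 0"
      using sub C0 by (intro mult_nonneg_nonpos) auto
    then show "Ltilde b c m (\<lambda>y. 1 / C * l y) y + \<alpha> * (1 / C * l y) \<le> 0"
      unfolding Ltilde_scale by (simp add: distrib_left mult.left_commute)
  qed
  moreover have "0 < 1 / C * l x" using l(2) x C0 by (simp add: order_less_le)
  ultimately show ?thesis by (metis not_less)
qed

end

lemma (in graph_measure) exhausted_graph_exists:
  assumes "countable (UNIV :: 'v set)"
  shows "\<exists>X. exhausted_graph b c m X"
proof
  show "exhausted_graph b c m (\<lambda>n. from_nat_into UNIV ` {..<n})"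
  proof
    show "incseq (\<lambda>n. from_nat_into UNIV ` {..<n} :: 'v set)" by (auto simp: incseq_def)
    \<comment> \<open>The initial segment is strict, so the vertex with index k first appears in the
      segment of length k + 1.\<close>
    have "x \<in> from_nat_into UNIV ` {..<Suc (to_nat_on UNIV x)}" for x :: 'v
      by (rule image_eqI[of _ _ "to_nat_on UNIV x"]) (auto simp: assms)
    then show "(\<Union>n. from_nat_into UNIV ` {..<n}) = (UNIV :: 'v set)" by blast
  qed auto
qed

theorem mainTheorem15:
  fixes b :: "'v \<Rightarrow> 'v \<Rightarrow> real" and c m :: "'v \<Rightarrow> real"
  assumes "countable (UNIV :: 'v set)" and "infinite (UNIV :: 'v set)"
    and "weighted_graph b c" and "is_measure_on m"
  shows
    "(\<forall>\<alpha>>0.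
        (\<forall>x. 0 \<le> wfun b c m \<alpha> x \<and> wfun b c m \<alpha> x \<le> 1) \<and>
        (\<forall>x. Ltilde b c m (wfun b c m \<alpha>) x + \<alpha> * wfun b c m \<alpha> x = 0) \<and>
        (\<forall>l. (\<forall>x. 0 \<le> l x \<and> l x \<le> 1) \<and> (\<forall>x. Ltilde b c m l x + \<alpha> * l x \<le> 0)
             \<longrightarrow> (\<forall>x. l x \<le> wfun b c m \<alpha> x)))
     \<and>
     ((\<forall>\<alpha>>0. \<exists>l. l \<noteq> (\<lambda>_. 0) \<and> (\<forall>x. 0 \<le> l x) \<and> (\<exists>C. \<forall>x. \<bar>l x\<bar> \<le> C) \<and>
                 (\<forall>x. Ltilde b c m l x + \<alpha> * l x \<le> 0))
      \<longleftrightarrow>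
      (\<forall>\<alpha>>0. \<exists>l. l \<noteq> (\<lambda>_. 0) \<and> (\<exists>C. \<forall>x. \<bar>l x\<bar> \<le> C) \<and>
                 (\<forall>x. Ltilde b c m l x + \<alpha> * l x = 0)))
     \<and>
     ((\<forall>\<alpha>>0. \<exists>l. l \<noteq> (\<lambda>_. 0) \<and> (\<exists>C. \<forall>x. \<bar>l x\<bar> \<le> C) \<and>
                 (\<forall>x. Ltilde b c m l x + \<alpha> * l x = 0))
      \<longleftrightarrow>
      (\<forall>\<alpha>>0. \<exists>l. l \<noteq> (\<lambda>_. 0) \<and> (\<forall>x. 0 \<le> l x) \<and> (\<exists>C. \<forall>x. \<bar>l x\<bar> \<le> C) \<and>
                 (\<forall>x. Ltilde b c m l x + \<alpha> * l x = 0)))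
     \<and>
     ((\<forall>\<alpha>>0. \<exists>l. l \<noteq> (\<lambda>_. 0) \<and> (\<forall>x. 0 \<le> l x) \<and> (\<exists>C. \<forall>x. \<bar>l x\<bar> \<le> C) \<and>
                 (\<forall>x. Ltilde b c m l x + \<alpha> * l x = 0))
      \<longleftrightarrow> (\<exists>\<alpha>>0. wfun b c m \<alpha> \<noteq> (\<lambda>_. 0)))
     \<and>
     ((\<exists>\<alpha>>0. wfun b c m \<alpha> \<noteq> (\<lambda>_. 0)) \<longleftrightarrow> (\<forall>\<alpha>>0. wfun b c m \<alpha> \<noteq> (\<lambda>_. 0)))
     \<and>
     ((\<forall>\<alpha>>0. wfun b c m \<alpha> \<noteq> (\<lambda>_. 0)) \<longleftrightarrow> (\<exists>x. \<exists>t>0. Mfun b c m t x < 1))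
     \<and>
     ((\<exists>x. \<exists>t>0. Mfun b c m t x < 1) \<longleftrightarrow>
      (\<exists>N. heat_solution b c m N \<and> (\<forall>t\<ge>0. \<forall>x. 0 \<le> N t x) \<and>
           (\<exists>C. \<forall>t\<ge>0. \<forall>x. N t x \<le> C) \<and> (\<forall>x. N 0 x = 0) \<and>
           (\<exists>t\<ge>0. \<exists>x. N t x \<noteq> 0)))"
    (is "?w \<and> (?i \<longleftrightarrow> ?ii) \<and> (_ \<longleftrightarrow> ?iii) \<and> (_ \<longleftrightarrow> ?iv) \<and> (_ \<longleftrightarrow> ?iv') \<and> (_ \<longleftrightarrow> ?v) \<and> (_ \<longleftrightarrow> ?vi)")
proof -
  interpret graph_measure b c m using assms(3,4) by unfold_locales
  obtain X where "exhausted_graph b c m X" using exhausted_graph_exists[OF assms(1)] by blast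
  then interpret exhausted_graph b c m X .
  have w: ?w using wfun_bounds wfun_solution wfun_maximal by blast
  \<comment> \<open>Both quantified forms of (iv) are compared with (v), which contains no \<alpha>;
    \<alpha> = 1 serves as an arbitrary instance.\<close>
  have iv: "?iv \<longleftrightarrow> ?v"
  proof
    assume ?iv
    then obtain \<alpha> where "0 < \<alpha>" "wfun b c m \<alpha> \<noteq> (\<lambda>_. 0)" by blast
    then show ?v using wfun_nonzero_iff by simp
  next
    assume ?v
    then show ?iv using wfun_nonzero_iff[of 1] by (intro exI[of _ 1]) simp
  qed
  have iv': "?iv' \<longleftrightarrow> ?v"
  proof
    assume ?iv'
    then have "wfun b c m 1 \<noteq> (\<lambda>_. 0)" by simp
    then show ?v using wfun_nonzero_iff[of 1] by simp
  next
    assume ?v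
    then show ?iv' using wfun_nonzero_iff by simp
  qed
  \<comment> \<open>The remaining conditions form a cycle: (i), (iv) for every \<alpha>, (iii), (ii)
    and back to (i). The witness for (iii) is w, and the way back replaces a solution of arbitrary
    sign by its absolute value.\<close>
  have ?iv' if ?i
  proof (intro allI impI)
    fix \<alpha> :: real assume \<alpha>: "0 < \<alpha>"
    from that[rule_format, OF \<alpha>] obtain l where
      l: "l \<noteq> (\<lambda>_. 0)" "\<forall>x. 0 \<le> l x" "\<exists>C. \<forall>x. \<bar>l x\<bar> \<le> C" "\<forall>x. Ltilde b c m l x + \<alpha> * l x \<le> 0"
      by (elim exE conjE) blast
    show "wfun b c m \<alpha> \<noteq> (\<lambda>_. 0)" by (rule subsolution_imp_wfun_nonzero[OF \<alpha> l])
  qed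
  moreover have ?iii if ?iv'
  proof (intro allI impI exI conjI)
    fix \<alpha> :: real assume \<alpha>: "0 < \<alpha>"
    show "wfun b c m \<alpha> \<noteq> (\<lambda>_. 0)" using that \<alpha> by blast
    show "0 \<le> wfun b c m \<alpha> x" for x by (rule wfun_bounds[OF \<alpha>])
    show "\<bar>wfun b c m \<alpha> x\<bar> \<le> 1" for x using wfun_bounds[OF \<alpha>, of x] by simp
    show "Ltilde b c m (wfun b c m \<alpha>) x + \<alpha> * wfun b c m \<alpha> x = 0" for x by (rule wfun_solution[OF \<alpha>])
  qed
  moreover have ?ii if ?iii
  proof (intro allI impI)
    fix \<alpha> :: real assume "0 < \<alpha>"
    from that[rule_format, OF this]
    show "\<exists>l. l \<noteq> (\<lambda>_. 0) \<and> (\<exists>C. \<forall>x. \<bar>l x\<bar> \<le> C) \<and> (\<forall>x. Ltilde b c m l x + \<alpha> * l x = 0)"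
      by (elim exE conjE) (intro exI conjI)
  qed
  moreover have ?i if ?ii
  proof (intro allI impI)
    fix \<alpha> :: real assume "0 < \<alpha>"
    from that[rule_format, OF this] obtain l C where
      l: "l \<noteq> (\<lambda>_. 0)" "\<And>x. \<bar>l x\<bar> \<le> C" "\<And>x. Ltilde b c m l x + \<alpha> * l x = 0"
      by (elim exE conjE) blast
    have bl: "bounded (range l)" unfolding bounded_iff using l(2) by auto
    show "\<exists>l. l \<noteq> (\<lambda>_. 0) \<and> (\<forall>x. 0 \<le> l x) \<and> (\<exists>C. \<forall>x. \<bar>l x\<bar> \<le> C) \<and> (\<forall>x. Ltilde b c m l x + \<alpha> * l x \<le> 0)"
    proof (intro exI[of _ "\<lambda>x. \<bar>l x\<bar>"] conjI allI exI[of _ C])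
      show "(\<lambda>x. \<bar>l x\<bar>) \<noteq> (\<lambda>_. 0)" using l(1) by (auto simp: fun_eq_iff)
    qed (use l(2) Ltilde_abs_subsolution[OF bl l(3)] in auto)
  qed
  ultimately have "?i \<longleftrightarrow> ?ii" "?ii \<longleftrightarrow> ?iii" "?iii \<longleftrightarrow> ?iv'" by argo+
  with w iv iv' Mfun_less_1_iff show ?thesis by argo
qed

end
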